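(* Let $\lambda\in\mathbb{C}$ with $|\lambda|=1$, let $\mathcal{A}$ be the non-commutative torus with unitary generators $U,V$ satisfying $UV=\lambda VU$, and let $\mathcal{A}_0$ be the $*$-subalgebra generated by $U$ and $V$. Fix $\mu,\nu\in\mathbb{C}$ with $|\mu|=|\nu|=1$ and $\mu\ne1$, and let $$\phi:\mathcal{A}_0\to\mathcal{A}_0\otimes\mathcal{B}(\mathbb{C}^2);\quad x\mapsto\begin{bmatrix}\tau(x)&-\mu\delta(x)\\ \delta(x)&\pi_{\mu,\nu}(x)-x\end{bmatrix},$$ where, by linear extension, for all $m,n\in\mathbb{Z}$, $$\pi_{\mu,\nu}(U^mV^n)=\mu^m\nu^nU^mV^n,\qquad\delta(U^mV^n)=\frac{1-\mu^m\nu^n}{1-\mu}U^mV^n,\qquad\tau:=\frac{\mu}{1-\mu}\delta.$$ There exists an adapted family $j=(j_t)_{t\ge0}$ of unital $*$-homomorphisms from $\mathcal{A}$ to $\mathcal{B}(\mathsf{h}\bar\otimes\mathcal{F})$ such that $$\langle u\varepsilon(f),j_t(x)v\varepsilon(g)\rangle=\langle u\varepsilon(f),(xv)\varepsilon(g)\rangle+\int_0^t\langle u\varepsilon(f),j_s\bigl(\phi^{\widehat{f}(s)}_{\widehat{g}(s)}(x)\bigr)v\varepsilon(g)\rangle\,ds$$ for all $u,v\in\mathsf{h}$, $f,g\in L^2(\mathbb{R}_+;\mathbb{C})$, $x\in\mathcal{A}_0$ and $t\ge0$.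
   Context: The non-commutative torus is the universal $C^*$-algebra generated by unitaries $U$ and $V$ satisfying $UV=\lambda VU$; $\{U^mV^n:m,n\in\mathbb{Z}\}$ is a basis of $\mathcal{A}_0$. It is identified with a $C^*$-subalgebra of $\mathcal{B}(\mathsf{h})$, $\mathsf{h}:=\ell^2(\mathbb{Z}^2)$, via $(Uu)_{m,n}=u_{m+1,n}$ and $(Vu)_{m,n}=\lambda^mu_{m,n+1}$. Inner products are linear in the second variable; $\otimes$ is the algebraic and $\bar\otimes$ the Hilbert-space tensor product; $|\xi\rangle:\lambda\mapsto\lambda\xi$, $\langle\xi|:\eta\mapsto\langle\xi,\eta\rangle$. The multiplicity space is $\mathsf{k}=\mathbb{C}$ and $\widehat{\mathsf{k}}=\mathbb{C}\oplus\mathsf{k}=\mathbb{C}^2$. For $\xi,\chi\in\widehat{\mathsf{k}}$, $\phi^\xi_\chi(x):=(1_{\mathsf{h}}\otimes\langle\xi|)\phi(x)(1_{\mathsf{h}}\otimes|\chi\rangle)$. $\mathcal{F}$ is Boson Fock space over $L^2(\mathbb{R}_+;\mathsf{k})$ with exponential vectors $\varepsilon(f)$, $\langle\varepsilon(f),\varepsilon(g)\rangle=e^{\langle f,g\rangle}$; $u\varepsilon(f):=u\otimes\varepsilon(f)$; $\widehat{f}(t):=(1,f(t))\in\widehat{\mathsf{k}}$; $f_{t)}:=1_{[0,t)}f$, $f_{[t}:=1_{[t,\infty)}f$. Adapted means $\langle u\varepsilon(f),j_t(a)v\varepsilon(g)\rangle=\langle u\varepsilon(f_{t)}),j_t(a)v\varepsilon(g_{t)})\rangle\langle\varepsilon(f_{[t}),\varepsilon(g_{[t})\rangle$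 for all $u,v,f,g,t$ and $a\in\mathcal{A}$. *)

theory Defs
  imports "HOL-Analysis.Analysis"
begin

class scaleC =
  fixes scaleC :: "complex \<Rightarrow> 'a \<Rightarrow> 'a" (infixr \<open>*\<^sub>C\<close> 75)

class cinner =
  fixes cinner :: "'a \<Rightarrow> 'a \<Rightarrow> complex"

text \<open>Complex Hilbert spaces. The inner product is linear in the second variable; the real
  structure (norm, topology) is the one inherited from \<^class>\<open>real_inner\<close>, with real inner product
  the real part of the complex one.\<close>

class complex_hilbert = scaleC + cinner + real_inner + complete_space +
  assumes scaleC_add_right: "c *\<^sub>C (x + y) = c *\<^sub>C x + c *\<^sub>C y"
    and scaleC_add_left: "(c + d) *\<^sub>C x = c *\<^sub>C x + d *\<^sub>C x"
    and scaleC_scaleC: "c *\<^sub>C d *\<^sub>C x = (c * d) *\<^sub>C x"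
    and scaleR_scaleC: "r *\<^sub>R x = complex_of_real r *\<^sub>C x"
    and cinner_commute: "cinner x y = cnj (cinner y x)"
    and cinner_add_right: "cinner x (y + z) = cinner x y + cinner x z"
    and cinner_scaleC_right: "cinner x (c *\<^sub>C y) = c * cinner x y"
    and inner_eq_Re_cinner: "inner x y = Re (cinner x y)"

instance complex_hilbert \<subseteq> banach ..

lemma scaleC_one [simp]: "1 *\<^sub>C x = (x :: 'a :: complex_hilbert)"
  using scaleR_scaleC[of 1 x] by simp

lemma scaleC_zero_left [simp]: "0 *\<^sub>C x = (0 :: 'a :: complex_hilbert)"
  using scaleR_scaleC[of 0 x] by simp

lemma cinner_add_left: "cinner (x + y) z = cinner x z + cinner (y :: 'a :: complex_hilbert) z"
  by (metis cinner_add_right cinner_commute complex_cnj_add)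

lemma cinner_scaleC_left: "cinner (c *\<^sub>C x) y = cnj c * cinner (x :: 'a :: complex_hilbert) y"
  by (metis cinner_scaleC_right cinner_commute complex_cnj_mult)

lemma cinner_self: "cinner x x = complex_of_real ((norm (x :: 'a :: complex_hilbert))\<^sup>2)"
proof -
  have "Im (cinner x x) = 0"
    using cinner_commute[of x x] by (metis Reals_cnj_iff complex_is_Real_iff)
  moreover have "Re (cinner x x) = (norm x)\<^sup>2"
    by (simp add: power2_norm_eq_inner inner_eq_Re_cinner)
  ultimately show ?thesis by (simp add: complex_eq_iff)
qed

lemma norm_scaleC: "norm (c *\<^sub>C x) = cmod c * norm (x :: 'a :: complex_hilbert)"
proof -
  have "complex_of_real ((norm (c *\<^sub>C x))\<^sup>2) = cnj c * c * complex_of_real ((norm x)\<^sup>2)"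
    using cinner_self[of "c *\<^sub>C x"] cinner_self[of x]
    by (simp add: cinner_scaleC_left cinner_scaleC_right mult_ac)
  also have "\<dots> = complex_of_real ((cmod c * norm x)\<^sup>2)"
    using complex_norm_square[of c] by (simp add: power_mult_distrib mult_ac)
  finally have "(norm (c *\<^sub>C x))\<^sup>2 = (cmod c * norm x)\<^sup>2"
    using of_real_eq_iff by blast
  then show ?thesis by (simp add: power2_eq_iff_nonneg)
qed

lemma norm_cinner_le: "cmod (cinner x y) \<le> norm x * norm (y :: 'a :: complex_hilbert)"
proof (cases "cinner x y = 0")
  case False
  define c where "c = cnj (cinner x y) / cmod (cinner x y)"
  have c: "cmod c = 1" using False by (simp add: c_def norm_divide)
  have "c * cinner x y = cmod (cinner x y)"
    using False
    by (simp add: c_def mult.commute[of _ "cinner x y"] complex_norm_square[symmetric] power2_eq_square)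
  then have "cmod (cinner x y) = inner x (c *\<^sub>C y)"
    by (simp add: inner_eq_Re_cinner cinner_scaleC_right)
  also have "\<dots> \<le> norm x * norm (c *\<^sub>C y)" by (rule norm_cauchy_schwarz)
  finally show ?thesis by (simp add: norm_scaleC c)
qed auto

lemma bounded_linear_scaleC: "bounded_linear (\<lambda>x :: 'a :: complex_hilbert. c *\<^sub>C x)"
  by (rule bounded_linear_intro[where K = "cmod c"])
     (auto simp: scaleC_add_right scaleR_scaleC scaleC_scaleC norm_scaleC mult_ac)

instantiation complex :: complex_hilbert
begin
definition scaleC_complex :: "complex \<Rightarrow> complex \<Rightarrow> complex" where
  "scaleC_complex c x = c * x"
definition cinner_complex :: "complex \<Rightarrow> complex \<Rightarrow> complex" where
  "cinner_complex x y = cnj x * y"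
instance
  by standard (auto simp: scaleC_complex_def cinner_complex_def algebra_simps scaleR_conv_of_real inner_complex_def)
end

text \<open>Operators between complex Hilbert spaces are elements of the library type of bounded
  real-linear maps; complex linearity is imposed by \<open>bounded_ops\<close> below.\<close>

instantiation blinfun :: (real_normed_vector, complex_hilbert) scaleC
begin
lift_definition scaleC_blinfun :: "complex \<Rightarrow> ('a \<Rightarrow>\<^sub>L 'b) \<Rightarrow> ('a \<Rightarrow>\<^sub>L 'b)"
  is "\<lambda>c f x. c *\<^sub>C f x"
  by (rule bounded_linear_compose[OF bounded_linear_scaleC])
instance ..
end

text \<open>Square-summable families of vectors of a Hilbert space. With \<^typ>\<open>complex\<close> as the second
  argument this is the usual \<open>\<ell>\<^sup>2\<close>; for a general Hilbert space \<open>'h\<close> it is the Hilbert space tensor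
  product of \<open>\<ell>\<^sup>2\<close> with \<open>'h\<close>, see \<open>cinner_tensor\<close> and \<open>closure_span_tensor\<close>.\<close>

typedef (overloaded) ('i, 'h :: complex_hilbert) ell2 =
  "{f :: 'i \<Rightarrow> 'h. (\<lambda>i. (norm (f i))\<^sup>2) summable_on UNIV}"
  morphisms ell2_nth Abs_ell2
  by (rule exI[of _ "\<lambda>_. 0"]) simp

notation ell2_nth (infixl \<open>$$\<close> 90)
setup_lifting type_definition_ell2

lemma norm_add_sq_le: "(norm (x + y))\<^sup>2 \<le> 2 * (norm x)\<^sup>2 + 2 * (norm (y :: 'a :: real_normed_vector))\<^sup>2"
proof -
  have "(norm (x + y))\<^sup>2 \<le> (norm x + norm y)\<^sup>2" by (intro power_mono norm_triangle_ineq) auto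
  also have "\<dots> \<le> 2 * (norm x)\<^sup>2 + 2 * (norm y)\<^sup>2"
    using sum_squares_bound[of "norm x" "norm y"] by (simp add: power2_sum)
  finally show ?thesis .
qed

lemma ell2_summable: "(\<lambda>i. (norm (x $$ i))\<^sup>2) summable_on UNIV"
  using ell2_nth[of x] by simp

lemma ell2_cinner_summable: "(\<lambda>i. cinner (x $$ i) (y $$ i)) summable_on UNIV"
proof (rule abs_summable_summable, rule Infinite_Sum.abs_summable_on_comparison_test')
  show "(\<lambda>i. (norm (x $$ i))\<^sup>2 + (norm (y $$ i))\<^sup>2) summable_on UNIV"
    by (intro summable_on_add ell2_summable)
  fix i
  have "cmod (cinner (x $$ i) (y $$ i)) \<le> norm (x $$ i) * norm (y $$ i)" by (rule norm_cinner_le)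
  also have "\<dots> \<le> (norm (x $$ i))\<^sup>2 + (norm (y $$ i))\<^sup>2"
    using sum_squares_bound[of "norm (x $$ i)" "norm (y $$ i)"]
      mult_nonneg_nonneg[OF norm_ge_zero norm_ge_zero, of "x $$ i" "y $$ i"] by linarith
  finally show "norm (cinner (x $$ i) (y $$ i)) \<le> (norm (x $$ i))\<^sup>2 + (norm (y $$ i))\<^sup>2" .
qed

lemma ell2_eqI: "(\<And>i. x $$ i = y $$ i) \<Longrightarrow> x = y"
  by (metis ell2_nth_inject ext)

instantiation ell2 :: (type, complex_hilbert) "{scaleC, cinner, real_inner}"
begin

lift_definition zero_ell2 :: "('a, 'b) ell2" is "\<lambda>_. 0" by simp

lift_definition plus_ell2 :: "('a, 'b) ell2 \<Rightarrow> ('a, 'b) ell2 \<Rightarrow> ('a, 'b) ell2"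
  is "\<lambda>x y i. x i + y i"
proof -
  fix x y :: "'a \<Rightarrow> 'b"
  assume "(\<lambda>i. (norm (x i))\<^sup>2) summable_on UNIV" "(\<lambda>i. (norm (y i))\<^sup>2) summable_on UNIV"
  then have "(\<lambda>i. 2 * (norm (x i))\<^sup>2 + 2 * (norm (y i))\<^sup>2) summable_on UNIV"
    by (intro summable_on_add summable_on_cmult_right)
  then show "(\<lambda>i. (norm (x i + y i))\<^sup>2) summable_on UNIV"
    by (rule summable_on_comparison_test) (auto simp: norm_add_sq_le)
qed

lift_definition uminus_ell2 :: "('a, 'b) ell2 \<Rightarrow> ('a, 'b) ell2" is "\<lambda>x i. - x i" by simp

definition minus_ell2 :: "('a, 'b) ell2 \<Rightarrow> ('a, 'b) ell2 \<Rightarrow> ('a, 'b) ell2" where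
  "minus_ell2 x y = x + (- y)"

lift_definition scaleC_ell2 :: "complex \<Rightarrow> ('a, 'b) ell2 \<Rightarrow> ('a, 'b) ell2" is "\<lambda>c x i. c *\<^sub>C x i"
  by (simp add: norm_scaleC power_mult_distrib summable_on_cmult_right)

definition scaleR_ell2 :: "real \<Rightarrow> ('a, 'b) ell2 \<Rightarrow> ('a, 'b) ell2" where
  "scaleR_ell2 r x = complex_of_real r *\<^sub>C x"

definition cinner_ell2 :: "('a, 'b) ell2 \<Rightarrow> ('a, 'b) ell2 \<Rightarrow> complex" where
  "cinner_ell2 x y = (\<Sum>\<^sub>\<infinity>i. cinner (x $$ i) (y $$ i))"

definition inner_ell2 :: "('a, 'b) ell2 \<Rightarrow> ('a, 'b) ell2 \<Rightarrow> real" where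
  "inner_ell2 x y = Re (cinner x y)"

definition norm_ell2 :: "('a, 'b) ell2 \<Rightarrow> real" where
  "norm_ell2 x = sqrt (inner x x)"

definition sgn_ell2 :: "('a, 'b) ell2 \<Rightarrow> ('a, 'b) ell2" where
  "sgn_ell2 x = scaleR (inverse (norm x)) x"

definition dist_ell2 :: "('a, 'b) ell2 \<Rightarrow> ('a, 'b) ell2 \<Rightarrow> real" where
  "dist_ell2 x y = norm (x - y)"

definition "(uniformity :: (('a, 'b) ell2 \<times> ('a, 'b) ell2) filter) =
  (INF e\<in>{0<..}. principal {(x, y). dist x y < e})"

definition "open (U :: ('a, 'b) ell2 set) \<longleftrightarrow>
  (\<forall>x\<in>U. eventually (\<lambda>(x', y). x' = x \<longrightarrow> y \<in> U) uniformity)"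

lemma ell2_inner_self: "inner x x = (\<Sum>\<^sub>\<infinity>i. (norm ((x :: ('a, 'b) ell2) $$ i))\<^sup>2)"
  unfolding inner_ell2_def cinner_ell2_def
  using infsum_Re[OF ell2_cinner_summable, of x x] by (simp add: cinner_self del: of_real_power)

lemma ell2_norm_sq: "(norm x)\<^sup>2 = (\<Sum>\<^sub>\<infinity>i. (norm ((x :: ('a, 'b) ell2) $$ i))\<^sup>2)"
  by (simp add: norm_ell2_def ell2_inner_self infsum_nonneg)

instance
proof
  fix x y z :: "('a, 'b) ell2" and a b :: real and c d :: complex
  show "x + y + z = x + (y + z)" by transfer (auto simp: add_ac)
  show "x + y = y + x" by transfer (auto simp: add_ac)
  show "0 + x = x" by transfer auto
  show "- x + x = 0" by transfer auto
  show "x - y = x + - y" by (rule minus_ell2_def)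
  have C1: "c *\<^sub>C (x + y) = c *\<^sub>C x + c *\<^sub>C y" for c by transfer (auto simp: scaleC_add_right)
  have C2: "(c + d) *\<^sub>C x = c *\<^sub>C x + d *\<^sub>C x" for c d by transfer (auto simp: scaleC_add_left)
  have C3: "c *\<^sub>C d *\<^sub>C x = (c * d) *\<^sub>C x" for c d by transfer (auto simp: scaleC_scaleC)
  have R: "r *\<^sub>R x = complex_of_real r *\<^sub>C x" for r by (rule scaleR_ell2_def)
  show "a *\<^sub>R (x + y) = a *\<^sub>R x + a *\<^sub>R y" by (simp add: scaleR_ell2_def C1)
  show "(a + b) *\<^sub>R x = a *\<^sub>R x + b *\<^sub>R x" by (simp add: scaleR_ell2_def C2)
  show "a *\<^sub>R b *\<^sub>R x = (a * b) *\<^sub>R x" by (simp add: scaleR_ell2_def C3)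
  show "1 *\<^sub>R x = x" unfolding scaleR_ell2_def by transfer simp
  show "dist x y = norm (x - y)" by (rule dist_ell2_def)
  show "sgn x = inverse (norm x) *\<^sub>R x" by (rule sgn_ell2_def)
  show "(uniformity :: (('a, 'b) ell2 \<times> ('a, 'b) ell2) filter) =
    (INF e\<in>{0<..}. principal {(x, y). dist x y < e})" by (rule uniformity_ell2_def)
  show "open U \<longleftrightarrow> (\<forall>x\<in>U. eventually (\<lambda>(x', y). x' = x \<longrightarrow> y \<in> U) uniformity)"
    for U :: "('a, 'b) ell2 set" by (rule open_ell2_def)
  have comm: "cinner x y = cnj (cinner y x)" for x y :: "('a, 'b) ell2"
    unfolding cinner_ell2_def infsum_cnj[symmetric] by (intro infsum_cong cinner_commute)
  have add: "cinner x (y + z) = cinner x y + cinner x z" for x y z :: "('a, 'b) ell2"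
    unfolding cinner_ell2_def
    by (simp add: plus_ell2.rep_eq cinner_add_right infsum_add[OF ell2_cinner_summable ell2_cinner_summable])
  have scal: "cinner x (c *\<^sub>C y) = c * cinner x y" for x y :: "('a, 'b) ell2" and c
    unfolding cinner_ell2_def
    by (simp add: scaleC_ell2.rep_eq cinner_scaleC_right infsum_cmult_right')
  show icomm: "inner x y = inner y x" for x y :: "('a, 'b) ell2"
    unfolding inner_ell2_def using comm[of x y] by simp
  show "inner (x + y) z = inner x z + inner y z"
    unfolding icomm[of _ z] by (simp add: inner_ell2_def add)
  show "inner (a *\<^sub>R x) y = a * inner x y"
    unfolding icomm[of _ y] by (simp add: inner_ell2_def scal R)
  show "0 \<le> inner x x" by (simp add: ell2_inner_self infsum_nonneg)
  show "inner x x = 0 \<longleftrightarrow> x = 0"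
  proof
    assume "inner x x = 0"
    then have "(norm (x $$ i))\<^sup>2 = 0" for i
      by (intro nonneg_infsum_le_0D[of "\<lambda>i. (norm (x $$ i))\<^sup>2" UNIV i])
         (auto simp: ell2_inner_self ell2_summable)
    then show "x = 0" by (intro ell2_eqI) (simp add: zero_ell2.rep_eq)
  next
    show "inner x x = 0" if "x = 0" using that by (simp add: ell2_inner_self zero_ell2.rep_eq)
  qed
  show "norm x = sqrt (inner x x)" by (rule norm_ell2_def)
qed
end

lemma ell2_Cauchy_convergent:
  fixes X :: "nat \<Rightarrow> ('a, 'b :: complex_hilbert) ell2"
  assumes X: "\<And>e. e > 0 \<Longrightarrow> \<exists>M. \<forall>m\<ge>M. \<forall>n\<ge>M. norm (X m - X n) < e"
  shows "\<exists>L. \<forall>e>0. \<exists>M. \<forall>n\<ge>M. norm (X n - L) < e"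
proof -
  have minus_nth: "(x - y) $$ i = x $$ i - y $$ i" for x y :: "('a, 'b) ell2" and i
    unfolding minus_ell2_def plus_ell2.rep_eq uminus_ell2.rep_eq by simp
  have fin_le: "(\<Sum>i\<in>F. (norm (x $$ i))\<^sup>2) \<le> (norm x)\<^sup>2" if "finite F" for x :: "('a, 'b) ell2" and F
    unfolding ell2_norm_sq using that by (intro finite_sum_le_infsum ell2_summable) auto
  have nth_le: "norm (x $$ i) \<le> norm x" for x :: "('a, 'b) ell2" and i
  proof (rule power2_le_imp_le)
    show "(norm (x $$ i))\<^sup>2 \<le> (norm x)\<^sup>2" using fin_le[of "{i}" x] by simp
  qed (simp add: norm_ge_zero)
  have "Cauchy (\<lambda>n. X n $$ i)" for i
  proof (rule CauchyI)
    fix e :: real assume "e > 0"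
    then obtain M where "\<forall>m\<ge>M. \<forall>n\<ge>M. norm (X m - X n) < e" using X by blast
    moreover have "norm (X m $$ i - X n $$ i) \<le> norm (X m - X n)" for m n
      using nth_le[of "X m - X n" i] by (simp only: minus_nth)
    ultimately show "\<exists>M. \<forall>m\<ge>M. \<forall>n\<ge>M. norm (X m $$ i - X n $$ i) < e"
      by (intro exI[of _ M]) (blast intro: order_le_less_trans)
  qed
  then have "convergent (\<lambda>n. X n $$ i)" for i by (rule Cauchy_convergent)
  then have l: "(\<lambda>n. X n $$ i) \<longlonglongrightarrow> lim (\<lambda>n. X n $$ i)" for i by (simp only: convergent_LIMSEQ_iff)
  define l where "l i = lim (\<lambda>n. X n $$ i)" for i
  note l = l[folded l_def]
  have fin_bd: "(\<Sum>i\<in>F. (norm (X n $$ i - l i))\<^sup>2) \<le> e\<^sup>2"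
    if F: "finite F" and n: "n \<ge> M" and e: "e > 0" and M: "\<forall>m\<ge>M. \<forall>n\<ge>M. norm (X m - X n) < e" for F n M e
  proof (rule LIMSEQ_le_const2)
    show "(\<lambda>m. \<Sum>i\<in>F. (norm (X n $$ i - X m $$ i))\<^sup>2) \<longlonglongrightarrow> (\<Sum>i\<in>F. (norm (X n $$ i - l i))\<^sup>2)"
      by (intro tendsto_intros l)
    have "(\<Sum>i\<in>F. (norm (X n $$ i - X m $$ i))\<^sup>2) \<le> e\<^sup>2" if "m \<ge> M" for m
    proof -
      have "(\<Sum>i\<in>F. (norm (X n $$ i - X m $$ i))\<^sup>2) \<le> (norm (X n - X m))\<^sup>2"
        using fin_le[OF F, of "X n - X m"] by (simp add: minus_nth)
      also have "\<dots> \<le> e\<^sup>2"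
        using M n that by (intro power_mono norm_ge_zero) (blast intro: less_imp_le)
      finally show ?thesis .
    qed
    then show "\<exists>N. \<forall>m\<ge>N. (\<Sum>i\<in>F. (norm (X n $$ i - X m $$ i))\<^sup>2) \<le> e\<^sup>2" by blast
  qed
  have summ: "(\<lambda>i. (norm (X n $$ i - l i))\<^sup>2) summable_on UNIV"
    if "n \<ge> M" "e > 0" "\<forall>m\<ge>M. \<forall>n\<ge>M. norm (X m - X n) < e" for n M e
  proof (rule nonneg_bdd_above_summable_on)
    show "bdd_above (sum (\<lambda>i. (norm (X n $$ i - l i))\<^sup>2) ` {F. F \<subseteq> UNIV \<and> finite F})"
      by (rule bdd_aboveI2[where M = "e\<^sup>2"]) (use fin_bd[OF _ that] in blast)
  qed simp
  obtain M1 where M1: "\<forall>m\<ge>M1. \<forall>n\<ge>M1. norm (X m - X n) < 1" using X[OF zero_less_one] by blast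
  have "(\<lambda>i. (norm (l i))\<^sup>2) summable_on UNIV"
  proof (rule summable_on_comparison_test)
    show "(\<lambda>i. 2 * (norm (X M1 $$ i))\<^sup>2 + 2 * (norm (X M1 $$ i - l i))\<^sup>2) summable_on UNIV"
      by (intro summable_on_add summable_on_cmult_right ell2_summable summ[OF order_refl zero_less_one M1])
    show "(norm (l i))\<^sup>2 \<le> 2 * (norm (X M1 $$ i))\<^sup>2 + 2 * (norm (X M1 $$ i - l i))\<^sup>2" for i
      using norm_add_sq_le[of "X M1 $$ i" "- (X M1 $$ i - l i)"] by (simp add: norm_minus_commute)
  qed auto
  then have L: "Abs_ell2 l $$ i = l i" for i by (simp add: Abs_ell2_inverse)
  have "\<exists>M. \<forall>n\<ge>M. norm (X n - Abs_ell2 l) < e" if "e > 0" for e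
  proof -
    obtain M where M: "\<forall>m\<ge>M. \<forall>n\<ge>M. norm (X m - X n) < e / 2" using X[OF half_gt_zero[OF \<open>e > 0\<close>]] by blast
    have "norm (X n - Abs_ell2 l) < e" if n: "n \<ge> M" for n
    proof -
      have "(norm (X n - Abs_ell2 l))\<^sup>2 \<le> (e / 2)\<^sup>2"
        unfolding ell2_norm_sq minus_nth L
      proof (rule infsum_le_finite_sums)
        show "(\<lambda>i. (norm (X n $$ i - l i))\<^sup>2) summable_on UNIV"
          using \<open>e > 0\<close> by (intro summ[OF n _ M]) simp
        show "(\<Sum>i\<in>F. (norm (X n $$ i - l i))\<^sup>2) \<le> (e / 2)\<^sup>2" if "finite F" for F
          using \<open>e > 0\<close> by (intro fin_bd[OF that n _ M]) simp
      qed
      then have "norm (X n - Abs_ell2 l) \<le> e / 2" by (rule power2_le_imp_le) (use \<open>e > 0\<close> in simp)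
      then show ?thesis using \<open>e > 0\<close> by simp
    qed
    then show ?thesis by blast
  qed
  then show ?thesis by blast
qed

instance ell2 :: (type, complex_hilbert) complex_hilbert
proof
  fix x y z :: "('a, 'b) ell2" and r :: real and c d :: complex
  show "c *\<^sub>C (x + y) = c *\<^sub>C x + c *\<^sub>C y" by transfer (auto simp: scaleC_add_right)
  show "(c + d) *\<^sub>C x = c *\<^sub>C x + d *\<^sub>C x" by transfer (auto simp: scaleC_add_left)
  show "c *\<^sub>C d *\<^sub>C x = (c * d) *\<^sub>C x" by transfer (auto simp: scaleC_scaleC)
  show "r *\<^sub>R x = complex_of_real r *\<^sub>C x" by (rule scaleR_ell2_def)
  show "cinner x y = cnj (cinner y x)"
    unfolding cinner_ell2_def infsum_cnj[symmetric] by (intro infsum_cong cinner_commute)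
  show "cinner x (y + z) = cinner x y + cinner x z"
    unfolding cinner_ell2_def
    by (simp add: plus_ell2.rep_eq cinner_add_right infsum_add[OF ell2_cinner_summable ell2_cinner_summable])
  show "cinner x (c *\<^sub>C y) = c * cinner x y"
    unfolding cinner_ell2_def
    by (simp add: scaleC_ell2.rep_eq cinner_scaleC_right infsum_cmult_right')
  show "inner x y = Re (cinner x y)" by (rule inner_ell2_def)
next
  fix X :: "nat \<Rightarrow> ('a, 'b) ell2"
  assume "Cauchy X"
  then have "\<exists>M. \<forall>m\<ge>M. \<forall>n\<ge>M. norm (X m - X n) < e" if "e > 0" for e
    using that unfolding Cauchy_def dist_ell2_def by blast
  then obtain L where "\<And>e. e > 0 \<Longrightarrow> \<exists>M. \<forall>n\<ge>M. norm (X n - L) < e"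
    using ell2_Cauchy_convergent by blast
  then show "convergent X" unfolding convergent_def lim_sequentially dist_ell2_def by blast
qed

text \<open>Elements of \<open>L\<^sup>2(\<real>\<^sub>+)\<close> are handled through representatives: \<open>L2_half_line\<close> consists of the
  square-integrable functions themselves. Values off the half line play no role.\<close>

definition half_line :: "real measure" where
  "half_line = restrict_space lborel {0..}"

abbreviation half_line_pow :: "nat \<Rightarrow> (nat \<Rightarrow> real) measure" where
  "half_line_pow n \<equiv> Pi\<^sub>M {..<n} (\<lambda>_. half_line)"

definition L2_half_line :: "(real \<Rightarrow> complex) set" where
  "L2_half_line = {f \<in> borel_measurable half_line. integrable half_line (\<lambda>t. (cmod (f t))\<^sup>2)}"

text \<open>The symmetric Fock space over \<open>L\<^sup>2(\<real>\<^sub>+)\<close> is the Hilbert space direct sum over \<open>n\<close> of the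
  symmetric square-integrable functions of \<open>n\<close> variables in \<open>\<real>\<^sub>+\<close>. A point of \<open>\<real>\<^sub>+\<^sup>n\<close> is a function
  defined on \<open>{..<n}\<close>. Symmetry is required pointwise of representatives, which loses no classes:
  averaging over permutations turns an almost everywhere symmetric function into a symmetric one.\<close>

definition fock_norm2 :: "(nat \<Rightarrow> (nat \<Rightarrow> real) \<Rightarrow> complex) \<Rightarrow> ennreal" where
  "fock_norm2 F = (\<Sum>n. \<integral>\<^sup>+ x. ennreal ((cmod (F n x))\<^sup>2) \<partial>half_line_pow n)"

definition fock_fun :: "(nat \<Rightarrow> (nat \<Rightarrow> real) \<Rightarrow> complex) set" where
  "fock_fun = {F. (\<forall>n. F n \<in> borel_measurable (half_line_pow n)) \<and>
     (\<forall>n \<sigma>. \<sigma> permutes {..<n} \<longrightarrow> (\<forall>x \<in> space (half_line_pow n). F n (x \<circ> \<sigma>) = F n x)) \<and>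
     fock_norm2 F < \<infinity>}"

definition fock_eq ::
  "(nat \<Rightarrow> (nat \<Rightarrow> real) \<Rightarrow> complex) \<Rightarrow> (nat \<Rightarrow> (nat \<Rightarrow> real) \<Rightarrow> complex) \<Rightarrow> bool" where
  "fock_eq F G \<longleftrightarrow> F \<in> fock_fun \<and> G \<in> fock_fun \<and> (\<forall>n. AE x in half_line_pow n. F n x = G n x)"

definition fock_cinner ::
  "(nat \<Rightarrow> (nat \<Rightarrow> real) \<Rightarrow> complex) \<Rightarrow> (nat \<Rightarrow> (nat \<Rightarrow> real) \<Rightarrow> complex) \<Rightarrow> complex" where
  "fock_cinner F G = (\<Sum>n. \<integral>x. cnj (F n x) * G n x \<partial>half_line_pow n)"

lemma measurable_cnj [measurable]: "cnj \<in> borel_measurable borel"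
  by (intro borel_measurable_continuous_onI continuous_intros)

lemma Bochner_integral_cnj: "(\<integral>x. cnj (f x) \<partial>M) = cnj (\<integral>x. f x \<partial>M)"
  by (rule integral_bounded_linear'[OF bounded_linear_cnj bounded_linear_cnj]) auto

lemma fock_fun_measurable: "F \<in> fock_fun \<Longrightarrow> F n \<in> borel_measurable (half_line_pow n)"
  by (simp add: fock_fun_def)

lemma fock_fun_symmetric:
  "F \<in> fock_fun \<Longrightarrow> \<sigma> permutes {..<n} \<Longrightarrow> x \<in> space (half_line_pow n) \<Longrightarrow> F n (x \<circ> \<sigma>) = F n x"
  by (simp add: fock_fun_def)

lemma fock_norm2_zero: "fock_norm2 (\<lambda>n x. 0) = 0"
  by (simp add: fock_norm2_def)

lemma fock_fun_zero: "(\<lambda>n x. 0) \<in> fock_fun"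
  by (simp add: fock_fun_def fock_norm2_zero)

lemma fock_fun_scale:
  assumes "F \<in> fock_fun" shows "(\<lambda>n x. c * F n x) \<in> fock_fun"
proof -
  have [measurable]: "F n \<in> borel_measurable (half_line_pow n)" for n
    using assms by (rule fock_fun_measurable)
  have "fock_norm2 (\<lambda>n x. c * F n x) = ennreal ((cmod c)\<^sup>2) * fock_norm2 F"
    unfolding fock_norm2_def
    by (simp add: norm_mult power_mult_distrib ennreal_mult' nn_integral_cmult)
  then show ?thesis
    using assms by (auto simp: fock_fun_def ennreal_mult_less_top)
qed

lemma fock_fun_add:
  assumes "F \<in> fock_fun" "G \<in> fock_fun" shows "(\<lambda>n x. F n x + G n x) \<in> fock_fun"
proof -
  have [measurable]: "F n \<in> borel_measurable (half_line_pow n)" "G n \<in> borel_measurable (half_line_pow n)" for n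
    using assms by (auto intro: fock_fun_measurable)
  have "fock_norm2 (\<lambda>n x. F n x + G n x) \<le>
      (\<Sum>n. \<integral>\<^sup>+ x. (2 * ennreal ((cmod (F n x))\<^sup>2) + 2 * ennreal ((cmod (G n x))\<^sup>2)) \<partial>half_line_pow n)"
    unfolding fock_norm2_def
  proof (intro suminf_le nn_integral_mono summableI)
    fix n x
    have "ennreal ((cmod (F n x + G n x))\<^sup>2) \<le> ennreal (2 * (cmod (F n x))\<^sup>2 + 2 * (cmod (G n x))\<^sup>2)"
      by (intro ennreal_leI norm_add_sq_le)
    then show "ennreal ((cmod (F n x + G n x))\<^sup>2) \<le> 2 * ennreal ((cmod (F n x))\<^sup>2) + 2 * ennreal ((cmod (G n x))\<^sup>2)"
      by (simp add: ennreal_mult')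
  qed
  also have "\<dots> = 2 * fock_norm2 F + 2 * fock_norm2 G"
    unfolding fock_norm2_def
    by (simp add: nn_integral_add nn_integral_cmult suminf_add[symmetric])
  also have "\<dots> < \<infinity>"
    using assms by (auto simp: fock_fun_def ennreal_mult_less_top)
  finally show ?thesis
    using assms by (auto simp: fock_fun_def)
qed

lemma fock_fun_uminus: "F \<in> fock_fun \<Longrightarrow> (\<lambda>n x. - F n x) \<in> fock_fun"
  using fock_fun_scale[of F "-1"] by simp

lemma fock_fun_integrable_sq:
  assumes "F \<in> fock_fun" shows "integrable (half_line_pow n) (\<lambda>x. (cmod (F n x))\<^sup>2)"
proof -
  have [measurable]: "F n \<in> borel_measurable (half_line_pow n)"
    using assms by (rule fock_fun_measurable)
  have "(\<integral>\<^sup>+ x. ennreal ((cmod (F n x))\<^sup>2) \<partial>half_line_pow n) \<le> fock_norm2 F"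
    unfolding fock_norm2_def
    using sum_le_suminf[of "\<lambda>n. \<integral>\<^sup>+ x. ennreal ((cmod (F n x))\<^sup>2) \<partial>half_line_pow n" "{n}"] by simp
  also have "\<dots> < \<infinity>" using assms by (simp add: fock_fun_def)
  finally show ?thesis
    by (intro integrableI_bounded) auto
qed

lemma fock_fun_nn_integral:
  assumes "F \<in> fock_fun"
  shows "(\<integral>\<^sup>+ x. ennreal ((cmod (F n x))\<^sup>2) \<partial>half_line_pow n) =
    ennreal (\<integral>x. (cmod (F n x))\<^sup>2 \<partial>half_line_pow n)"
  by (intro nn_integral_eq_integral fock_fun_integrable_sq assms) auto

lemma fock_fun_summable_sq:
  assumes "F \<in> fock_fun" shows "summable (\<lambda>n. \<integral>x. (cmod (F n x))\<^sup>2 \<partial>half_line_pow n)"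
  using assms
  by (intro summable_suminf_not_top) (auto simp: fock_fun_def fock_norm2_def fock_fun_nn_integral[OF assms])

lemma fock_norm2_eq:
  assumes "F \<in> fock_fun"
  shows "fock_norm2 F = ennreal (\<Sum>n. \<integral>x. (cmod (F n x))\<^sup>2 \<partial>half_line_pow n)"
  unfolding fock_norm2_def fock_fun_nn_integral[OF assms]
  by (intro suminf_ennreal2 fock_fun_summable_sq assms) auto

lemma fock_cinner_integrable:
  assumes "F \<in> fock_fun" "G \<in> fock_fun"
  shows "integrable (half_line_pow n) (\<lambda>x. cnj (F n x) * G n x)"
    and "cmod (\<integral>x. cnj (F n x) * G n x \<partial>half_line_pow n) \<le>
      (\<integral>x. (cmod (F n x))\<^sup>2 \<partial>half_line_pow n) + (\<integral>x. (cmod (G n x))\<^sup>2 \<partial>half_line_pow n)"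
proof -
  have [measurable]: "F n \<in> borel_measurable (half_line_pow n)" "G n \<in> borel_measurable (half_line_pow n)"
    using assms by (auto intro: fock_fun_measurable)
  have I: "integrable (half_line_pow n) (\<lambda>x. (cmod (F n x))\<^sup>2 + (cmod (G n x))\<^sup>2)"
    by (intro Bochner_Integration.integrable_add fock_fun_integrable_sq assms)
  have le: "cmod (cnj (F n x) * G n x) \<le> (cmod (F n x))\<^sup>2 + (cmod (G n x))\<^sup>2" for x
  proof -
    have "cmod (cnj (F n x) * G n x) = cmod (F n x) * cmod (G n x)" by (simp add: norm_mult)
    then show ?thesis
      using sum_squares_bound[of "cmod (F n x)" "cmod (G n x)"]
        mult_nonneg_nonneg[OF norm_ge_zero norm_ge_zero, of "F n x" "G n x"] by linarith
  qed
  show int: "integrable (half_line_pow n) (\<lambda>x. cnj (F n x) * G n x)"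
    using I by (rule Bochner_Integration.integrable_bound) (use le in \<open>auto intro!: AE_I2 order_trans[OF le]\<close>)
  have "cmod (\<integral>x. cnj (F n x) * G n x \<partial>half_line_pow n) \<le>
      (\<integral>x. (cmod (F n x))\<^sup>2 + (cmod (G n x))\<^sup>2 \<partial>half_line_pow n)"
    by (rule order_trans[OF integral_norm_bound integral_mono[OF integrable_norm[OF int] I le]])
  then show "cmod (\<integral>x. cnj (F n x) * G n x \<partial>half_line_pow n) \<le>
      (\<integral>x. (cmod (F n x))\<^sup>2 \<partial>half_line_pow n) + (\<integral>x. (cmod (G n x))\<^sup>2 \<partial>half_line_pow n)"
    by (simp add: Bochner_Integration.integral_add fock_fun_integrable_sq assms)
qed

lemma fock_cinner_summable:
  assumes "F \<in> fock_fun" "G \<in> fock_fun"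
  shows "summable (\<lambda>n. \<integral>x. cnj (F n x) * G n x \<partial>half_line_pow n)"
  by (rule summable_comparison_test'[OF summable_add[OF fock_fun_summable_sq[OF assms(1)] fock_fun_summable_sq[OF assms(2)]]])
     (rule fock_cinner_integrable(2)[OF assms])

lemma fock_cinner_commute:
  assumes "F \<in> fock_fun" "G \<in> fock_fun"
  shows "fock_cinner F G = cnj (fock_cinner G F)"
proof -
  have "(\<integral>x. cnj (F n x) * G n x \<partial>half_line_pow n) = cnj (\<integral>x. cnj (G n x) * F n x \<partial>half_line_pow n)" for n
  proof -
    have "(\<integral>x. cnj (F n x) * G n x \<partial>half_line_pow n) = (\<integral>x. cnj (cnj (G n x) * F n x) \<partial>half_line_pow n)"
      by (intro Bochner_Integration.integral_cong) (simp_all add: mult.commute)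
    then show ?thesis by (simp only: Bochner_integral_cnj)
  qed
  then show ?thesis
    unfolding fock_cinner_def
    using bounded_linear.suminf[OF bounded_linear_cnj fock_cinner_summable[OF assms(2,1)]] by simp
qed

lemma fock_cinner_add_right:
  assumes "F \<in> fock_fun" "G \<in> fock_fun" "H \<in> fock_fun"
  shows "fock_cinner F (\<lambda>n x. G n x + H n x) = fock_cinner F G + fock_cinner F H"
  unfolding fock_cinner_def
  by (simp add: distrib_left Bochner_Integration.integral_add fock_cinner_integrable
      fock_cinner_summable suminf_add assms)

lemma fock_cinner_scale_right:
  assumes "F \<in> fock_fun" "G \<in> fock_fun"
  shows "fock_cinner F (\<lambda>n x. c * G n x) = c * fock_cinner F G"
  using suminf_mult[OF fock_cinner_summable[OF assms], of c]
  by (simp add: fock_cinner_def mult.left_commute)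

lemma fock_cinner_self:
  assumes "F \<in> fock_fun"
  shows "fock_cinner F F = complex_of_real (\<Sum>n. \<integral>x. (cmod (F n x))\<^sup>2 \<partial>half_line_pow n)"
proof -
  have *: "cnj z * z = complex_of_real ((cmod z)\<^sup>2)" for z
    by (metis complex_norm_square mult.commute)
  show ?thesis
    unfolding fock_cinner_def * integral_complex_of_real
    by (rule suminf_of_real[symmetric]) (rule fock_fun_summable_sq[OF assms])
qed

lemma fock_norm2_cinner: "F \<in> fock_fun \<Longrightarrow> fock_norm2 F = ennreal (Re (fock_cinner F F))"
  by (simp add: fock_norm2_eq fock_cinner_self)

lemma fock_cinner_cong:
  assumes "fock_eq F F'" "fock_eq G G'"
  shows "fock_cinner F G = fock_cinner F' G'"
proof -
  have [measurable]: "F n \<in> borel_measurable (half_line_pow n)" "G n \<in> borel_measurable (half_line_pow n)"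
    "F' n \<in> borel_measurable (half_line_pow n)" "G' n \<in> borel_measurable (half_line_pow n)" for n
    using assms by (auto intro: fock_fun_measurable simp: fock_eq_def)
  have "AE x in half_line_pow n. cnj (F n x) * G n x = cnj (F' n x) * G' n x" for n
  proof -
    have "AE x in half_line_pow n. F n x = F' n x" "AE x in half_line_pow n. G n x = G' n x"
      using assms by (auto simp: fock_eq_def)
    then show ?thesis by eventually_elim auto
  qed
  then show ?thesis
    unfolding fock_cinner_def by (intro suminf_cong integral_cong_AE) measurable
qed

lemma fock_cinner_self_eq_0:
  assumes "F \<in> fock_fun" "Re (fock_cinner F F) = 0"
  shows "fock_eq F (\<lambda>n x. 0)"
proof -
  have [measurable]: "F n \<in> borel_measurable (half_line_pow n)" for n
    using assms by (auto intro: fock_fun_measurable)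
  have "fock_norm2 F = 0" using assms by (simp add: fock_norm2_cinner)
  then have "(\<integral>\<^sup>+ x. ennreal ((cmod (F n x))\<^sup>2) \<partial>half_line_pow n) = 0" for n
    unfolding fock_norm2_def
    using suminf_eq_zero_iff[of "\<lambda>n. \<integral>\<^sup>+ x. ennreal ((cmod (F n x))\<^sup>2) \<partial>half_line_pow n"] by auto
  then have "AE x in half_line_pow n. F n x = 0" for n
    by (simp add: nn_integral_0_iff_AE)
  then show ?thesis using assms by (simp add: fock_eq_def fock_fun_zero)
qed

lemma fock_complete_aux:
  fixes X :: "nat \<Rightarrow> nat \<Rightarrow> (nat \<Rightarrow> real) \<Rightarrow> complex"
  assumes X: "\<And>k. X k \<in> fock_fun"
    and Cauchy: "\<And>e. e > 0 \<Longrightarrow> \<exists>M. \<forall>m\<ge>M. \<forall>n\<ge>M. fock_norm2 (\<lambda>i y. X m i y - X n i y) \<le> ennreal e"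
  shows "\<exists>L \<in> fock_fun. \<forall>e>0. \<exists>M. \<forall>m\<ge>M. fock_norm2 (\<lambda>i y. X m i y - L i y) \<le> ennreal e"
proof -
  have [measurable]: "X k n \<in> borel_measurable (half_line_pow n)" for k n
    using X by (rule fock_fun_measurable)
  have "\<forall>k. \<exists>M. \<forall>m\<ge>M. \<forall>n\<ge>M. fock_norm2 (\<lambda>i y. X m i y - X n i y) \<le> ennreal ((1/4)^k)"
    using Cauchy by simp
  then obtain M0 where M0:
    "\<And>k m n. m \<ge> M0 k \<Longrightarrow> n \<ge> M0 k \<Longrightarrow> fock_norm2 (\<lambda>i y. X m i y - X n i y) \<le> ennreal ((1/4)^k)"
    by metis
  define r where "r k = k + (\<Sum>i\<le>k. M0 i)" for k
  have r_ge: "r k \<ge> k" for k by (simp add: r_def)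
  have r_M0: "r k \<ge> M0 k" for k
    using member_le_sum[of k "{..k}" M0] by (simp add: r_def)
  have r_Suc: "r (Suc k) \<ge> M0 k" for k
    using member_le_sum[of k "{..Suc k}" M0] by (simp add: r_def del: sum.atMost_Suc)
  define d where "d k i y = (cmod (X (r (Suc k)) i y - X (r k) i y))\<^sup>2" for k i y
  have [measurable]: "d k i \<in> borel_measurable (half_line_pow i)" for k i
    unfolding d_def by measurable
  have dk: "(\<Sum>i. \<integral>\<^sup>+y. ennreal (d k i y) \<partial>half_line_pow i) \<le> ennreal ((1/4)^k)" for k
    using M0[OF r_Suc r_M0, of k] by (simp add: fock_norm2_def d_def)
  have "(\<Sum>i. \<integral>\<^sup>+y. (\<Sum>k. ennreal (2^k * d k i y)) \<partial>half_line_pow i)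
      = (\<integral>\<^sup>+i. (\<integral>\<^sup>+y. (\<Sum>k. ennreal (2^k * d k i y)) \<partial>half_line_pow i) \<partial>count_space UNIV)"
    by (simp add: nn_integral_count_space_nat)
  also have "\<dots> = (\<Sum>k. \<integral>\<^sup>+i. (\<integral>\<^sup>+y. ennreal (2^k * d k i y) \<partial>half_line_pow i) \<partial>count_space UNIV)"
    by (simp add: nn_integral_suminf)
  also have "\<dots> \<le> (\<Sum>k. ennreal ((1/2)^k))"
  proof (intro suminf_le summableI)
    fix k
    have "(\<integral>\<^sup>+i. (\<integral>\<^sup>+y. ennreal (2^k * d k i y) \<partial>half_line_pow i) \<partial>count_space UNIV)
      = ennreal (2^k) * (\<Sum>i. \<integral>\<^sup>+y. ennreal (d k i y) \<partial>half_line_pow i)"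
      by (subst ennreal_mult') (simp_all add: nn_integral_cmult nn_integral_count_space_nat)
    also have "\<dots> \<le> ennreal (2^k) * ennreal ((1/4)^k)"
      by (intro mult_left_mono dk) auto
    also have "\<dots> = ennreal ((1/2)^k)"
      by (subst ennreal_mult[symmetric]) (auto simp flip: power_mult_distrib)
    finally show "(\<integral>\<^sup>+i. (\<integral>\<^sup>+y. ennreal (2^k * d k i y) \<partial>half_line_pow i) \<partial>count_space UNIV) \<le> ennreal ((1/2)^k)" .
  qed
  also have "\<dots> = ennreal (\<Sum>k. (1/2)^k)"
    by (intro suminf_ennreal2 summable_geometric) auto
  also have "\<dots> < \<infinity>" by simp
  finally have fin: "(\<Sum>i. \<integral>\<^sup>+y. (\<Sum>k. ennreal (2^k * d k i y)) \<partial>half_line_pow i) < \<infinity>" .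
  have conv: "AE y in half_line_pow i. convergent (\<lambda>k. X (r k) i y)" for i
  proof -
    have "(\<integral>\<^sup>+y. (\<Sum>k. ennreal (2^k * d k i y)) \<partial>half_line_pow i) < \<infinity>"
      using sum_le_suminf[of "\<lambda>i. \<integral>\<^sup>+y. (\<Sum>k. ennreal (2^k * d k i y)) \<partial>half_line_pow i" "{i}"] fin
      by (auto intro: le_less_trans)
    then have "AE y in half_line_pow i. (\<Sum>k. ennreal (2^k * d k i y)) \<noteq> \<infinity>"
      by (intro nn_integral_PInf_AE) auto
    then show ?thesis
    proof eventually_elim
      case (elim y)
      then have "summable (\<lambda>k. 2^k * d k i y)"
        by (intro summable_suminf_not_top) (auto simp: d_def)
      then have "(\<lambda>k. 2^k * d k i y) \<longlonglongrightarrow> 0" by (rule summable_LIMSEQ_zero)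
      then have ev: "eventually (\<lambda>k. 2^k * d k i y < 1) sequentially"
        by (rule order_tendstoD) simp
      have "summable (\<lambda>k. X (r (Suc k)) i y - X (r k) i y)"
      proof (rule summable_comparison_test_ev)
        show "summable (\<lambda>k. (sqrt (1/2))^k)"
          by (intro summable_geometric) (simp add: real_sqrt_lt_1_iff)
        show "\<forall>\<^sub>F k in sequentially. cmod (X (r (Suc k)) i y - X (r k) i y) \<le> (sqrt (1/2))^k"
          using ev
        proof eventually_elim
          case (elim k)
          have "(cmod (X (r (Suc k)) i y - X (r k) i y))\<^sup>2 \<le> (1/2)^k"
            using elim by (simp add: d_def field_simps power_divide)
          also have "\<dots> = ((sqrt (1/2))^k)\<^sup>2"
            by (simp add: power_mult[symmetric] mult.commute[of k] power_mult real_sqrt_pow2)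
          finally show ?case by (rule power2_le_imp_le) simp
        qed
      qed
      then have "convergent (\<lambda>K. \<Sum>k<K. X (r (Suc k)) i y - X (r k) i y)"
        by (simp add: summable_iff_convergent)
      then have "convergent (\<lambda>K. X (r K) i y - X (r 0) i y)"
        unfolding sum_lessThan_telescope[of "\<lambda>k. X (r k) i y"] .
      then show ?case
        using convergent_add[OF _ convergent_const[of "X (r 0) i y"]] by fastforce
    qed
  qed
  define L where "L i y = lim (\<lambda>k. X (r k) i y)" for i y
  have L[measurable]: "L i \<in> borel_measurable (half_line_pow i)" for i
    unfolding L_def by (rule borel_measurable_lim_metric) simp
  have bound: "fock_norm2 (\<lambda>i y. X m i y - L i y) \<le> ennreal e"
    if M: "\<forall>m\<ge>M. \<forall>n\<ge>M. fock_norm2 (\<lambda>i y. X m i y - X n i y) \<le> ennreal e" and m: "m \<ge> M" for m M e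
  proof -
    let ?g = "\<lambda>k i y. ennreal ((cmod (X m i y - X (r k) i y))\<^sup>2)"
    have "AE y in half_line_pow i. ennreal ((cmod (X m i y - L i y))\<^sup>2) = liminf (\<lambda>k. ?g k i y)" for i
      using conv[of i]
    proof eventually_elim
      case (elim y)
      then have "(\<lambda>k. X (r k) i y) \<longlonglongrightarrow> L i y"
        unfolding L_def by (simp add: convergent_LIMSEQ_iff)
      then have "(\<lambda>k. ?g k i y) \<longlonglongrightarrow> ennreal ((cmod (X m i y - L i y))\<^sup>2)"
        by (intro tendsto_ennrealI tendsto_intros)
      then show ?case by (rule lim_imp_Liminf[OF sequentially_bot, symmetric])
    qed
    then have "fock_norm2 (\<lambda>i y. X m i y - L i y)
        = (\<integral>\<^sup>+i. (\<integral>\<^sup>+y. liminf (\<lambda>k. ?g k i y) \<partial>half_line_pow i) \<partial>count_space UNIV)"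
      unfolding fock_norm2_def nn_integral_count_space_nat
      by (intro suminf_cong nn_integral_cong_AE)
    also have "\<dots> \<le> (\<integral>\<^sup>+i. liminf (\<lambda>k. \<integral>\<^sup>+y. ?g k i y \<partial>half_line_pow i) \<partial>count_space UNIV)"
      by (intro nn_integral_mono nn_integral_liminf) auto
    also have "\<dots> \<le> liminf (\<lambda>k. \<integral>\<^sup>+i. (\<integral>\<^sup>+y. ?g k i y \<partial>half_line_pow i) \<partial>count_space UNIV)"
      by (intro nn_integral_liminf) auto
    also have "\<dots> \<le> ennreal e"
    proof (rule Liminf_le)
      have "fock_norm2 (\<lambda>i y. X m i y - X (r k) i y) \<le> ennreal e" if "k \<ge> M" for k
        using M m that r_ge[of k] by auto
      then show "\<forall>\<^sub>F k in sequentially. (\<integral>\<^sup>+i. (\<integral>\<^sup>+y. ?g k i y \<partial>half_line_pow i) \<partial>count_space UNIV) \<le> ennreal e"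
        unfolding eventually_sequentially by (auto simp: fock_norm2_def nn_integral_count_space_nat)
    qed auto
    finally show ?thesis .
  qed
  have sym: "L n (x \<circ> \<sigma>) = L n x" if "\<sigma> permutes {..<n}" "x \<in> space (half_line_pow n)" for n \<sigma> x
    unfolding L_def by (simp add: fock_fun_symmetric[OF X that])
  obtain M where M: "\<forall>m\<ge>M. \<forall>n\<ge>M. fock_norm2 (\<lambda>i y. X m i y - X n i y) \<le> ennreal 1"
    using Cauchy[OF zero_less_one] by blast
  have D: "(\<lambda>i y. X M i y - L i y) \<in> fock_fun"
    unfolding fock_fun_def mem_Collect_eq
  proof (intro conjI allI impI ballI)
    have "fock_norm2 (\<lambda>i y. X M i y - L i y) \<le> ennreal 1" by (rule bound[OF M]) simp
    also have "\<dots> < \<infinity>" by simp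
    finally show "fock_norm2 (\<lambda>i y. X M i y - L i y) < \<infinity>" .
  qed (auto simp: sym fock_fun_symmetric[OF X])
  have "L \<in> fock_fun"
    using fock_fun_add[OF X[of M] fock_fun_uminus[OF D]] by simp
  moreover have "\<exists>M. \<forall>m\<ge>M. fock_norm2 (\<lambda>i y. X m i y - L i y) \<le> ennreal e" if "e > 0" for e
    using Cauchy[OF that] by (elim exE) (intro exI allI impI, rule bound)
  ultimately show ?thesis by blast
qed

quotient_type fock = "nat \<Rightarrow> (nat \<Rightarrow> real) \<Rightarrow> complex" / partial: fock_eq
proof (rule part_equivpI)
  show "\<exists>F. fock_eq F F"
    by (intro exI[of _ "\<lambda>n x. 0"]) (simp add: fock_eq_def fock_fun_zero)
  show "symp fock_eq"
    by (rule sympI) (auto simp: fock_eq_def eq_commute)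
  show "transp fock_eq"
  proof (rule transpI)
    fix F G H assume a: "fock_eq F G" "fock_eq G H"
    have "AE x in half_line_pow n. F n x = H n x" for n
    proof -
      have "AE x in half_line_pow n. F n x = G n x" "AE x in half_line_pow n. G n x = H n x"
        using a by (auto simp: fock_eq_def)
      then show ?thesis by eventually_elim auto
    qed
    then show "fock_eq F H" using a by (auto simp: fock_eq_def)
  qed
qed

lemma fock_eq_refl: "F \<in> fock_fun \<Longrightarrow> fock_eq F F"
  by (simp add: fock_eq_def)

instantiation fock :: "{scaleC, cinner, real_inner}"
begin

lift_definition zero_fock :: fock is "\<lambda>n x. 0"
  by (simp add: fock_eq_def fock_fun_zero)

lift_definition plus_fock :: "fock \<Rightarrow> fock \<Rightarrow> fock" is "\<lambda>F G n x. F n x + G n x"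
proof -
  fix F F' G G' assume a: "fock_eq F F'" "fock_eq G G'"
  have "AE x in half_line_pow n. F n x + G n x = F' n x + G' n x" for n
  proof -
    have "AE x in half_line_pow n. F n x = F' n x" "AE x in half_line_pow n. G n x = G' n x"
      using a by (auto simp: fock_eq_def)
    then show ?thesis by eventually_elim auto
  qed
  then show "fock_eq (\<lambda>n x. F n x + G n x) (\<lambda>n x. F' n x + G' n x)"
    using a by (auto simp: fock_eq_def fock_fun_add)
qed

lift_definition scaleC_fock :: "complex \<Rightarrow> fock \<Rightarrow> fock" is "\<lambda>c F n x. c * F n x"
  by (auto simp: fock_eq_def fock_fun_scale)

lift_definition cinner_fock :: "fock \<Rightarrow> fock \<Rightarrow> complex" is fock_cinner
  by (rule fock_cinner_cong)

definition uminus_fock :: "fock \<Rightarrow> fock" where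
  "uminus_fock x = (-1) *\<^sub>C x"

definition minus_fock :: "fock \<Rightarrow> fock \<Rightarrow> fock" where
  "minus_fock x y = x + (- y)"

definition scaleR_fock :: "real \<Rightarrow> fock \<Rightarrow> fock" where
  "scaleR_fock r x = complex_of_real r *\<^sub>C x"

definition inner_fock :: "fock \<Rightarrow> fock \<Rightarrow> real" where
  "inner_fock x y = Re (cinner x y)"

definition norm_fock :: "fock \<Rightarrow> real" where
  "norm_fock x = sqrt (inner x x)"

definition sgn_fock :: "fock \<Rightarrow> fock" where
  "sgn_fock x = scaleR (inverse (norm x)) x"

definition dist_fock :: "fock \<Rightarrow> fock \<Rightarrow> real" where
  "dist_fock x y = norm (x - y)"

definition "(uniformity :: (fock \<times> fock) filter) =
  (INF e\<in>{0<..}. principal {(x, y). dist x y < e})"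

definition "open (U :: fock set) \<longleftrightarrow>
  (\<forall>x\<in>U. eventually (\<lambda>(x', y). x' = x \<longrightarrow> y \<in> U) uniformity)"

instance
proof
  fix x y z :: fock and a b :: real
  show "x + y + z = x + (y + z)" by transfer (simp add: add_ac fock_eq_def fock_fun_add)
  show "x + y = y + x" by transfer (simp add: add_ac fock_eq_def fock_fun_add)
  show "0 + x = x" by transfer (simp add: fock_eq_def)
  show "- x + x = 0" unfolding uminus_fock_def by transfer (simp add: fock_eq_def fock_fun_zero)
  show "x - y = x + - y" by (rule minus_fock_def)
  show "a *\<^sub>R (x + y) = a *\<^sub>R x + a *\<^sub>R y" unfolding scaleR_fock_def
    by transfer (simp add: distrib_left fock_eq_def fock_fun_add fock_fun_scale)
  show "(a + b) *\<^sub>R x = a *\<^sub>R x + b *\<^sub>R x" unfolding scaleR_fock_def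
    by transfer (simp add: distrib_right fock_eq_def fock_fun_add fock_fun_scale)
  show "a *\<^sub>R b *\<^sub>R x = (a * b) *\<^sub>R x" unfolding scaleR_fock_def
    by transfer (simp add: mult.assoc fock_eq_def fock_fun_scale)
  show "1 *\<^sub>R x = x" unfolding scaleR_fock_def by transfer (simp add: fock_eq_def)
  show "dist x y = norm (x - y)" by (rule dist_fock_def)
  show "sgn x = inverse (norm x) *\<^sub>R x" by (rule sgn_fock_def)
  show "(uniformity :: (fock \<times> fock) filter) =
    (INF e\<in>{0<..}. principal {(x, y). dist x y < e})" by (rule uniformity_fock_def)
  show "open U \<longleftrightarrow> (\<forall>x\<in>U. eventually (\<lambda>(x', y). x' = x \<longrightarrow> y \<in> U) uniformity)"
    for U :: "fock set" by (rule open_fock_def)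
  have comm: "cinner x y = cnj (cinner y x)" for x y :: fock
    by transfer (rule fock_cinner_commute, auto simp: fock_eq_def)
  have add: "cinner x (y + z) = cinner x y + cinner x z" for x y z :: fock
    by transfer (simp add: fock_cinner_add_right fock_eq_def)
  have scal: "cinner x (c *\<^sub>C y) = c * cinner x y" for x y :: fock and c
    by transfer (simp add: fock_cinner_scale_right fock_eq_def)
  show icomm: "inner x y = inner y x" for x y :: fock
    unfolding inner_fock_def using comm[of x y] by simp
  show "inner (x + y) z = inner x z + inner y z"
    unfolding icomm[of _ z] by (simp add: inner_fock_def add)
  show "inner (a *\<^sub>R x) y = a * inner x y"
    unfolding icomm[of _ y] by (simp add: inner_fock_def scal scaleR_fock_def)
  show "0 \<le> inner x x" unfolding inner_fock_def
    by transfer (simp add: fock_eq_def fock_cinner_self suminf_nonneg fock_fun_summable_sq)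
  show "inner x x = 0 \<longleftrightarrow> x = 0"
  proof
    show "x = 0" if "inner x x = 0"
      using that unfolding inner_fock_def
      by transfer (rule fock_cinner_self_eq_0, auto simp: fock_eq_def)
    show "inner x x = 0" if "x = 0"
      unfolding that inner_fock_def by transfer (simp add: fock_cinner_def)
  qed
  show "norm x = sqrt (inner x x)" by (rule norm_fock_def)
qed
end

lemma fock_norm_abs:
  assumes "F \<in> fock_fun" shows "ennreal ((norm (abs_fock F))\<^sup>2) = fock_norm2 F"
proof -
  have "cinner (abs_fock F) (abs_fock F) = fock_cinner F F"
    using assms by (simp add: cinner_fock.abs_eq fock_eq_refl)
  then show ?thesis
    using assms by (simp add: norm_fock_def inner_fock_def fock_norm2_cinner fock_cinner_self suminf_nonneg
        fock_fun_summable_sq)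
qed

lemma fock_abs_minus:
  assumes "F \<in> fock_fun" "G \<in> fock_fun"
  shows "abs_fock F - abs_fock G = abs_fock (\<lambda>n x. F n x - G n x)"
  using assms unfolding minus_fock_def uminus_fock_def
  by (simp add: scaleC_fock.abs_eq plus_fock.abs_eq fock_eq_refl fock_fun_uminus)

instance fock :: complex_hilbert
proof
  fix x y z :: fock and r :: real and c d :: complex
  show "c *\<^sub>C (x + y) = c *\<^sub>C x + c *\<^sub>C y"
    by transfer (simp add: distrib_left fock_eq_def fock_fun_add fock_fun_scale)
  show "(c + d) *\<^sub>C x = c *\<^sub>C x + d *\<^sub>C x"
    by transfer (simp add: distrib_right fock_eq_def fock_fun_add fock_fun_scale)
  show "c *\<^sub>C d *\<^sub>C x = (c * d) *\<^sub>C x"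
    by transfer (simp add: mult.assoc fock_eq_def fock_fun_scale)
  show "r *\<^sub>R x = complex_of_real r *\<^sub>C x" by (rule scaleR_fock_def)
  show "cinner x y = cnj (cinner y x)"
    by transfer (rule fock_cinner_commute, auto simp: fock_eq_def)
  show "cinner x (y + z) = cinner x y + cinner x z"
    by transfer (simp add: fock_cinner_add_right fock_eq_def)
  show "cinner x (c *\<^sub>C y) = c * cinner x y"
    by transfer (simp add: fock_cinner_scale_right fock_eq_def)
  show "inner x y = Re (cinner x y)" by (rule inner_fock_def)
next
  fix X :: "nat \<Rightarrow> fock"
  assume C: "Cauchy X"
  have "\<exists>F. F \<in> fock_fun \<and> abs_fock F = x" for x
    by (induction x rule: fock.abs_induct) (auto simp: fock_eq_def)
  then have "\<forall>k. \<exists>F. F \<in> fock_fun \<and> abs_fock F = X k" by blast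
  then obtain F where "\<forall>k. F k \<in> fock_fun \<and> abs_fock (F k) = X k" by (rule choice[THEN exE])
  then have F: "\<And>k. F k \<in> fock_fun" "\<And>k. abs_fock (F k) = X k" by auto
  have N: "fock_norm2 (\<lambda>i y. F m i y - G i y) = ennreal ((norm (X m - abs_fock G))\<^sup>2)"
    if "G \<in> fock_fun" for m G
    using fock_norm_abs[OF fock_fun_add[OF F(1)[of m] fock_fun_uminus[OF that]]] fock_abs_minus[OF F(1)[of m] that]
    by (simp add: F(2))
  have "\<exists>L \<in> fock_fun. \<forall>e>0. \<exists>M. \<forall>m\<ge>M. fock_norm2 (\<lambda>i y. F m i y - L i y) \<le> ennreal e"
  proof (rule fock_complete_aux[OF F(1)])
    fix e :: real assume e: "e > 0"
    then obtain M where M: "\<forall>m\<ge>M. \<forall>n\<ge>M. norm (X m - X n) < sqrt e"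
      using CauchyD[OF C real_sqrt_gt_zero[OF e]] by blast
    have "fock_norm2 (\<lambda>i y. F m i y - F n i y) \<le> ennreal e" if "m \<ge> M" "n \<ge> M" for m n
    proof -
      have "(norm (X m - X n))\<^sup>2 \<le> (sqrt e)\<^sup>2"
        using M that by (intro power_mono) (auto intro: less_imp_le)
      then show ?thesis using e by (simp add: N[OF F(1)] F(2) ennreal_leI)
    qed
    then show "\<exists>M. \<forall>m\<ge>M. \<forall>n\<ge>M. fock_norm2 (\<lambda>i y. F m i y - F n i y) \<le> ennreal e" by blast
  qed
  then obtain L where L: "L \<in> fock_fun"
    "\<And>e. e > 0 \<Longrightarrow> \<exists>M. \<forall>m\<ge>M. fock_norm2 (\<lambda>i y. F m i y - L i y) \<le> ennreal e" by blast
  have "X \<longlonglongrightarrow> abs_fock L"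
  proof (rule LIMSEQ_I)
    fix e :: real assume e: "e > 0"
    then obtain M where M: "\<forall>m\<ge>M. fock_norm2 (\<lambda>i y. F m i y - L i y) \<le> ennreal ((e/2)\<^sup>2)"
      using L(2)[of "(e/2)\<^sup>2"] by (meson half_gt_zero zero_less_power)
    have "norm (X m - abs_fock L) < e" if "m \<ge> M" for m
    proof -
      have "(norm (X m - abs_fock L))\<^sup>2 \<le> (e/2)\<^sup>2"
        using M that by (auto simp: N[OF L(1)] ennreal_le_iff)
      then have "norm (X m - abs_fock L) \<le> e/2" by (rule power2_le_imp_le) (use e in simp)
      then show ?thesis using e by simp
    qed
    then show "\<exists>M. \<forall>m\<ge>M. norm (X m - abs_fock L) < e" by blast
  qed
  then show "convergent X" by (rule convergentI)
qed

text \<open>The \<open>n\<close>-particle component of the exponential vector is \<open>f\<^sup>\<otimes>\<^sup>n / sqrt (n!)\<close>.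
  \<open>exp_vec f\<close> is meaningful for \<open>f \<in> L2_half_line\<close> only, and depends only on the class of \<open>f\<close>.\<close>

definition exp_fun :: "(real \<Rightarrow> complex) \<Rightarrow> nat \<Rightarrow> (nat \<Rightarrow> real) \<Rightarrow> complex" where
  "exp_fun f n x = (\<Prod>i<n. f (x i)) / complex_of_real (sqrt (fact n))"

definition exp_vec :: "(real \<Rightarrow> complex) \<Rightarrow> fock" where
  "exp_vec f = abs_fock (exp_fun f)"

lemma half_line_product_sigma_finite: "product_sigma_finite (\<lambda>_. half_line)"
  unfolding product_sigma_finite_def half_line_def
  by (intro allI sigma_finite_measure_restrict_space sigma_finite_lborel) auto

lemma exp_fun_in_fock_fun:
  assumes "f \<in> L2_half_line" shows "exp_fun f \<in> fock_fun"
  unfolding fock_fun_def mem_Collect_eq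
proof (intro conjI allI impI ballI)
  have [measurable]: "f \<in> borel_measurable half_line" using assms by (simp add: L2_half_line_def)
  show meas: "exp_fun f n \<in> borel_measurable (half_line_pow n)" for n
    unfolding exp_fun_def by measurable
  show "exp_fun f n (x \<circ> \<sigma>) = exp_fun f n x" if "\<sigma> permutes {..<n}" for n \<sigma> x
    using prod.permute[OF that, of "\<lambda>i. f (x i)"] by (simp add: exp_fun_def comp_def)
  interpret product_sigma_finite "\<lambda>_ :: nat. half_line" by (rule half_line_product_sigma_finite)
  define c where "c = (\<integral>t. (cmod (f t))\<^sup>2 \<partial>half_line)"
  have c: "c \<ge> 0" by (simp add: c_def)
  have "(\<integral>\<^sup>+t. ennreal ((cmod (f t))\<^sup>2) \<partial>half_line) = ennreal c"
    unfolding c_def using assms by (intro nn_integral_eq_integral) (auto simp: L2_half_line_def)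
  then have P: "(\<integral>\<^sup>+x. (\<Prod>i<n. ennreal ((cmod (f (x i)))\<^sup>2)) \<partial>half_line_pow n) = ennreal (c ^ n)" for n
    using c by (subst product_nn_integral_prod) (auto simp: ennreal_power)
  have eq: "ennreal ((cmod (exp_fun f n x))\<^sup>2) = ennreal (inverse (fact n)) * (\<Prod>i<n. ennreal ((cmod (f (x i)))\<^sup>2))" for n x
  proof -
    have "(cmod (exp_fun f n x))\<^sup>2 = (\<Prod>i<n. (cmod (f (x i)))\<^sup>2) / fact n"
      by (simp add: exp_fun_def norm_divide prod_norm[symmetric] power_divide prod_power_distrib)
    then show ?thesis
      by (simp add: prod_ennreal ennreal_mult[symmetric] prod_nonneg field_simps)
  qed
  have "fock_norm2 (exp_fun f) = (\<Sum>n. ennreal (c ^ n /\<^sub>R fact n))"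
    unfolding fock_norm2_def eq using c
    by (intro suminf_cong) (subst nn_integral_cmult, simp_all add: P ennreal_mult)
  also have "\<dots> = ennreal (exp c)"
    unfolding exp_def using c by (intro suminf_ennreal2 summable_exp_generic) auto
  finally show "fock_norm2 (exp_fun f) < \<infinity>" by simp
qed

lemma cinner_exp_vec:
  assumes f: "f \<in> L2_half_line" and g: "g \<in> L2_half_line"
  shows "cinner (exp_vec f) (exp_vec g) = exp (\<integral>t. cnj (f t) * g t \<partial>half_line)"
proof -
  interpret product_sigma_finite "\<lambda>_ :: nat. half_line" by (rule half_line_product_sigma_finite)
  have [measurable]: "f \<in> borel_measurable half_line" "g \<in> borel_measurable half_line"
    using f g by (simp_all add: L2_half_line_def)
  have int: "integrable half_line (\<lambda>t. cnj (f t) * g t)"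
  proof (rule Bochner_Integration.integrable_bound)
    show "integrable half_line (\<lambda>t. (cmod (f t))\<^sup>2 + (cmod (g t))\<^sup>2)"
      using f g by (simp add: L2_half_line_def)
    have "cmod (f t) * cmod (g t) \<le> (cmod (f t))\<^sup>2 + (cmod (g t))\<^sup>2" for t
      using sum_squares_bound[of "cmod (f t)" "cmod (g t)"]
        mult_nonneg_nonneg[OF norm_ge_zero norm_ge_zero, of "f t" "g t"] by linarith
    then show "AE t in half_line. norm (cnj (f t) * g t) \<le> norm ((cmod (f t))\<^sup>2 + (cmod (g t))\<^sup>2)"
      by (simp add: norm_mult)
  qed measurable
  have "cinner (exp_vec f) (exp_vec g) = fock_cinner (exp_fun f) (exp_fun g)"
    using f g by (simp add: exp_vec_def cinner_fock.abs_eq fock_eq_refl exp_fun_in_fock_fun)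
  also have "\<dots> = (\<Sum>n. (\<integral>t. cnj (f t) * g t \<partial>half_line) ^ n /\<^sub>R fact n)"
    unfolding fock_cinner_def
  proof (rule suminf_cong)
    fix n
    have s: "complex_of_real (sqrt (fact n)) * complex_of_real (sqrt (fact n)) = fact n"
      by (simp flip: of_real_mult)
    have "cnj (exp_fun f n x) * exp_fun g n x = (\<Prod>i<n. cnj (f (x i)) * g (x i)) / fact n" for x
      unfolding exp_fun_def by (simp add: prod.distrib s)
    then have "(\<integral>x. cnj (exp_fun f n x) * exp_fun g n x \<partial>half_line_pow n) =
      (\<integral>x. (\<Prod>i<n. cnj (f (x i)) * g (x i)) \<partial>half_line_pow n) / fact n"
      by simp
    also have "\<dots> = (\<integral>t. cnj (f t) * g t \<partial>half_line) ^ n / fact n"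
      using int by (subst product_integral_prod) simp_all
    finally show "(\<integral>x. cnj (exp_fun f n x) * exp_fun g n x \<partial>half_line_pow n) =
      (\<integral>t. cnj (f t) * g t \<partial>half_line) ^ n /\<^sub>R fact n"
      by (simp add: scaleR_conv_of_real field_simps)
  qed
  finally show ?thesis by (simp add: exp_def)
qed

lift_definition tensor :: "('i, complex) ell2 \<Rightarrow> 'h :: complex_hilbert \<Rightarrow> ('i, 'h) ell2" (infixr \<open>\<otimes>\<^sub>h\<close> 70)
  is "\<lambda>u a i. u i *\<^sub>C a"
  by (simp add: norm_scaleC power_mult_distrib summable_on_cmult_left)

lemma cinner_tensor: "cinner (u \<otimes>\<^sub>h a) (v \<otimes>\<^sub>h b) = cinner u v * cinner a b"
proof -
  have "cinner (u \<otimes>\<^sub>h a) (v \<otimes>\<^sub>h b) = (\<Sum>\<^sub>\<infinity>i. cinner (u $$ i) (v $$ i) * cinner a b)"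
    unfolding cinner_ell2_def
    by (simp add: tensor.rep_eq cinner_scaleC_left cinner_scaleC_right cinner_complex_def mult_ac)
  also have "\<dots> = cinner u v * cinner a b"
    unfolding cinner_ell2_def by (rule infsum_cmult_left')
  finally show ?thesis .
qed

lemma closure_span_tensor: "closure (span (range (\<lambda>(u, a). u \<otimes>\<^sub>h a))) = (UNIV :: ('i, 'h :: complex_hilbert) ell2 set)"
proof -
  have "\<exists>y \<in> span (range (\<lambda>(u, a). u \<otimes>\<^sub>h a)). dist y x < e" if e: "e > 0" for x :: "('i, 'h) ell2" and e
  proof -
    have "e\<^sup>2 / 2 > 0" using e by simp
    from infsum_finite_approximation[OF ell2_summable[of x] this]
    obtain F where F: "finite F" "dist (\<Sum>i\<in>F. (norm (x $$ i))\<^sup>2) ((norm x)\<^sup>2) \<le> e\<^sup>2 / 2"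
      unfolding ell2_norm_sq by auto
    define b :: "'i \<Rightarrow> ('i, complex) ell2" where "b i = Abs_ell2 (\<lambda>j. if j = i then 1 else 0)" for i
    have b: "b i $$ j = (if j = i then 1 else 0)" for i j
    proof -
      have "(\<lambda>j. (norm (if j = i then 1 else 0 :: complex))\<^sup>2) summable_on UNIV"
        using summable_on_finite[of "{i}" "\<lambda>_. 1 :: real"]
          summable_on_cong_neutral[of "{i}" UNIV "\<lambda>_. 1 :: real" "\<lambda>j. (norm (if j = i then 1 else 0 :: complex))\<^sup>2"]
        by simp
      then show ?thesis by (simp add: b_def Abs_ell2_inverse)
    qed
    define y where "y = (\<Sum>i\<in>F. b i \<otimes>\<^sub>h (x $$ i))"
    have ysp: "y \<in> span (range (\<lambda>(u, a). u \<otimes>\<^sub>h a))"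
      unfolding y_def by (intro span_sum span_base) auto
    have sum_nth: "(\<Sum>i\<in>G. z i) $$ j = (\<Sum>i\<in>G. z i $$ j)" if "finite G" for G j and z :: "'i \<Rightarrow> ('i, 'h) ell2"
      using that by induction (simp_all add: plus_ell2.rep_eq zero_ell2.rep_eq)
    have y: "y $$ j = (if j \<in> F then x $$ j else 0)" for j
    proof -
      have "y $$ j = (\<Sum>i\<in>F. if i = j then x $$ i else 0)"
        unfolding y_def sum_nth[OF F(1)] by (intro sum.cong) (auto simp: tensor.rep_eq b)
      then show ?thesis using F(1) by (simp add: sum.delta')
    qed
    have minus_nth: "(x - y) $$ j = x $$ j - y $$ j" for j
      unfolding minus_ell2_def plus_ell2.rep_eq uminus_ell2.rep_eq by simp
    have "(norm (x - y))\<^sup>2 + (\<Sum>i\<in>F. (norm (x $$ i))\<^sup>2) = (norm x)\<^sup>2"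
    proof -
      have "(\<Sum>\<^sub>\<infinity>i. (norm (y $$ i))\<^sup>2) = (\<Sum>\<^sub>\<infinity>i\<in>F. (norm (x $$ i))\<^sup>2)"
        by (rule infsum_cong_neutral) (auto simp: y)
      then have "(\<Sum>i\<in>F. (norm (x $$ i))\<^sup>2) = (\<Sum>\<^sub>\<infinity>i. (norm (y $$ i))\<^sup>2)"
        using F(1) by simp
      then have "(norm (x - y))\<^sup>2 + (\<Sum>i\<in>F. (norm (x $$ i))\<^sup>2)
          = (\<Sum>\<^sub>\<infinity>i. (norm ((x - y) $$ i))\<^sup>2 + (norm (y $$ i))\<^sup>2)"
        unfolding ell2_norm_sq by (simp add: infsum_add[OF ell2_summable ell2_summable])
      also have "\<dots> = (norm x)\<^sup>2"
        unfolding ell2_norm_sq by (intro infsum_cong) (simp add: minus_nth y)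
      finally show ?thesis .
    qed
    then have "(norm (x - y))\<^sup>2 \<le> e\<^sup>2 / 2" using F(2) unfolding dist_real_def by linarith
    also have "\<dots> < e\<^sup>2" using e by simp
    finally have "norm (x - y) < e" by (rule power2_less_imp_less) (use e in simp)
    with ysp show ?thesis by (auto simp: dist_norm norm_minus_commute)
  qed
  then show ?thesis by (auto simp: closure_approachable)
qed

text \<open>The algebra of bounded complex-linear operators.\<close>

definition bounded_ops :: "('h :: complex_hilbert \<Rightarrow>\<^sub>L 'h) set" where
  "bounded_ops = {T. \<forall>c x. blinfun_apply T (c *\<^sub>C x) = c *\<^sub>C blinfun_apply T x}"

definition op_adjoint :: "('h :: complex_hilbert \<Rightarrow>\<^sub>L 'h) \<Rightarrow> ('h \<Rightarrow>\<^sub>L 'h)" where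
  "op_adjoint T = (THE S. \<forall>x y. cinner (blinfun_apply S x) y = cinner x (blinfun_apply T y))"

text \<open>Integer powers of a unitary operator, with the adjoint as inverse.\<close>

definition op_pow :: "('h :: complex_hilbert \<Rightarrow>\<^sub>L 'h) \<Rightarrow> int \<Rightarrow> ('h \<Rightarrow>\<^sub>L 'h)" where
  "op_pow T m = ((if m \<ge> 0 then (o\<^sub>L) T else (o\<^sub>L) (op_adjoint T)) ^^ nat \<bar>m\<bar>) id_blinfun"

text \<open>Unital \<open>*\<close>-homomorphisms from a unital \<open>*\<close>-algebra of operators into the bounded operators
  on a second Hilbert space; values off the algebra are irrelevant.\<close>

definition unital_star_hom ::
  "('h :: complex_hilbert \<Rightarrow>\<^sub>L 'h) set \<Rightarrow> (('h \<Rightarrow>\<^sub>L 'h) \<Rightarrow> ('k :: complex_hilbert \<Rightarrow>\<^sub>L 'k)) \<Rightarrow> bool" where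
  "unital_star_hom A \<Phi> \<longleftrightarrow>
     \<Phi> ` A \<subseteq> bounded_ops \<and>
     \<Phi> id_blinfun = id_blinfun \<and>
     (\<forall>x\<in>A. \<forall>y\<in>A. \<Phi> (x + y) = \<Phi> x + \<Phi> y \<and> \<Phi> (x o\<^sub>L y) = \<Phi> x o\<^sub>L \<Phi> y) \<and>
     (\<forall>c. \<forall>x\<in>A. \<Phi> (c *\<^sub>C x) = c *\<^sub>C \<Phi> x) \<and>
     (\<forall>x\<in>A. \<Phi> (op_adjoint x) = op_adjoint (\<Phi> x))"

type_synonym l2_Z2 = "(int \<times> int, complex) ell2"

text \<open>The generators, meaningful for \<open>\<bar>\<lambda>\<bar> = 1\<close>: see \<open>torus_U_apply\<close> and \<open>torus_V_apply\<close>. The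
  non-commutative torus is the norm closure, in the bounded operators on \<open>\<ell>\<^sup>2(\<int>\<^sup>2)\<close>, of the
  \<open>*\<close>-algebra generated by them.\<close>

definition torus_U :: "l2_Z2 \<Rightarrow>\<^sub>L l2_Z2" where
  "torus_U = Blinfun (\<lambda>u. Abs_ell2 (\<lambda>(m, n). u $$ (m + 1, n)))"

definition torus_V :: "complex \<Rightarrow> l2_Z2 \<Rightarrow>\<^sub>L l2_Z2" where
  "torus_V lam = Blinfun (\<lambda>u. Abs_ell2 (\<lambda>(m, n). lam powi m * u $$ (m, n + 1)))"

inductive_set torus_alg0 :: "complex \<Rightarrow> (l2_Z2 \<Rightarrow>\<^sub>L l2_Z2) set" for lam where
  U: "torus_U \<in> torus_alg0 lam"
| V: "torus_V lam \<in> torus_alg0 lam"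
| add: "x \<in> torus_alg0 lam \<Longrightarrow> y \<in> torus_alg0 lam \<Longrightarrow> x + y \<in> torus_alg0 lam"
| scale: "x \<in> torus_alg0 lam \<Longrightarrow> c *\<^sub>C x \<in> torus_alg0 lam"
| mult: "x \<in> torus_alg0 lam \<Longrightarrow> y \<in> torus_alg0 lam \<Longrightarrow> x o\<^sub>L y \<in> torus_alg0 lam"
| op_adjoint: "x \<in> torus_alg0 lam \<Longrightarrow> op_adjoint x \<in> torus_alg0 lam"

definition nc_torus :: "complex \<Rightarrow> (l2_Z2 \<Rightarrow>\<^sub>L l2_Z2) set" where
  "nc_torus lam = closure (torus_alg0 lam)"

definition torus_monom :: "complex \<Rightarrow> int \<Rightarrow> int \<Rightarrow> l2_Z2 \<Rightarrow>\<^sub>L l2_Z2" where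
  "torus_monom lam m n = op_pow torus_U m o\<^sub>L op_pow (torus_V lam) n"

text \<open>The linear map on \<^term>\<open>torus_alg0 lam\<close> sending the basis element \<open>U\<^sup>mV\<^sup>n\<close> to \<open>G m n\<close>;
  see \<open>linear_extension_sum\<close> for well-definedness.\<close>

definition linear_extension ::
  "complex \<Rightarrow> (int \<Rightarrow> int \<Rightarrow> l2_Z2 \<Rightarrow>\<^sub>L l2_Z2) \<Rightarrow> (l2_Z2 \<Rightarrow>\<^sub>L l2_Z2) \<Rightarrow> (l2_Z2 \<Rightarrow>\<^sub>L l2_Z2)" where
  "linear_extension lam G x = (THE y. \<exists>c. finite {p. c p \<noteq> 0} \<and>
     x = (\<Sum>(m, n) | c (m, n) \<noteq> 0. c (m, n) *\<^sub>C torus_monom lam m n) \<and>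
     y = (\<Sum>(m, n) | c (m, n) \<noteq> 0. c (m, n) *\<^sub>C G m n))"

definition torus_pi where
  "torus_pi lam mu nu =
     linear_extension lam (\<lambda>m n. (mu powi m * nu powi n) *\<^sub>C torus_monom lam m n)"

definition torus_delta where
  "torus_delta lam mu nu =
     linear_extension lam (\<lambda>m n. ((1 - mu powi m * nu powi n) / (1 - mu)) *\<^sub>C torus_monom lam m n)"

definition torus_tau where
  "torus_tau lam mu nu x = (mu / (1 - mu)) *\<^sub>C torus_delta lam mu nu x"

definition torus_phi ::
  "complex \<Rightarrow> complex \<Rightarrow> complex \<Rightarrow> (l2_Z2 \<Rightarrow>\<^sub>L l2_Z2) \<Rightarrow> (l2_Z2 \<Rightarrow>\<^sub>L l2_Z2) ^ 2 ^ 2" where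
  "torus_phi lam mu nu x = vector
     [vector [torus_tau lam mu nu x, (- mu) *\<^sub>C torus_delta lam mu nu x],
      vector [torus_delta lam mu nu x, torus_pi lam mu nu x - x]]"

text \<open>For an operator matrix \<open>M\<close>, regarded as an element of \<open>\<A>\<^sub>0 \<otimes> B(\<complex>\<^sup>2)\<close>, this is
  \<open>(1 \<otimes> \<langle>\<xi>|) M (1 \<otimes> |\<eta>\<rangle>)\<close>, where \<open>1 \<otimes> |\<eta>\<rangle>\<close> maps \<open>v\<close> to the pair \<open>(\<eta>\<^sub>1 v, \<eta>\<^sub>2 v)\<close> and
  \<open>1 \<otimes> \<langle>\<xi>|\<close> maps \<open>(w\<^sub>1, w\<^sub>2)\<close> to \<open>cnj \<xi>\<^sub>1 w\<^sub>1 + cnj \<xi>\<^sub>2 w\<^sub>2\<close>.\<close>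

definition compress ::
  "complex ^ 2 \<Rightarrow> (l2_Z2 \<Rightarrow>\<^sub>L l2_Z2) ^ 2 ^ 2 \<Rightarrow> complex ^ 2 \<Rightarrow> (l2_Z2 \<Rightarrow>\<^sub>L l2_Z2)" where
  "compress \<xi> M \<eta> = (\<Sum>i\<in>UNIV. \<Sum>j\<in>UNIV. (cnj (\<xi> $ i) * \<eta> $ j) *\<^sub>C (M $ i $ j))"

definition hat_vec :: "(real \<Rightarrow> complex) \<Rightarrow> real \<Rightarrow> complex ^ 2" where
  "hat_vec f t = vector [1, f t]"

definition restrict_before :: "real \<Rightarrow> (real \<Rightarrow> complex) \<Rightarrow> (real \<Rightarrow> complex)" where
  "restrict_before t f s = indicator {0..<t} s * f s"

definition restrict_from :: "real \<Rightarrow> (real \<Rightarrow> complex) \<Rightarrow> (real \<Rightarrow> complex)" where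
  "restrict_from t f s = indicator {t..} s * f s"

text \<open>Here \<open>restrict_before t f\<close> is \<open>f\<^sub>t\<^sub>)\<close> and \<open>restrict_from t f\<close> is \<open>f\<^sub>[\<^sub>t\<close>.\<close>

definition adapted ::
  "(l2_Z2 \<Rightarrow>\<^sub>L l2_Z2) set \<Rightarrow>
   (real \<Rightarrow> (l2_Z2 \<Rightarrow>\<^sub>L l2_Z2) \<Rightarrow> ((int \<times> int, fock) ell2 \<Rightarrow>\<^sub>L (int \<times> int, fock) ell2)) \<Rightarrow> bool" where
  "adapted A j \<longleftrightarrow> (\<forall>t\<ge>0. \<forall>a\<in>A. \<forall>u v. \<forall>f\<in>L2_half_line. \<forall>g\<in>L2_half_line.
     cinner (u \<otimes>\<^sub>h exp_vec f) (j t a (v \<otimes>\<^sub>h exp_vec g)) =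
     cinner (u \<otimes>\<^sub>h exp_vec (restrict_before t f)) (j t a (v \<otimes>\<^sub>h exp_vec (restrict_before t g))) *
     cinner (exp_vec (restrict_from t f)) (exp_vec (restrict_from t g)))"

lemma weighted_shift:
  fixes w :: "'i \<Rightarrow> complex" and \<pi> :: "'i \<Rightarrow> 'i"
  assumes w: "\<And>i. cmod (w i) = 1" and \<pi>: "bij \<pi>"
  shows "Blinfun (\<lambda>u :: ('i, complex) ell2. Abs_ell2 (\<lambda>i. w i * u $$ \<pi> i)) u $$ i = w i * u $$ \<pi> i"
proof -
  have mem: "(\<lambda>i. (norm (w i * u $$ \<pi> i))\<^sup>2) summable_on UNIV" for u
    using summable_on_reindex_bij_betw[of \<pi> UNIV UNIV "\<lambda>i. (norm (u $$ i))\<^sup>2"] \<pi> ell2_summable[of u]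
    by (simp add: norm_mult w)
  define T :: "('i, complex) ell2 \<Rightarrow> ('i, complex) ell2" where "T u = Abs_ell2 (\<lambda>i. w i * u $$ \<pi> i)" for u
  have nth: "T u $$ i = w i * u $$ \<pi> i" for u i
    unfolding T_def using mem[of u] by (simp add: Abs_ell2_inverse)
  have "norm (T u) = norm u" for u
  proof -
    have "(norm (T u))\<^sup>2 = (norm u)\<^sup>2"
      using infsum_reindex_bij_betw[of \<pi> UNIV UNIV "\<lambda>i. (norm (u $$ i))\<^sup>2"] \<pi>
      by (simp add: ell2_norm_sq nth norm_mult w)
    then show ?thesis by simp
  qed
  then have "bounded_linear T"
    by (intro bounded_linear_intro[where K = 1] ell2_eqI)
       (simp_all add: nth plus_ell2.rep_eq scaleR_ell2_def scaleC_ell2.rep_eq scaleC_complex_def algebra_simps)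
  then show ?thesis
    unfolding T_def[symmetric] by (simp add: bounded_linear_Blinfun_apply nth)
qed

lemma bij_shift: "bij (\<lambda>(m, n). (m + a, n + b) :: int \<times> int)"
  by (rule bij_betwI[where g = "\<lambda>(m, n). (m - a, n - b)"]) auto

lemma torus_U_apply: "torus_U u $$ (m, n) = u $$ (m + 1, n)"
  using weighted_shift[of "\<lambda>_. 1" "\<lambda>(m, n). (m + 1, n + 0)" u "(m, n)", OF _ bij_shift]
  by (simp add: torus_U_def case_prod_unfold)

lemma torus_V_apply:
  assumes "cmod lam = 1" shows "torus_V lam u $$ (m, n) = lam powi m * u $$ (m, n + 1)"
  using weighted_shift[of "\<lambda>(m, n). lam powi m" "\<lambda>(m, n). (m + 0, n + 1)" u "(m, n)", OF _ bij_shift] assms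
  by (simp add: torus_V_def case_prod_unfold norm_power_int)

lemma torus_relation:
  assumes "cmod lam = 1" shows "torus_U o\<^sub>L torus_V lam = lam *\<^sub>C (torus_V lam o\<^sub>L torus_U)"
proof -
  have nz: "lam \<noteq> 0" using assms by auto
  have "lam powi (m + 1) = lam * lam powi m" for m
    using nz by (simp add: power_int_add)
  then have "(torus_U o\<^sub>L torus_V lam) u $$ (m, n) = (lam *\<^sub>C (torus_V lam o\<^sub>L torus_U)) u $$ (m, n)" for u m n
    by (simp add: torus_U_apply torus_V_apply[OF assms] scaleC_blinfun.rep_eq scaleC_ell2.rep_eq scaleC_complex_def)
  then show ?thesis
    by (intro blinfun_eqI ell2_eqI) (simp add: split_paired_all)
qed

lemma cinner_ext: "(\<And>y. cinner x y = cinner x' y) \<Longrightarrow> x = (x' :: 'a :: complex_hilbert)"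
proof -
  assume a: "\<And>y. cinner x y = cinner x' y"
  have "inner x z = inner x' z" for z by (simp add: inner_eq_Re_cinner a)
  then have "inner (x - x') (x - x') = 0" by (simp add: inner_diff_left)
  then show ?thesis by simp
qed

lemma op_adjoint_eqI:
  assumes "\<And>x y. cinner (blinfun_apply S x) y = cinner x (blinfun_apply T y)" shows "op_adjoint T = S"
  unfolding op_adjoint_def
proof (rule the_equality)
  show "\<forall>x y. cinner (S x) y = cinner x (T y)" using assms by blast
  fix S' :: "'a \<Rightarrow>\<^sub>L 'a" assume "\<forall>x y. cinner (S' x) y = cinner x (T y)"
  then have "cinner (S' x) y = cinner (S x) y" for x y using assms by simp
  then show "S' = S" by (intro blinfun_eqI) (rule cinner_ext)
qed

lemma op_adjoint_torus_U_apply: "op_adjoint torus_U u $$ (m, n) = u $$ (m - 1, n)"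
proof -
  define S where "S = Blinfun (\<lambda>u :: l2_Z2. Abs_ell2 (\<lambda>i. 1 * u $$ (case i of (m, n) \<Rightarrow> (m + (- 1), n + 0))))"
  have S: "S u $$ (m, n) = u $$ (m - 1, n)" for u m n
    using weighted_shift[of "\<lambda>_. 1" "\<lambda>(m, n). (m + (- 1), n + 0)" u "(m, n)", OF _ bij_shift]
    by (simp add: S_def case_prod_unfold)
  have "op_adjoint torus_U = S"
  proof (rule op_adjoint_eqI)
    fix x y :: l2_Z2
    have "cinner x (torus_U y) = (\<Sum>\<^sub>\<infinity>p. cinner (S x $$ (case p of (m, n) \<Rightarrow> (m + 1, n + 0))) (y $$ (case p of (m, n) \<Rightarrow> (m + 1, n + 0))))"
      unfolding cinner_ell2_def by (intro infsum_cong) (auto simp: S torus_U_apply)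
    also have "\<dots> = cinner (S x) y"
      unfolding cinner_ell2_def by (rule infsum_reindex_bij_betw[OF bij_shift])
    finally show "cinner (S x) y = cinner x (torus_U y)" by simp
  qed
  then show ?thesis by (simp add: S)
qed

lemma op_adjoint_torus_V_apply:
  assumes lam: "cmod lam = 1" shows "op_adjoint (torus_V lam) u $$ (m, n) = lam powi (- m) * u $$ (m, n - 1)"
proof -
  define S where "S = Blinfun (\<lambda>u :: l2_Z2. Abs_ell2 (\<lambda>i. (case i of (m, n) \<Rightarrow> lam powi (- m)) * u $$ (case i of (m, n) \<Rightarrow> (m + 0, n + (- 1)))))"
  have S: "S u $$ (m, n) = lam powi (- m) * u $$ (m, n - 1)" for u m n
    using weighted_shift[of "\<lambda>(m, n). lam powi (- m)" "\<lambda>(m, n). (m + 0, n + (- 1))" u "(m, n)", OF _ bij_shift] lam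
    by (simp add: S_def case_prod_unfold norm_power_int)
  have c: "cnj (lam powi (- m)) = lam powi m" for m
  proof -
    have "cnj lam = inverse lam"
      using lam by (metis complex_norm_square inverse_unique mult.commute of_real_1 power_one)
    then have "cnj (lam powi (- m)) = inverse lam powi (- m)"
      unfolding complex_cnj_power_int by (rule arg_cong)
    also have "\<dots> = lam powi m"
      unfolding power_int_minus power_int_inverse by (rule inverse_inverse_eq)
    finally show ?thesis .
  qed
  have "op_adjoint (torus_V lam) = S"
  proof (rule op_adjoint_eqI)
    fix x y :: l2_Z2
    have "cinner x (torus_V lam y) = (\<Sum>\<^sub>\<infinity>p. cinner (S x $$ (case p of (m, n) \<Rightarrow> (m + 0, n + 1))) (y $$ (case p of (m, n) \<Rightarrow> (m + 0, n + 1))))"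
      unfolding cinner_ell2_def
      by (intro infsum_cong) (auto simp: S torus_V_apply lam cinner_complex_def c[simplified])
    also have "\<dots> = cinner (S x) y"
      unfolding cinner_ell2_def by (rule infsum_reindex_bij_betw[OF bij_shift])
    finally show "cinner (S x) y = cinner x (torus_V lam y)" by simp
  qed
  then show ?thesis by (simp add: S)
qed

lemma op_pow_U_apply: "op_pow torus_U a u $$ (m, n) = u $$ (m + a, n)"
proof -
  have 1: "(((o\<^sub>L) torus_U) ^^ k) id_blinfun u $$ (m, n) = u $$ (m + int k, n)" for k m
    by (induction k arbitrary: m) (auto simp: torus_U_apply algebra_simps)
  have 2: "(((o\<^sub>L) (op_adjoint torus_U)) ^^ k) id_blinfun u $$ (m, n) = u $$ (m - int k, n)" for k m
    by (induction k arbitrary: m) (auto simp: op_adjoint_torus_U_apply algebra_simps)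
  show ?thesis unfolding op_pow_def by (auto simp: 1 2)
qed

lemma op_pow_V_apply:
  assumes lam: "cmod lam = 1" shows "op_pow (torus_V lam) b u $$ (m, n) = lam powi (m * b) * u $$ (m, n + b)"
proof -
  have nz: "lam \<noteq> 0" using lam by auto
  have 1: "(((o\<^sub>L) (torus_V lam)) ^^ k) id_blinfun u $$ (m, n) = lam powi (m * int k) * u $$ (m, n + int k)" for k n
    by (induction k arbitrary: n) (auto simp: torus_V_apply lam nz algebra_simps power_int_add)
  have 2: "(((o\<^sub>L) (op_adjoint (torus_V lam))) ^^ k) id_blinfun u $$ (m, n) = lam powi (- m * int k) * u $$ (m, n - int k)" for k n
    by (induction k arbitrary: n) (auto simp: op_adjoint_torus_V_apply lam nz algebra_simps power_int_add power_int_diff power_int_minus divide_inverse)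
  show ?thesis unfolding op_pow_def by (auto simp: 1 2)
qed

lemma torus_monom_apply:
  assumes "cmod lam = 1"
  shows "torus_monom lam a b u $$ (m, n) = lam powi ((m + a) * b) * u $$ (m + a, n + b)"
  by (simp add: torus_monom_def op_pow_U_apply op_pow_V_apply assms)

lemma sum_ell2_nth: "(\<Sum>i\<in>G. z i) $$ j = (\<Sum>i\<in>G. z i $$ j)"
  by (induction G rule: infinite_finite_induct) (simp_all add: plus_ell2.rep_eq zero_ell2.rep_eq)

lemma linear_extension_sum:
  assumes lam: "cmod lam = 1" and c: "finite {p. c p \<noteq> 0}"
  shows "linear_extension lam G (\<Sum>(m, n) | c (m, n) \<noteq> 0. c (m, n) *\<^sub>C torus_monom lam m n) =
    (\<Sum>(m, n) | c (m, n) \<noteq> 0. c (m, n) *\<^sub>C G m n)"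
proof -
  define b :: l2_Z2 where "b = Abs_ell2 (\<lambda>j. if j = (0, 0) then 1 else 0)"
  have b: "b $$ j = (if j = (0, 0) then 1 else 0)" for j
  proof -
    have "(\<lambda>j :: int \<times> int. (norm (if j = (0, 0) then 1 else 0 :: complex))\<^sup>2) summable_on UNIV"
      using summable_on_finite[of "{(0, 0) :: int \<times> int}" "\<lambda>_. 1 :: real"]
        summable_on_cong_neutral[of "{(0, 0) :: int \<times> int}" UNIV "\<lambda>_. 1 :: real" "\<lambda>j. (norm (if j = (0, 0) then 1 else 0 :: complex))\<^sup>2"]
      by simp
    then show ?thesis by (simp add: b_def Abs_ell2_inverse)
  qed
  have coeff: "(\<Sum>(m, n) | d (m, n) \<noteq> 0. d (m, n) *\<^sub>C torus_monom lam m n) b $$ (- m', - n') = d (m', n')"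
    if d: "finite {p. d p \<noteq> 0}" for d m' n'
  proof -
    have "(\<Sum>(m, n) | d (m, n) \<noteq> 0. d (m, n) *\<^sub>C torus_monom lam m n) b $$ (- m', - n') =
      (\<Sum>p | d p \<noteq> 0. if p = (m', n') then d p else 0)"
      unfolding blinfun.sum_left sum_ell2_nth
      by (rule sum.cong)
         (auto simp: scaleC_blinfun.rep_eq scaleC_ell2.rep_eq scaleC_complex_def torus_monom_apply lam b split: if_splits)
    then show ?thesis using d by (simp add: sum.delta)
  qed
  show ?thesis
    unfolding linear_extension_def
  proof (rule the_equality)
    fix y
    assume "\<exists>d. finite {p. d p \<noteq> 0} \<and>
     (\<Sum>(m, n) | c (m, n) \<noteq> 0. c (m, n) *\<^sub>C torus_monom lam m n) = (\<Sum>(m, n) | d (m, n) \<noteq> 0. d (m, n) *\<^sub>C torus_monom lam m n) \<and>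
     y = (\<Sum>(m, n) | d (m, n) \<noteq> 0. d (m, n) *\<^sub>C G m n)"
    then obtain d where d: "finite {p. d p \<noteq> 0}" 
      "(\<Sum>(m, n) | c (m, n) \<noteq> 0. c (m, n) *\<^sub>C torus_monom lam m n) = (\<Sum>(m, n) | d (m, n) \<noteq> 0. d (m, n) *\<^sub>C torus_monom lam m n)"
      "y = (\<Sum>(m, n) | d (m, n) \<noteq> 0. d (m, n) *\<^sub>C G m n)" by blast
    have "c (m, n) = d (m, n)" for m n
      using coeff[OF c, of m n] coeff[OF d(1), of m n] d(2) by simp
    then have "c = d" by auto
    then show "y = (\<Sum>(m, n) | c (m, n) \<noteq> 0. c (m, n) *\<^sub>C G m n)" using d(3) by simp
  qed (use c in blast)
qed

end

theory Submission
  imports Defs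
begin

text \<open>Put \<open>c = 1 / (1 - \<mu>)\<close> and \<open>z = \<mu>\<^sup>m \<nu>\<^sup>n\<close>. On the monomial \<open>U\<^sup>m V\<^sup>n\<close> the generator, compressed between
  \<open>(1, f)\<close> and \<open>(1, g)\<close>, is multiplication by \<open>(z - 1) cnj (f - c) (g - c)\<close>. Hence the flow must send the
  monomial to its tensor product with the unitary \<open>W z\<close> on Fock space that is the second quantization of
  multiplication by \<open>z\<close> on \<open>[0, t)\<close>, conjugated with a Weyl operator for \<open>c\<close>. The operators \<open>W z\<close> permute the
  exponential vectors up to scalars, which suffices to construct them, acting as the identity on the
  orthogonal complement of the exponential vectors. As monomials are weighted shifts, the flow is
  \<open>x \<mapsto> D\<^sup>* (x \<otimes> 1) D\<close>, where \<open>D\<close> is the diagonal operator with entry \<open>W (\<mu>\<^sup>m \<nu>\<^sup>n)\<close> at \<open>(m, n)\<close>;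
  so it is a \<open>*\<close>-homomorphism on the whole \<open>C\<^sup>*\<close>-algebra without any appeal to its universal property.\<close>

subsection \<open>Hilbert space\<close>

text \<open>The constant c comes from completing the square. On a monomial with eigenvalue z the
  four entries of the generator add up to z - 1 times cnj f * g - c * cnj f - cnj c * g + c * cnj c,
  because cnj c = - \<mu> * c, which is where |\<mu>| = 1 enters. The product form forces the matrix
  element of the flow: it is <u, x v> times the exponential of <f, g> plus z - 1 times the integral
  of cnj (f - c) * (g - c) over [0, t). The formula that carries the proof is the inner product of W
  z and W w applied to exponential vectors: it depends on z and w through cnj z * w alone. For z = w
  of modulus one it says that W z is isometric. For the phases at two lattice points joined by a
  monomial it yields the phase of that monomial, the same at every lattice point. Two obstacles
  shape the rest. The functions f and g are merely square-integrable, so the integral equation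
  concerns a function that is only absolutely continuous. And x \<otimes> 1 has to exist for every x
  in the norm closure, so its norm bound is proved for an arbitrary bounded operator, by positivity
  of Schur products.\<close>

lemma closed_subspace_projection:
  fixes S :: "'a :: {real_inner, complete_space} set"
  assumes S: "subspace S" "closed S"
  obtains y where "y \<in> S" and "\<And>z. z \<in> S \<Longrightarrow> inner (x - y) z = 0"
proof -
  define d where "d = infdist x S"
  have ne: "S \<noteq> {}" and d0: "d \<ge> 0"
    using subspace_0[OF S(1)] by (auto simp: d_def infdist_nonneg)
  have "\<exists>y\<in>S. (norm (x - y))\<^sup>2 < d\<^sup>2 + e" if "e > 0" for e
  proof -
    have "d < sqrt (d\<^sup>2 + e)" using that by (intro real_less_rsqrt) simp
    then have "Inf (dist x ` S) < sqrt (d\<^sup>2 + e)" using ne by (simp add: d_def infdist_def)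
    then obtain y where "y \<in> S" "dist x y < sqrt (d\<^sup>2 + e)" using cInf_lessD[of "dist x ` S"] ne by auto
    then have "(norm (x - y))\<^sup>2 < (sqrt (d\<^sup>2 + e))\<^sup>2"
      by (intro power_strict_mono) (auto simp: dist_norm)
    then show ?thesis using \<open>y \<in> S\<close> that by auto
  qed
  then have "\<forall>n. \<exists>y\<in>S. (norm (x - y))\<^sup>2 < d\<^sup>2 + 1 / real (Suc n)" by simp
  then obtain y where y: "\<And>n. y n \<in> S" "\<And>n. (norm (x - y n))\<^sup>2 < d\<^sup>2 + 1 / real (Suc n)" by metis
  have d_le: "d \<le> norm (x - z)" if "z \<in> S" for z
    using infdist_le[OF that, of x] by (simp add: d_def dist_norm)
  \<comment> \<open>Parallelogram law: the midpoint of two members lies in \<open>S\<close>, hence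
    at distance at least \<open>d\<close> from \<open>x\<close>, so only the two excesses over
    \<open>d\<close> squared survive.\<close>
  have para: "(norm (y m - y n))\<^sup>2 \<le> 2 / real (Suc m) + 2 / real (Suc n)" for m n
  proof -
    have "(1/2) *\<^sub>R (y m + y n) \<in> S" using S(1) y(1) by (simp add: subspace_add subspace_scale)
    then have "d\<^sup>2 \<le> (norm (x - (1/2) *\<^sub>R (y m + y n)))\<^sup>2" using d_le d0 by (intro power_mono)
    moreover have "(norm (y m - y n))\<^sup>2 + 4 * (norm (x - (1/2) *\<^sub>R (y m + y n)))\<^sup>2 = 2 * (norm (x - y m))\<^sup>2 + 2 * (norm (x - y n))\<^sup>2"
      unfolding power2_norm_eq_inner by (simp add: inner_diff inner_add inner_commute algebra_simps)
    ultimately show ?thesis using y(2)[of m] y(2)[of n] by linarith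
  qed
  have "Cauchy y"
  proof (rule CauchyI)
    fix e :: real assume "e > 0"
    then obtain N where "inverse (real (Suc N)) < e\<^sup>2 / 4" using reals_Archimedean[of "e\<^sup>2 / 4"] by auto
    then have N: "4 / real (Suc N) < e\<^sup>2" unfolding divide_inverse[of 4] by linarith
    have "norm (y m - y n) < e" if "m \<ge> N" "n \<ge> N" for m n
    proof (rule power2_less_imp_less)
      have "2 / real (Suc m) \<le> 2 / real (Suc N)" "2 / real (Suc n) \<le> 2 / real (Suc N)"
        using that by (auto intro!: divide_left_mono)
      then show "(norm (y m - y n))\<^sup>2 < e\<^sup>2" using para[of m n] N by linarith
    qed (use \<open>e > 0\<close> in simp)
    then show "\<exists>M. \<forall>m\<ge>M. \<forall>n\<ge>M. norm (y m - y n) < e" by blast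
  qed
  then obtain l where l: "y \<longlonglongrightarrow> l" using Cauchy_convergent convergent_def by blast
  have lS: "l \<in> S" using closed_sequentially[OF S(2) y(1) l] .
  have "(norm (x - l))\<^sup>2 \<le> d\<^sup>2"
  proof (rule LIMSEQ_le)
    show "(\<lambda>n. (norm (x - y n))\<^sup>2) \<longlonglongrightarrow> (norm (x - l))\<^sup>2" by (intro tendsto_intros l)
    show "(\<lambda>n. d\<^sup>2 + 1 / real (Suc n)) \<longlonglongrightarrow> d\<^sup>2"
      using tendsto_add[OF tendsto_const LIMSEQ_inverse_real_of_nat, of "d\<^sup>2"] by (simp add: divide_inverse)
    show "\<exists>N. \<forall>n\<ge>N. (norm (x - y n))\<^sup>2 \<le> d\<^sup>2 + 1 / real (Suc n)" using less_imp_le[OF y(2)] by blast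
  qed
  then have ld: "norm (x - l) \<le> d" using d0 by (rule power2_le_imp_le)
  \<comment> \<open>The angle inequality at a closest point of a convex set, tested at
    \<open>z + l\<close>. Applied to \<open>- z\<close> as well, it becomes orthogonality.\<close>
  have le0: "inner (x - l) z \<le> 0" if "z \<in> S" for z
  proof -
    have "\<forall>w\<in>S. dist x l \<le> dist x w" using d_le ld by (fastforce simp: dist_norm intro: order_trans)
    then show ?thesis
      using any_closest_point_dot[OF subspace_imp_convex[OF S(1)] S(2) lS subspace_add[OF S(1) that lS], of x] by simp
  qed
  have "inner (x - l) z = 0" if "z \<in> S" for z
    using le0[OF that] le0[of "- z"] that S(1) by (simp add: subspace_neg)
  then show thesis using that lS by blast
qed

section \<open>Sesquilinear calculus and polarization\<close>

lemma cinner_zero_right [simp]: "cinner x 0 = (0 :: complex)" for x :: "'a :: complex_hilbert"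
  using cinner_scaleC_right[of x 0 0] by simp

lemma cinner_zero_left [simp]: "cinner 0 x = (0 :: complex)" for x :: "'a :: complex_hilbert"
  using cinner_scaleC_left[of 0 0 x] by simp

lemma scaleC_zero_right [simp]: "c *\<^sub>C 0 = (0 :: 'a :: complex_hilbert)"
  using scaleC_add_right[of c 0 0] by simp

lemma scaleC_minus_right: "c *\<^sub>C (- x) = - (c *\<^sub>C (x :: 'a :: complex_hilbert))"
  using scaleC_add_right[of c x "- x"] by (simp add: eq_neg_iff_add_eq_0 add.commute)

lemma scaleC_diff_right: "c *\<^sub>C (x - y) = c *\<^sub>C x - c *\<^sub>C (y :: 'a :: complex_hilbert)"
  using scaleC_add_right[of c x "- y"] by (simp add: scaleC_minus_right)

lemma cinner_scaleR_left: "cinner (r *\<^sub>R x) y = r *\<^sub>R cinner x (y :: 'a :: complex_hilbert)"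
  by (simp only: scaleR_scaleC cinner_scaleC_left scaleC_complex_def complex_cnj_complex_of_real)

lemma cinner_scaleR_right: "cinner x (r *\<^sub>R y) = r *\<^sub>R cinner x (y :: 'a :: complex_hilbert)"
  by (simp only: scaleR_scaleC cinner_scaleC_right scaleR_conv_of_real scaleC_complex_def)

lemma bounded_bilinear_cinner: "bounded_bilinear (cinner :: 'a :: complex_hilbert \<Rightarrow> 'a \<Rightarrow> complex)"
  by (rule bounded_bilinear.intro)
     (auto simp: cinner_add_left cinner_add_right cinner_scaleR_left cinner_scaleR_right
       intro!: exI[of _ 1] norm_cinner_le)

lemmas cinner_sum_left = bounded_bilinear.sum_left[OF bounded_bilinear_cinner]
lemmas cinner_sum_right = bounded_bilinear.sum_right[OF bounded_bilinear_cinner]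
lemmas cinner_diff_left = bounded_bilinear.diff_left[OF bounded_bilinear_cinner]
lemmas cinner_diff_right = bounded_bilinear.diff_right[OF bounded_bilinear_cinner]
lemmas bounded_linear_cinner_right = bounded_bilinear.bounded_linear_right[OF bounded_bilinear_cinner]
lemmas bounded_linear_cinner_left = bounded_bilinear.bounded_linear_left[OF bounded_bilinear_cinner]

lemma Im_cinner: "Im (cinner x y) = - inner x (\<i> *\<^sub>C y)" for x y :: "'a :: complex_hilbert"
  by (simp add: inner_eq_Re_cinner cinner_scaleC_right)

text \<open>Polarization: the norm determines the real inner product, and replacing \<open>y\<close>
  by its multiple with the imaginary unit recovers the imaginary part.\<close>

lemma norm_preserving_cinner:
  fixes f :: "'a :: complex_hilbert \<Rightarrow> 'b :: complex_hilbert"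
  assumes add: "\<And>x y. f (x + y) = f x + f y" and scale: "\<And>c x. f (c *\<^sub>C x) = c *\<^sub>C f x"
    and norm: "\<And>x. norm (f x) = norm x"
  shows "cinner (f x) (f y) = cinner x y"
proof -
  have inner: "inner (f x) (f y) = inner x y" for x y
    using norm[of "x + y"] unfolding dot_norm by (simp add: add norm)
  have "Im (cinner (f x) (f y)) = Im (cinner x y)"
    using inner[of x "\<i> *\<^sub>C y"] by (simp add: Im_cinner scale)
  then show ?thesis using inner[of x y] by (simp add: complex_eq_iff inner_eq_Re_cinner)
qed

lemma subspace_closure_span:
  fixes B :: "'a :: real_normed_vector set"
  shows "subspace (closure (span B))"
  unfolding subspace_def
proof (intro conjI ballI allI)
  show "0 \<in> closure (span B)" using closure_subset span_zero by blast
  fix x y and c :: real assume x: "x \<in> closure (span B)" and y: "y \<in> closure (span B)"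
  obtain f g where f: "\<And>n. f n \<in> span B" "f \<longlonglongrightarrow> x" and g: "\<And>n. g n \<in> span B" "g \<longlonglongrightarrow> y"
    using x y unfolding closure_sequential by blast
  show "x + y \<in> closure (span B)"
    unfolding closure_sequential
    by (rule exI[of _ "\<lambda>n. f n + g n"]) (auto intro: span_add f g tendsto_add)
  show "c *\<^sub>R x \<in> closure (span B)"
    unfolding closure_sequential
    by (rule exI[of _ "\<lambda>n. c *\<^sub>R f n"]) (auto intro: span_scale f tendsto_intros)
qed

lemma closure_span_induct:
  fixes B :: "'a :: real_normed_vector set"
  assumes x: "x \<in> closure (span B)" and P: "subspace {x. P x}" "closed {x. P x}"
    and B: "\<And>x. x \<in> B \<Longrightarrow> P x"
  shows "P x"
proof -
  have "span B \<subseteq> {x. P x}" using B P(1) by (intro span_minimal) auto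
  then have "closure (span B) \<subseteq> {x. P x}" using P(2) by (intro closure_minimal)
  then show ?thesis using x by blast
qed

text \<open>Phrased as isometric and onto instead of through \<open>op_adjoint\<close>, which is a
  definite description and has a known value only once an adjoint has been exhibited.\<close>

definition unitary_op :: "('h :: complex_hilbert \<Rightarrow>\<^sub>L 'h) \<Rightarrow> bool" where
  "unitary_op W \<longleftrightarrow> W \<in> bounded_ops \<and> (\<forall>x. norm (W x) = norm x) \<and> surj (blinfun_apply W)"

text \<open>The closed linear relation spanned by the pairs \<open>(e i, e' i)\<close> is the graph of an isometry.
  Projecting \<open>(x, 0)\<close> onto it yields half of the projection of \<open>x\<close> onto its domain, which
  provides the decomposition along which the isometry is extended by the identity.\<close>

lemma unitary_extension:
  fixes e e' :: "'i \<Rightarrow> 'h :: complex_hilbert"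
  assumes iso: "\<And>i j. i \<in> I \<Longrightarrow> j \<in> I \<Longrightarrow> cinner (e' i) (e' j) = cinner (e i) (e j)"
    and e'_e: "\<And>i. i \<in> I \<Longrightarrow> \<exists>j\<in>I. \<exists>c. e' i = c *\<^sub>C e j"
    and e_e': "\<And>i. i \<in> I \<Longrightarrow> \<exists>j\<in>I. \<exists>c. e i = c *\<^sub>C e' j"
  shows "\<exists>W. unitary_op W \<and> (\<forall>i\<in>I. W (e i) = e' i)"
proof -
  \<comment> \<open>All complex multiples are included, so that the real span is already complex.
    Pairs live in a product type that carries only the real inner product here, hence the real
    projection theorem.\<close>
  define B where "B = {(c *\<^sub>C e i, c *\<^sub>C e' i) | c i. i \<in> I}"
  define G where "G = closure (span B)"
  define R where "R = {r. \<forall>i\<in>I. cinner r (e i) = 0}"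
  \<comment> \<open>The graph of the extension: the isometry with graph \<open>G\<close> on its
    domain, the identity on \<open>R\<close>.\<close>
  define K where "K = {(s + r, s' + r) | s s' r. (s, s') \<in> G \<and> r \<in> R}"
  have subG: "subspace G" and clG: "closed G" and BG: "B \<subseteq> G"
    unfolding G_def using subspace_closure_span span_superset closure_subset by fastforce+
  have ind: "P p" if "p \<in> G" "subspace {p. P p}" "closed {p. P p}" "\<And>c i. i \<in> I \<Longrightarrow> P (c *\<^sub>C e i, c *\<^sub>C e' i)" for P p
    by (rule closure_span_induct[OF that(1)[unfolded G_def] that(2,3)]) (use that(4) in \<open>auto simp: B_def\<close>)
  have innerG: "inner (fst p) (fst q) = inner (snd p) (snd q)" if p: "p \<in> G" and q: "q \<in> G" for p q
    using q
  proof (rule ind)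
    show "subspace {q. inner (fst p) (fst q) = inner (snd p) (snd q)}"
      by (auto simp: subspace_def inner_add_right)
    show "closed {q. inner (fst p) (fst q) = inner (snd p) (snd q)}"
      by (intro closed_Collect_eq continuous_intros)
    fix d j assume j: "j \<in> I"
    have "inner (fst p) (d *\<^sub>C e j) = inner (snd p) (d *\<^sub>C e' j)"
      using p
    proof (rule ind)
      show "subspace {p. inner (fst p) (d *\<^sub>C e j) = inner (snd p) (d *\<^sub>C e' j)}"
        by (auto simp: subspace_def inner_add_left)
      show "closed {p. inner (fst p) (d *\<^sub>C e j) = inner (snd p) (d *\<^sub>C e' j)}"
        by (intro closed_Collect_eq continuous_intros)
    qed (simp add: inner_eq_Re_cinner cinner_scaleC_left cinner_scaleC_right iso j)
    then show "inner (fst p) (fst (d *\<^sub>C e j, d *\<^sub>C e' j)) = inner (snd p) (snd (d *\<^sub>C e j, d *\<^sub>C e' j))" by simp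
  qed
  have scaleG: "(c *\<^sub>C fst p, c *\<^sub>C snd p) \<in> G" if "p \<in> G" for c p
    using that
  proof (rule ind)
    show "subspace {p. (c *\<^sub>C fst p, c *\<^sub>C snd p) \<in> G}"
      unfolding subspace_def Ball_def mem_Collect_eq
    proof (intro conjI allI impI)
      show "(c *\<^sub>C fst (0 :: 'h \<times> 'h), c *\<^sub>C snd (0 :: 'h \<times> 'h)) \<in> G"
        using subspace_0[OF subG] by (simp add: zero_prod_def)
      show "(c *\<^sub>C fst (p + q), c *\<^sub>C snd (p + q)) \<in> G"
        if "(c *\<^sub>C fst p, c *\<^sub>C snd p) \<in> G" "(c *\<^sub>C fst q, c *\<^sub>C snd q) \<in> G" for p q
        using subspace_add[OF subG that] by (simp add: scaleC_add_right)
      show "(c *\<^sub>C fst (r *\<^sub>R p), c *\<^sub>C snd (r *\<^sub>R p)) \<in> G"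
        if "(c *\<^sub>C fst p, c *\<^sub>C snd p) \<in> G" for r p
        using subspace_scale[OF subG that, of r]
        by (simp add: scaleR_scaleC scaleC_scaleC mult.commute)
    qed
    have "continuous_on UNIV (\<lambda>p :: 'h \<times> 'h. (c *\<^sub>C fst p, c *\<^sub>C snd p))"
      by (intro continuous_intros bounded_linear.continuous_on[OF bounded_linear_scaleC])
    then show "closed {p. (c *\<^sub>C fst p, c *\<^sub>C snd p) \<in> G}"
      using closed_vimage[OF clG] by (simp add: vimage_def)
    fix d i assume "i \<in> I"
    then show "(c *\<^sub>C fst (d *\<^sub>C e i, d *\<^sub>C e' i), c *\<^sub>C snd (d *\<^sub>C e i, d *\<^sub>C e' i)) \<in> G"
      using BG by (auto simp: B_def scaleC_scaleC)
  qed
  \<comment> \<open>Each vector of either family is a multiple of one of the other, so both have the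
    same orthogonal complement. This is what lets the identity on \<open>R\<close> fit both the
    domain and the range.\<close>
  have R': "r \<in> R \<longleftrightarrow> (\<forall>i\<in>I. cinner r (e' i) = 0)" for r
  proof
    show "\<forall>i\<in>I. cinner r (e' i) = 0" if "r \<in> R"
    proof
      fix i assume "i \<in> I"
      then obtain j c where "j \<in> I" "e' i = c *\<^sub>C e j" using e'_e by blast
      then show "cinner r (e' i) = 0" using that by (simp add: R_def cinner_scaleC_right)
    qed
    show "r \<in> R" if *: "\<forall>i\<in>I. cinner r (e' i) = 0"
      unfolding R_def mem_Collect_eq
    proof
      fix i assume "i \<in> I"
      then obtain j c where "j \<in> I" "e i = c *\<^sub>C e' j" using e_e' by blast
      then show "cinner r (e i) = 0" using * by (simp add: cinner_scaleC_right)
    qed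
  qed
  have RG: "inner r (fst p) = 0 \<and> inner r (snd p) = 0" if r: "r \<in> R" and p: "p \<in> G" for r p
    using p
  proof (rule ind)
    show "subspace {p. inner r (fst p) = 0 \<and> inner r (snd p) = 0}"
      by (auto simp: subspace_def inner_add_right)
    show "closed {p. inner r (fst p) = 0 \<and> inner r (snd p) = 0}"
      by (intro closed_Collect_conj closed_Collect_eq continuous_intros)
  qed (use r R'[of r] in \<open>auto simp: inner_eq_Re_cinner cinner_scaleC_right R_def\<close>)
  have in_R: "r \<in> R" if "\<And>p. p \<in> G \<Longrightarrow> inner r (fst p) = 0" for r
    unfolding R_def
  proof (safe)
    fix i assume i: "i \<in> I"
    have "inner r (c *\<^sub>C e i) = 0" for c
      using that[of "(c *\<^sub>C e i, c *\<^sub>C e' i)"] BG i by (auto simp: B_def)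
    \<comment> \<open>The multiples by 1 and by the imaginary unit give the real and the imaginary
      part.\<close>
    from this[of 1] this[of \<i>] show "cinner r (e i) = 0"
      by (simp add: complex_eq_iff Im_cinner inner_eq_Re_cinner)
  qed
  have in_R': "r \<in> R" if "\<And>p. p \<in> G \<Longrightarrow> inner r (snd p) = 0" for r
    unfolding R'
  proof (safe)
    fix i assume i: "i \<in> I"
    have "inner r (c *\<^sub>C e' i) = 0" for c
      using that[of "(c *\<^sub>C e i, c *\<^sub>C e' i)"] BG i by (auto simp: B_def)
    from this[of 1] this[of \<i>] show "cinner r (e' i) = 0"
      by (simp add: complex_eq_iff Im_cinner inner_eq_Re_cinner)
  qed
  have K_left: "\<exists>y. (x, y) \<in> K" for x
  proof -
    obtain p where p: "p \<in> G" "\<And>q. q \<in> G \<Longrightarrow> inner ((x, 0) - p) q = 0"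
      using closed_subspace_projection[OF subG clG] by blast
    \<comment> \<open>Orthogonality of \<open>(x, 0) - p\<close> to \<open>q\<close> reads <x - fst
      p, fst q> = <snd p, snd q>. The right side equals <fst p, fst q> by \<open>innerG\<close>,
      which produces the factor 2.\<close>
    have "inner (x - 2 *\<^sub>R fst p) (fst q) = 0" if "q \<in> G" for q
      using p(2)[OF that] innerG[OF p(1) that] by (simp add: inner_prod_def inner_diff_left)
    then have "x - 2 *\<^sub>R fst p \<in> R" by (rule in_R)
    moreover have "(2 *\<^sub>R fst p, 2 *\<^sub>R snd p) \<in> G"
      using subspace_scale[OF subG p(1), of 2] by (simp add: scaleR_prod_def)
    ultimately have "(2 *\<^sub>R fst p + (x - 2 *\<^sub>R fst p), 2 *\<^sub>R snd p + (x - 2 *\<^sub>R fst p)) \<in> K"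
      unfolding K_def by blast
    then show ?thesis by auto
  qed
  have K_right: "\<exists>x. (x, y) \<in> K" for y
  proof -
    obtain p where p: "p \<in> G" "\<And>q. q \<in> G \<Longrightarrow> inner ((0, y) - p) q = 0"
      using closed_subspace_projection[OF subG clG] by blast
    have "inner (y - 2 *\<^sub>R snd p) (snd q) = 0" if "q \<in> G" for q
      using p(2)[OF that] innerG[OF p(1) that] by (simp add: inner_prod_def inner_diff_left)
    then have "y - 2 *\<^sub>R snd p \<in> R" by (rule in_R')
    moreover have "(2 *\<^sub>R fst p, 2 *\<^sub>R snd p) \<in> G"
      using subspace_scale[OF subG p(1), of 2] by (simp add: scaleR_prod_def)
    ultimately have "(2 *\<^sub>R fst p + (y - 2 *\<^sub>R snd p), 2 *\<^sub>R snd p + (y - 2 *\<^sub>R snd p)) \<in> K"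
      unfolding K_def by blast
    then show ?thesis by auto
  qed
  have subR: "r + t \<in> R" "c *\<^sub>C r \<in> R" "0 \<in> R" if "r \<in> R" "t \<in> R" for r t c
    using that by (auto simp: R_def cinner_add_left cinner_scaleC_left)
  have K_add: "(x + z, y + w) \<in> K" if xy: "(x, y) \<in> K" and zw: "(z, w) \<in> K" for x y z w
  proof -
    obtain s s' r where 1: "x = s + r" "y = s' + r" "(s, s') \<in> G" "r \<in> R" using xy by (auto simp: K_def)
    obtain t t' q where 2: "z = t + q" "w = t' + q" "(t, t') \<in> G" "q \<in> R" using zw by (auto simp: K_def)
    have "((s + t) + (r + q), (s' + t') + (r + q)) \<in> K"
      unfolding K_def using subspace_add[OF subG 1(3) 2(3)] subR(1)[OF 1(4) 2(4)] by auto
    then show ?thesis by (simp add: 1 2 algebra_simps)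
  qed
  have K_scale: "(c *\<^sub>C x, c *\<^sub>C y) \<in> K" if xy: "(x, y) \<in> K" for c x y
  proof -
    obtain s s' r where 1: "x = s + r" "y = s' + r" "(s, s') \<in> G" "r \<in> R" using xy by (auto simp: K_def)
    have "(c *\<^sub>C s + c *\<^sub>C r, c *\<^sub>C s' + c *\<^sub>C r) \<in> K"
      unfolding K_def using scaleG[OF 1(3), of c] subR(2)[OF 1(4) 1(4)] by auto
    then show ?thesis by (simp add: 1 scaleC_add_right)
  qed
  have K_norm: "norm x = norm y" if xy: "(x, y) \<in> K" for x y
  proof -
    obtain s s' r where 1: "x = s + r" "y = s' + r" "(s, s') \<in> G" "r \<in> R" using xy by (auto simp: K_def)
    have "inner x x = inner y y"
      using innerG[OF 1(3) 1(3)] RG[OF 1(4) 1(3)] by (simp add: 1 inner_add inner_commute)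
    then show ?thesis by (simp add: norm_eq_sqrt_inner)
  qed
  \<comment> \<open>A linear relation whose pairs have equal norms is single-valued: the difference
    of two pairs over \<open>x\<close> is a pair over 0.\<close>
  have K_fun: "y = y'" if "(x, y) \<in> K" "(x, y') \<in> K" for x y y'
  proof -
    have "(x + (-1) *\<^sub>C x, y + (-1) *\<^sub>C y') \<in> K" using that K_add K_scale by blast
    moreover have "(-1) *\<^sub>C z = - z" for z :: 'h using scaleR_scaleC[of "-1" z] by simp
    ultimately show ?thesis using K_norm by fastforce
  qed
  define f where "f x = (THE y. (x, y) \<in> K)" for x
  have f: "(x, f x) \<in> K" for x
    unfolding f_def using K_left[of x] K_fun by (metis theI)
  have f_eq: "f x = y" if "(x, y) \<in> K" for x y using K_fun[OF f that] .
  have f_add: "f (x + y) = f x + f y" for x y by (intro f_eq K_add f)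
  have f_scale: "f (c *\<^sub>C x) = c *\<^sub>C f x" for c x by (intro f_eq K_scale f)
  have f_norm: "norm (f x) = norm x" for x using K_norm[OF f[of x]] by simp
  have bl: "bounded_linear f"
    by (rule bounded_linear_intro[where K = 1]) (simp_all add: f_add f_scale f_norm scaleR_scaleC)
  have W: "blinfun_apply (Blinfun f) = f" by (rule bounded_linear_Blinfun_apply[OF bl])
  have "f (e i) = e' i" if "i \<in> I" for i
  proof (rule f_eq)
    have "(1 *\<^sub>C e i, 1 *\<^sub>C e' i) \<in> B" unfolding B_def using that by blast
    then have "(e i, e' i) \<in> G" using BG by auto
    moreover have "0 \<in> R" by (simp add: R_def)
    ultimately have "(e i + 0, e' i + 0) \<in> K" unfolding K_def by blast
    then show "(e i, e' i) \<in> K" by simp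
  qed
  moreover have "surj f" using K_right f_eq by (metis surjI)
  ultimately have "unitary_op (Blinfun f) \<and> (\<forall>i\<in>I. blinfun_apply (Blinfun f) (e i) = e' i)"
    by (simp add: unitary_op_def bounded_ops_def W[unfolded fun_eq_iff] W f_scale f_norm)
  then show ?thesis by blast
qed

lemma unitary_op_scaleC: "unitary_op W \<Longrightarrow> W (c *\<^sub>C x) = c *\<^sub>C W x"
  by (simp add: unitary_op_def bounded_ops_def)

lemma unitary_op_norm: "unitary_op W \<Longrightarrow> norm (W x) = norm x"
  by (simp add: unitary_op_def)

lemma unitary_op_cinner: "unitary_op W \<Longrightarrow> cinner (W x) (W y) = cinner x y"
  by (rule norm_preserving_cinner) (simp_all add: unitary_op_scaleC unitary_op_norm blinfun.add_right)

subsection \<open>Ampliation of operators\<close>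

lemma minus_ell2_nth: "(x - y) $$ i = x $$ i - y $$ i"
  unfolding minus_ell2_def plus_ell2.rep_eq uminus_ell2.rep_eq by simp

lemma norm_ell2_nth_le: "norm (x $$ i) \<le> norm x"
proof (rule power2_le_imp_le)
  show "(norm (x $$ i))\<^sup>2 \<le> (norm x)\<^sup>2"
    unfolding ell2_norm_sq using finite_sum_le_infsum[OF ell2_summable, of "{i}" x] by simp
qed simp

lemma bounded_linear_ell2_nth: "bounded_linear (\<lambda>x. x $$ i)"
  by (rule bounded_linear_intro[where K = 1])
     (simp_all add: plus_ell2.rep_eq scaleR_ell2_def scaleC_ell2.rep_eq scaleR_scaleC norm_ell2_nth_le)

lift_definition ket :: "'i \<Rightarrow> ('i, complex) ell2" is "\<lambda>i j. if j = i then 1 else 0"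
proof -
  fix i :: 'i
  show "(\<lambda>j. (norm (if j = i then 1 else 0 :: complex))\<^sup>2) summable_on UNIV"
    using summable_on_finite[of "{i}" "\<lambda>_. 1 :: real"]
      summable_on_cong_neutral[of "{i}" UNIV "\<lambda>_. 1 :: real" "\<lambda>j. (norm (if j = i then 1 else 0 :: complex))\<^sup>2"]
    by simp
qed

lemma norm_tensor: "norm (u \<otimes>\<^sub>h a) = norm u * norm a"
proof -
  have "complex_of_real ((norm (u \<otimes>\<^sub>h a))\<^sup>2) = complex_of_real ((norm u * norm a)\<^sup>2)"
    using cinner_tensor[of u a u a] by (simp add: cinner_self power_mult_distrib)
  then have "(norm (u \<otimes>\<^sub>h a))\<^sup>2 = (norm u * norm a)\<^sup>2" using of_real_eq_iff by blast
  then show ?thesis by (simp add: power2_eq_iff_nonneg)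
qed

lemma bounded_bilinear_tensor:
  "bounded_bilinear ((\<otimes>\<^sub>h) :: ('i, complex) ell2 \<Rightarrow> 'h :: complex_hilbert \<Rightarrow> ('i, 'h) ell2)"
proof
  fix u v :: "('i, complex) ell2" and a b :: 'h and r :: real
  show "(u + v) \<otimes>\<^sub>h a = u \<otimes>\<^sub>h a + v \<otimes>\<^sub>h a" "u \<otimes>\<^sub>h (a + b) = u \<otimes>\<^sub>h a + u \<otimes>\<^sub>h b"
    "(r *\<^sub>R u) \<otimes>\<^sub>h a = r *\<^sub>R (u \<otimes>\<^sub>h a)" "u \<otimes>\<^sub>h (r *\<^sub>R a) = r *\<^sub>R (u \<otimes>\<^sub>h a)"
    by (rule ell2_eqI, simp add: tensor.rep_eq plus_ell2.rep_eq scaleC_add_left scaleC_add_right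
      scaleR_ell2_def scaleC_ell2.rep_eq scaleR_scaleC scaleC_scaleC scaleC_complex_def mult.commute)+
  show "\<exists>K. \<forall>(u :: ('i, complex) ell2) (a :: 'h). norm (u \<otimes>\<^sub>h a) \<le> norm u * norm a * K"
    by (rule exI[of _ 1]) (simp add: norm_tensor)
qed

lemma tensor_scaleC_left: "(c *\<^sub>C u) \<otimes>\<^sub>h a = c *\<^sub>C (u \<otimes>\<^sub>h a)"
  by (rule ell2_eqI) (simp add: tensor.rep_eq scaleC_ell2.rep_eq scaleC_scaleC scaleC_complex_def)

lemma tensor_scaleC_right: "u \<otimes>\<^sub>h (c *\<^sub>C a) = c *\<^sub>C (u \<otimes>\<^sub>h a)"
  by (rule ell2_eqI) (simp add: tensor.rep_eq scaleC_ell2.rep_eq scaleC_scaleC mult.commute)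

lemma tensor_ext:
  fixes f g :: "('i, 'h :: complex_hilbert) ell2 \<Rightarrow> 'b :: real_normed_vector"
  assumes f: "bounded_linear f" and g: "bounded_linear g" and eq: "\<And>u a. f (u \<otimes>\<^sub>h a) = g (u \<otimes>\<^sub>h a)"
  shows "f x = g x"
proof (rule closure_span_induct[where x = x and P = "\<lambda>x. f x = g x"])
  show "x \<in> closure (span (range (\<lambda>(u, a). u \<otimes>\<^sub>h a)))" unfolding closure_span_tensor by simp
  show "subspace {x. f x = g x}"
    using bounded_linear.linear[OF f] bounded_linear.linear[OF g]
    by (auto simp: subspace_def linear_0 linear_add linear_scale)
  show "closed {x. f x = g x}"
    by (intro closed_Collect_eq linear_continuous_on f g)
qed (use eq in auto)

text \<open>Gives unconditional convergence where absolute convergence can fail: an orthogonal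
  series has square-summable norms only. The bound makes the net of finite partial sums
  Cauchy.\<close>

lemma summable_on_if_sum_bound:
  fixes g :: "'i \<Rightarrow> 'b :: banach" and h :: "'i \<Rightarrow> real"
  assumes h: "h summable_on UNIV" "\<And>i. h i \<ge> 0"
    and le: "\<And>F. finite F \<Longrightarrow> (norm (sum g F))\<^sup>2 \<le> C * sum h F" and C: "C \<ge> 0"
  shows "g summable_on UNIV"
proof -
  have "\<exists>P. eventually P (finite_subsets_at_top UNIV) \<and> (\<forall>F G. P F \<and> P G \<longrightarrow> dist (sum g F) (sum g G) < e)"
    if e: "e > 0" for e
  proof -
    \<comment> \<open>Dividing by \<open>C + 1\<close> keeps the quotient meaningful for
      \<open>C = 0\<close> and makes \<open>C * d\<close> strictly smaller than the target.\<close>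
    define d where "d = (e / 2)\<^sup>2 / (C + 1)"
    have d: "d > 0" using e C by (simp add: d_def)
    have Cd: "C * d < (e / 2)\<^sup>2"
    proof -
      have "C * d < (C + 1) * d" using d by (simp add: algebra_simps)
      also have "\<dots> = (e / 2)\<^sup>2" using C by (simp add: d_def)
      finally show ?thesis .
    qed
    obtain F0 where F0: "finite F0" "dist (sum h F0) (infsum h UNIV) \<le> d"
      using infsum_finite_approximation[OF h(1) d] by auto
    have near: "dist (sum g F) (sum g F0) < e / 2" if F: "finite F" "F0 \<subseteq> F" for F
    proof -
      have "sum h F \<le> infsum h UNIV" using F h by (intro finite_sum_le_infsum) auto
      then have "sum h (F - F0) \<le> d" using F F0(2) by (simp add: sum_diff dist_real_def)
      then have "(norm (sum g (F - F0)))\<^sup>2 \<le> C * d"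
        using le[of "F - F0"] F C by (meson finite_Diff mult_left_mono order_trans)
      then have "(norm (sum g (F - F0)))\<^sup>2 < (e / 2)\<^sup>2" using Cd by linarith
      then have "norm (sum g (F - F0)) < e / 2" by (rule power2_less_imp_less) (use e in simp)
      then show ?thesis using F by (simp add: sum_diff dist_norm)
    qed
    have "dist (sum g F) (sum g G) < e" if "finite F \<and> F0 \<subseteq> F" "finite G \<and> F0 \<subseteq> G" for F G
      using near[of F] near[of G] that dist_triangle_half_l[of "sum g F" "sum g F0" e "sum g G"]
      by (simp add: dist_commute)
    moreover have "eventually (\<lambda>F. finite F \<and> F0 \<subseteq> F) (finite_subsets_at_top UNIV)"
      unfolding eventually_finite_subsets_at_top using F0(1) by auto
    ultimately show ?thesis by blast
  qed
  then have "cauchy_filter (filtermap (sum g) (finite_subsets_at_top UNIV))"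
    by (simp add: cauchy_filter_metric_filtermap)
  moreover have "complete (UNIV :: 'b set)"
    by (meson Cauchy_convergent UNIV_I complete_def convergent_def)
  ultimately obtain l where "(sum g \<longlongrightarrow> l) (finite_subsets_at_top UNIV)"
    using complete_uniform[where S = UNIV] by (force simp add: filterlim_def)
  then show ?thesis using summable_on_def has_sum_def by blast
qed

lemma sum_ket_tensor_nth:
  assumes "finite F" shows "(\<Sum>q\<in>F. ket q \<otimes>\<^sub>h a q) $$ i = (if i \<in> F then a i else 0)"
proof -
  have "(\<Sum>q\<in>F. ket q \<otimes>\<^sub>h a q) $$ i = (\<Sum>q\<in>F. if q = i then a q else 0)"
    unfolding linear_sum[OF bounded_linear.linear[OF bounded_linear_ell2_nth]]
    by (intro sum.cong) (auto simp: tensor.rep_eq ket.rep_eq)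
  then show ?thesis using assms by (simp add: sum.delta')
qed

lemma norm_sum_ket_tensor:
  assumes "finite F" shows "(norm (\<Sum>q\<in>F. ket q \<otimes>\<^sub>h a q))\<^sup>2 = (\<Sum>q\<in>F. (norm (a q))\<^sup>2)"
proof -
  have "(norm (\<Sum>q\<in>F. ket q \<otimes>\<^sub>h a q))\<^sup>2 = (\<Sum>\<^sub>\<infinity>q\<in>F. (norm (a q))\<^sup>2)"
    unfolding ell2_norm_sq by (rule infsum_cong_neutral) (auto simp: sum_ket_tensor_nth assms)
  then show ?thesis using assms by simp
qed

text \<open>Orthogonality makes the squared norm of a partial sum equal to the sum of squares. The
  limit is then identified coordinatewise, each coordinate being continuous.\<close>

lemma has_sum_ket_tensor: "((\<lambda>q. ket q \<otimes>\<^sub>h (x $$ q)) has_sum x) UNIV"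
proof -
  have "(\<lambda>q. ket q \<otimes>\<^sub>h (x $$ q)) summable_on UNIV"
    by (rule summable_on_if_sum_bound[OF ell2_summable, where C = 1]) (auto simp: norm_sum_ket_tensor)
  then obtain y where y: "((\<lambda>q. ket q \<otimes>\<^sub>h (x $$ q)) has_sum y) UNIV" unfolding summable_on_def by blast
  have "y $$ i = x $$ i" for i
  proof -
    have "((\<lambda>q. (ket q \<otimes>\<^sub>h (x $$ q)) $$ i) has_sum y $$ i) UNIV"
      by (rule has_sum_bounded_linear[OF bounded_linear_ell2_nth y])
    moreover have "((\<lambda>q. (ket q \<otimes>\<^sub>h (x $$ q)) $$ i) has_sum x $$ i) UNIV"
      by (rule has_sum_finite_neutralI[of "{i}"]) (auto simp: tensor.rep_eq ket.rep_eq)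
    ultimately show ?thesis by (rule has_sum_unique)
  qed
  then show ?thesis using y ell2_eqI by metis
qed

lemma ket_tensor_complex: "ket q \<otimes>\<^sub>h c = c *\<^sub>C ket q"
  by (rule ell2_eqI) (simp add: tensor.rep_eq ket.rep_eq scaleC_ell2.rep_eq scaleC_complex_def)

text \<open>Schur product positivity: splitting off the component of all vectors along one of them
  reduces the number of nonzero vectors.\<close>

lemma gram_schur_nonneg:
  fixes a :: "'i \<Rightarrow> 'h :: complex_hilbert" and Q :: "'i \<Rightarrow> 'i \<Rightarrow> complex"
  assumes F: "finite F" and Q: "\<And>z. 0 \<le> Re (\<Sum>q\<in>F. \<Sum>r\<in>F. cnj (z q) * z r * Q q r)"
  shows "0 \<le> Re (\<Sum>q\<in>F. \<Sum>r\<in>F. cinner (a q) (a r) * Q q r)"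
proof (induction "card {q\<in>F. a q \<noteq> 0}" arbitrary: a rule: less_induct)
  case less
  show ?case
  proof (cases "\<exists>q\<in>F. a q \<noteq> 0")
    case False
    then show ?thesis by simp
  next
    case True
    then obtain p where p: "p \<in> F" "a p \<noteq> 0" by blast
    define h where "h = a p"
    define n where "n = complex_of_real ((norm h)\<^sup>2)"
    have n: "n \<noteq> 0" "cinner h h = n" using p by (simp_all add: n_def h_def cinner_self)
    define \<alpha> where "\<alpha> q = cinner h (a q) / n" for q
    define b where "b q = a q - \<alpha> q *\<^sub>C h" for q
    have hb: "cinner h (b q) = 0" for q
      using n by (simp add: b_def cinner_diff_right cinner_scaleC_right \<alpha>_def)
    have bh: "cinner (b q) h = 0" for q using hb[of q] cinner_commute[of "b q" h] by simp
    have a: "a q = \<alpha> q *\<^sub>C h + b q" for q by (simp add: b_def)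
    \<comment> \<open>Since \<open>h\<close> is orthogonal to every \<open>b q\<close>, the Gram
      matrix splits into a rank one part, covered by the hypothesis on \<open>Q\<close>, and the
      Gram matrix of the remainders.\<close>
    have gram: "cinner (a q) (a r) = n * (cnj (\<alpha> q) * \<alpha> r) + cinner (b q) (b r)" for q r
      unfolding a by (simp add: cinner_add_left cinner_add_right cinner_scaleC_left cinner_scaleC_right hb bh n)
    have bp: "b p = 0" using n by (simp add: b_def \<alpha>_def h_def[symmetric])
    have "b q = 0" if "a q = 0" for q using that by (simp add: b_def \<alpha>_def)
    then have "{q\<in>F. b q \<noteq> 0} \<subset> {q\<in>F. a q \<noteq> 0}" using p bp by auto
    then have "card {q\<in>F. b q \<noteq> 0} < card {q\<in>F. a q \<noteq> 0}" using F by (intro psubset_card_mono) auto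
    then have "0 \<le> Re (\<Sum>q\<in>F. \<Sum>r\<in>F. cinner (b q) (b r) * Q q r)" by (rule less)
    moreover have "(\<Sum>q\<in>F. \<Sum>r\<in>F. cinner (a q) (a r) * Q q r) =
      n * (\<Sum>q\<in>F. \<Sum>r\<in>F. cnj (\<alpha> q) * \<alpha> r * Q q r) + (\<Sum>q\<in>F. \<Sum>r\<in>F. cinner (b q) (b r) * Q q r)"
      by (simp add: gram distrib_right sum.distrib sum_distrib_left mult.assoc)
    moreover have "0 \<le> Re (n * (\<Sum>q\<in>F. \<Sum>r\<in>F. cnj (\<alpha> q) * \<alpha> r * Q q r))"
      using Q[of \<alpha>] by (simp add: n_def)
    ultimately show ?thesis by simp
  qed
qed

lemma bounded_opsD: "T \<in> bounded_ops \<Longrightarrow> T (c *\<^sub>C x) = c *\<^sub>C T x"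
  by (simp add: bounded_ops_def)

text \<open>The kernel \<open>Q\<close> in the proof, the square of \<open>norm T\<close> times the
  identity minus the Gram matrix of the columns of \<open>T\<close>, is positive because
  \<open>T\<close> is bounded by \<open>norm T\<close> on finite combinations of basis vectors. Its
  Schur product with the Gram matrix of \<open>a\<close> stays nonnegative when summed, and that is
  the claim.\<close>

lemma norm_sum_tensor_le:
  fixes T :: "('i, complex) ell2 \<Rightarrow>\<^sub>L ('i, complex) ell2" and a :: "'i \<Rightarrow> 'h :: complex_hilbert"
  assumes T: "T \<in> bounded_ops" and F: "finite F"
  shows "(norm (\<Sum>q\<in>F. T (ket q) \<otimes>\<^sub>h a q))\<^sup>2 \<le> (norm T)\<^sup>2 * (\<Sum>q\<in>F. (norm (a q))\<^sup>2)"
proof -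
  define M where "M = complex_of_real ((norm T)\<^sup>2)"
  define Q where "Q q r = (if r = q then M else 0) - cinner (T (ket q)) (T (ket r))" for q r
  have gram: "(\<Sum>q\<in>F. \<Sum>r\<in>F. g q r * Q q r) = M * (\<Sum>q\<in>F. g q q) -
    (\<Sum>q\<in>F. \<Sum>r\<in>F. g q r * cinner (T (ket q)) (T (ket r)))" for g
  proof -
    have "(\<Sum>r\<in>F. g q r * (if r = q then M else 0)) = M * g q q" if "q \<in> F" for q
    proof -
      have "(\<Sum>r\<in>F. g q r * (if r = q then M else 0)) = (\<Sum>r\<in>F. if r = q then M * g q r else 0)"
        by (intro sum.cong) auto
      then show ?thesis using F that by (simp add: sum.delta)
    qed
    then show ?thesis
      by (simp add: Q_def right_diff_distrib sum_subtractf sum_distrib_left)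
  qed
  have sq: "cinner (\<Sum>q\<in>F. y q) (\<Sum>q\<in>F. y q) = (\<Sum>q\<in>F. \<Sum>r\<in>F. cinner (y q) (y r))"
    for y :: "'i \<Rightarrow> 'k :: complex_hilbert"
    by (simp only: cinner_sum_left cinner_sum_right) (rule sum.swap)
  have "0 \<le> Re (\<Sum>q\<in>F. \<Sum>r\<in>F. cinner (a q) (a r) * Q q r)"
  proof (rule gram_schur_nonneg[OF F])
    fix z :: "'i \<Rightarrow> complex"
    define y where "y = (\<Sum>q\<in>F. z q *\<^sub>C ket q)"
    have "norm (T y) \<le> norm T * norm y" by (rule norm_blinfun)
    then have le: "(norm (T y))\<^sup>2 \<le> (norm T)\<^sup>2 * (norm y)\<^sup>2"
      unfolding power_mult_distrib[symmetric] by (intro power_mono) auto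
    have y: "(norm y)\<^sup>2 = (\<Sum>q\<in>F. (cmod (z q))\<^sup>2)"
      unfolding y_def using norm_sum_ket_tensor[OF F, of z] by (simp add: ket_tensor_complex)
    have Ty: "(\<Sum>q\<in>F. \<Sum>r\<in>F. cnj (z q) * z r * cinner (T (ket q)) (T (ket r))) =
        complex_of_real ((norm (T y))\<^sup>2)"
      unfolding cinner_self[symmetric] y_def blinfun.sum_right sq bounded_opsD[OF T]
      by (simp add: cinner_scaleC_left cinner_scaleC_right mult_ac)
    have zz: "(\<Sum>q\<in>F. cnj (z q) * z q) = complex_of_real (\<Sum>q\<in>F. (cmod (z q))\<^sup>2)"
      unfolding of_real_sum by (intro sum.cong) (metis complex_norm_square mult.commute)+
    show "0 \<le> Re (\<Sum>q\<in>F. \<Sum>r\<in>F. cnj (z q) * z r * Q q r)"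
      unfolding gram M_def Ty zz of_real_mult[symmetric] of_real_diff[symmetric] Re_complex_of_real
      using le by (simp add: y)
  qed
  moreover have aT: "(\<Sum>q\<in>F. \<Sum>r\<in>F. cinner (a q) (a r) * cinner (T (ket q)) (T (ket r))) =
      complex_of_real ((norm (\<Sum>q\<in>F. T (ket q) \<otimes>\<^sub>h a q))\<^sup>2)"
    unfolding cinner_self[symmetric] sq cinner_tensor by (simp only: mult.commute)
  moreover have aa: "(\<Sum>q\<in>F. cinner (a q) (a q)) = complex_of_real (\<Sum>q\<in>F. (norm (a q))\<^sup>2)"
    unfolding of_real_sum by (simp only: cinner_self)
  ultimately show ?thesis
    unfolding gram M_def aT aa of_real_mult[symmetric] of_real_diff[symmetric] Re_complex_of_real by simp
qed

text \<open>The operator \<open>T \<otimes> 1\<close>, summed over the columns of \<open>T\<close>: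
  a general vector is an infinite sum of tensors with basis vectors, so prescribing values on
  elementary tensors would leave well-definedness and boundedness to be shown.\<close>

definition ampl :: "(('i, complex) ell2 \<Rightarrow>\<^sub>L ('i, complex) ell2) \<Rightarrow> (('i, 'h :: complex_hilbert) ell2 \<Rightarrow>\<^sub>L ('i, 'h) ell2)" where
  "ampl T = Blinfun (\<lambda>x. \<Sum>\<^sub>\<infinity>q. T (ket q) \<otimes>\<^sub>h (x $$ q))"

lemma
  fixes x :: "('i, 'h :: complex_hilbert) ell2"
  assumes T: "T \<in> bounded_ops"
  shows has_sum_ampl: "((\<lambda>q. T (ket q) \<otimes>\<^sub>h (x $$ q)) has_sum ampl T x) UNIV"
    and norm_ampl_apply_le: "norm (ampl T x) \<le> norm T * norm x"
proof -
  define A where "A x = (\<Sum>\<^sub>\<infinity>q. T (ket q) \<otimes>\<^sub>h (x $$ q))" for x :: "('i, 'h) ell2"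
  have A: "((\<lambda>q. T (ket q) \<otimes>\<^sub>h (x $$ q)) has_sum A x) UNIV" for x :: "('i, 'h) ell2"
    unfolding A_def
    by (intro has_sum_infsum summable_on_if_sum_bound[OF ell2_summable _ norm_sum_tensor_le[OF T]]) auto
  have le: "norm (A x) \<le> norm T * norm x" for x :: "('i, 'h) ell2"
  proof (rule power2_le_imp_le)
    show "(norm (A x))\<^sup>2 \<le> (norm T * norm x)\<^sup>2"
    proof (rule tendsto_upperbound)
      show "((\<lambda>F. (norm (\<Sum>q\<in>F. T (ket q) \<otimes>\<^sub>h (x $$ q)))\<^sup>2) \<longlongrightarrow> (norm (A x))\<^sup>2) (finite_subsets_at_top UNIV)"
        using A[of x] unfolding has_sum_def by (intro tendsto_intros)
      have "(norm (\<Sum>q\<in>F. T (ket q) \<otimes>\<^sub>h (x $$ q)))\<^sup>2 \<le> (norm T * norm x)\<^sup>2" if F: "finite F" for F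
      proof -
        have "(norm (\<Sum>q\<in>F. T (ket q) \<otimes>\<^sub>h (x $$ q)))\<^sup>2 \<le> (norm T)\<^sup>2 * (\<Sum>q\<in>F. (norm (x $$ q))\<^sup>2)"
          by (rule norm_sum_tensor_le[OF T F])
        also have "\<dots> \<le> (norm T)\<^sup>2 * (norm x)\<^sup>2"
          unfolding ell2_norm_sq by (intro mult_left_mono finite_sum_le_infsum ell2_summable F) auto
        finally show ?thesis by (simp add: power_mult_distrib)
      qed
      then show "\<forall>\<^sub>F F in finite_subsets_at_top UNIV. (norm (\<Sum>q\<in>F. T (ket q) \<otimes>\<^sub>h (x $$ q)))\<^sup>2 \<le> (norm T * norm x)\<^sup>2"
        by (intro eventually_finite_subsets_at_top_weakI)
    qed simp
  qed simp
  have "bounded_linear A"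
  proof (rule bounded_linear_intro[where K = "norm T"])
    show "A (x + y) = A x + A y" for x y
    proof (rule has_sum_unique[OF A])
      show "((\<lambda>q. T (ket q) \<otimes>\<^sub>h ((x + y) $$ q)) has_sum A x + A y) UNIV"
        using has_sum_add[OF A[of x] A[of y]]
        by (simp add: plus_ell2.rep_eq bounded_bilinear.add_right[OF bounded_bilinear_tensor])
    qed
    show "A (r *\<^sub>R x) = r *\<^sub>R A x" for r x
    proof (rule has_sum_unique[OF A])
      show "((\<lambda>q. T (ket q) \<otimes>\<^sub>h ((r *\<^sub>R x) $$ q)) has_sum r *\<^sub>R A x) UNIV"
        using has_sum_scaleR[OF A[of x], of r]
        by (simp add: scaleR_scaleC scaleC_ell2.rep_eq tensor_scaleC_right)
    qed
    show "norm (A x) \<le> norm x * norm T" for x using le[of x] by (simp add: mult.commute)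
  qed
  then have "blinfun_apply (ampl T) = A"
    unfolding ampl_def A_def[symmetric] by (rule bounded_linear_Blinfun_apply)
  then show "((\<lambda>q. T (ket q) \<otimes>\<^sub>h (x $$ q)) has_sum ampl T x) UNIV" "norm (ampl T x) \<le> norm T * norm x"
    using A le by simp_all
qed

lemma norm_ampl_le: "T \<in> bounded_ops \<Longrightarrow> norm (ampl T) \<le> norm T"
  by (intro norm_blinfun_bound norm_ampl_apply_le) simp_all

lemma ampl_tensor:
  assumes T: "T \<in> bounded_ops" shows "ampl T (u \<otimes>\<^sub>h a) = T u \<otimes>\<^sub>h a"
proof (rule has_sum_unique[OF has_sum_ampl[OF T]])
  have "bounded_linear (\<lambda>w. T w \<otimes>\<^sub>h a)"
    by (intro bounded_linear_compose[OF bounded_bilinear.bounded_linear_left[OF bounded_bilinear_tensor]]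
        blinfun.bounded_linear_right)
  from has_sum_bounded_linear[OF this has_sum_ket_tensor[of u]]
  show "((\<lambda>q. T (ket q) \<otimes>\<^sub>h ((u \<otimes>\<^sub>h a) $$ q)) has_sum T u \<otimes>\<^sub>h a) UNIV"
    by (simp add: ket_tensor_complex bounded_opsD[OF T] tensor_scaleC_left tensor.rep_eq tensor_scaleC_right)
qed

lemma blinfun_tensor_ext:
  assumes "\<And>u a. blinfun_apply S (u \<otimes>\<^sub>h a) = blinfun_apply T (u \<otimes>\<^sub>h a)" shows "S = T"
  by (rule blinfun_eqI) (rule tensor_ext[OF blinfun.bounded_linear_right blinfun.bounded_linear_right assms])

section \<open>Ampliation as a homomorphism\<close>

lemma bounded_ops_add: "S \<in> bounded_ops \<Longrightarrow> T \<in> bounded_ops \<Longrightarrow> S + T \<in> bounded_ops"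
  by (simp add: bounded_ops_def blinfun.add_left scaleC_add_right)

lemma bounded_ops_diff: "S \<in> bounded_ops \<Longrightarrow> T \<in> bounded_ops \<Longrightarrow> S - T \<in> bounded_ops"
  by (simp add: bounded_ops_def blinfun.diff_left scaleC_diff_right)

lemma bounded_ops_compose: "S \<in> bounded_ops \<Longrightarrow> T \<in> bounded_ops \<Longrightarrow> S o\<^sub>L T \<in> bounded_ops"
  unfolding bounded_ops_def by simp

lemma bounded_ops_scaleC: "T \<in> bounded_ops \<Longrightarrow> c *\<^sub>C T \<in> bounded_ops"
  unfolding bounded_ops_def by (simp add: scaleC_blinfun.rep_eq scaleC_scaleC mult.commute)

lemma bounded_ops_id: "id_blinfun \<in> bounded_ops"
  by (simp add: bounded_ops_def)

lemma ampl_add: "S \<in> bounded_ops \<Longrightarrow> T \<in> bounded_ops \<Longrightarrow> ampl (S + T) = ampl S + ampl T"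
  by (intro blinfun_tensor_ext)
     (simp add: ampl_tensor bounded_ops_add blinfun.add_left bounded_bilinear.add_left[OF bounded_bilinear_tensor])

lemma ampl_diff: "S \<in> bounded_ops \<Longrightarrow> T \<in> bounded_ops \<Longrightarrow> ampl (S - T) = ampl S - ampl T"
  by (intro blinfun_tensor_ext)
     (simp add: ampl_tensor bounded_ops_diff blinfun.diff_left bounded_bilinear.diff_left[OF bounded_bilinear_tensor])

lemma ampl_compose: "S \<in> bounded_ops \<Longrightarrow> T \<in> bounded_ops \<Longrightarrow> ampl (S o\<^sub>L T) = ampl S o\<^sub>L ampl T"
  by (intro blinfun_tensor_ext) (simp add: ampl_tensor bounded_ops_compose)

lemma ampl_scaleC: "T \<in> bounded_ops \<Longrightarrow> ampl (c *\<^sub>C T) = c *\<^sub>C ampl T"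
  by (intro blinfun_tensor_ext)
     (simp add: ampl_tensor bounded_ops_scaleC scaleC_blinfun.rep_eq tensor_scaleC_left)

lemma ampl_id: "ampl id_blinfun = id_blinfun"
  by (intro blinfun_tensor_ext) (simp add: ampl_tensor bounded_ops_id)

lemma ampl_bounded_ops: 
  fixes T :: "('i, complex) ell2 \<Rightarrow>\<^sub>L ('i, complex) ell2"
  assumes T: "T \<in> bounded_ops" shows "(ampl T :: ('i, 'h :: complex_hilbert) ell2 \<Rightarrow>\<^sub>L _) \<in> bounded_ops"
proof -
  have "ampl T (c *\<^sub>C x) = c *\<^sub>C ampl T x" for c and x :: "('i, 'h) ell2"
  proof (rule tensor_ext[where x = x])
    show "bounded_linear (\<lambda>x. ampl T (c *\<^sub>C x))" "bounded_linear (\<lambda>x. c *\<^sub>C ampl T x)"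
      by (auto intro!: bounded_linear_compose[OF blinfun.bounded_linear_right bounded_linear_scaleC]
          bounded_linear_compose[OF bounded_linear_scaleC blinfun.bounded_linear_right])
  qed (simp add: tensor_scaleC_left[symmetric] ampl_tensor[OF T] bounded_opsD[OF T])
  then show ?thesis by (simp add: bounded_ops_def)
qed

lemma ampl_adjoint:
  assumes S: "S \<in> bounded_ops" and T: "T \<in> bounded_ops" and adj: "\<And>x y. cinner (S x) y = cinner x (T y)"
  shows "cinner (ampl S x) y = cinner x (ampl T y)"
proof (rule tensor_ext[where x = x])
  show "bounded_linear (\<lambda>x. cinner (ampl S x) y)"
    by (rule bounded_linear_compose[OF bounded_linear_cinner_left blinfun.bounded_linear_right])
  show "bounded_linear (\<lambda>x. cinner x (ampl T y))" by (rule bounded_linear_cinner_left)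
  fix u a
  show "cinner (ampl S (u \<otimes>\<^sub>h a)) y = cinner (u \<otimes>\<^sub>h a) (ampl T y)"
  proof (rule tensor_ext[where x = y])
    show "bounded_linear (\<lambda>y. cinner (u \<otimes>\<^sub>h a) (ampl T y))"
      by (rule bounded_linear_compose[OF bounded_linear_cinner_right blinfun.bounded_linear_right])
    show "bounded_linear (cinner (ampl S (u \<otimes>\<^sub>h a)))" by (rule bounded_linear_cinner_right)
  qed (simp add: ampl_tensor[OF S] ampl_tensor[OF T] cinner_tensor adj)
qed

text \<open>Lets an ampliated monomial be computed one coordinate at a time, now with vectors of the
  second factor as coordinates.\<close>

lemma ampl_weighted_shift:
  assumes T: "T \<in> bounded_ops" and shift: "\<And>u. T u $$ p = w * u $$ p'"
  shows "ampl T x $$ p = w *\<^sub>C (x $$ p')"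
proof (rule tensor_ext[where x = x])
  show "bounded_linear (\<lambda>x. ampl T x $$ p)"
    by (rule bounded_linear_compose[OF bounded_linear_ell2_nth blinfun.bounded_linear_right])
  show "bounded_linear (\<lambda>x. w *\<^sub>C (x $$ p'))"
    by (rule bounded_linear_compose[OF bounded_linear_scaleC bounded_linear_ell2_nth])
qed (simp add: ampl_tensor[OF T] tensor.rep_eq shift scaleC_scaleC)

subsection \<open>Unitary conjugation\<close>

definition diag_op :: "('i \<Rightarrow> 'h :: complex_hilbert \<Rightarrow>\<^sub>L 'h) \<Rightarrow> (('i, 'h) ell2 \<Rightarrow>\<^sub>L ('i, 'h) ell2)" where
  "diag_op W = Blinfun (\<lambda>x. Abs_ell2 (\<lambda>i. W i (x $$ i)))"

lemma
  fixes W :: "'i \<Rightarrow> 'h :: complex_hilbert \<Rightarrow>\<^sub>L 'h"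
  assumes W: "\<And>i. unitary_op (W i)"
  shows diag_op_nth: "diag_op W x $$ i = W i (x $$ i)"
    and unitary_diag_op: "unitary_op (diag_op W)"
proof -
  define D where "D x = Abs_ell2 (\<lambda>i. W i (x $$ i))" for x
  have D: "D x $$ i = W i (x $$ i)" for x i
    unfolding D_def using ell2_summable[of x]
    by (simp add: Abs_ell2_inverse unitary_op_norm[OF W])
  have norm: "norm (D x) = norm x" for x
    using ell2_norm_sq[of "D x"] ell2_norm_sq[of x]
    by (simp add: D unitary_op_norm[OF W] power2_eq_iff_nonneg[symmetric])
  have "bounded_linear D"
    by (rule bounded_linear_intro[where K = 1])
       (auto intro!: ell2_eqI simp: D norm plus_ell2.rep_eq blinfun.add_right scaleR_ell2_def scaleC_ell2.rep_eq
         unitary_op_scaleC[OF W])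
  then have bl: "blinfun_apply (diag_op W) = D"
    unfolding diag_op_def D_def[symmetric] by (rule bounded_linear_Blinfun_apply)
  then show "diag_op W x $$ i = W i (x $$ i)" by (simp add: D)
  have "\<exists>x. D x = y" for y
  proof -
    have "\<forall>i. \<exists>z. W i z = y $$ i"
      using W unfolding unitary_op_def surj_def by metis
    then obtain z where z: "\<And>i. W i (z i) = y $$ i" by metis
    have "norm (z i) = norm (y $$ i)" for i using unitary_op_norm[OF W, of i "z i"] by (simp add: z)
    then have "Abs_ell2 z $$ i = z i" for i
      using ell2_summable[of y] by (simp add: Abs_ell2_inverse)
    then have "D (Abs_ell2 z) = y" by (intro ell2_eqI) (simp add: D z)
    then show ?thesis by blast
  qed
  then have "surj D" by (metis surjI)
  moreover have "D (c *\<^sub>C x) = c *\<^sub>C D x" for c x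
    by (rule ell2_eqI) (simp add: D scaleC_ell2.rep_eq unitary_op_scaleC[OF W])
  ultimately show "unitary_op (diag_op W)"
    by (simp add: unitary_op_def bounded_ops_def bl norm)
qed

text \<open>The inverse satisfies the adjoint relation because a unitary preserves inner products.
  By uniqueness it is the value of \<open>op_adjoint\<close>.\<close>

lemma unitary_op_adjoint:
  fixes W :: "'h :: complex_hilbert \<Rightarrow>\<^sub>L 'h"
  assumes W: "unitary_op W"
  shows "op_adjoint W o\<^sub>L W = id_blinfun" "W o\<^sub>L op_adjoint W = id_blinfun"
    "cinner (op_adjoint W x) y = cinner x (W y)" "op_adjoint W \<in> bounded_ops"
    "norm (op_adjoint W x) = norm x"
proof -
  define g where "g = inv (blinfun_apply W)"
  have inj: "x = y" if "W x = W y" for x y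
    using unitary_op_norm[OF W, of "x - y"] that by (simp add: blinfun.diff_right)
  have Wg: "W (g x) = x" for x using W by (simp add: g_def unitary_op_def surj_f_inv_f)
  have gW: "g (W x) = x" for x by (rule inj) (simp add: Wg)
  have norm: "norm (g x) = norm x" for x using unitary_op_norm[OF W, of "g x"] by (simp add: Wg)
  have "g (x + y) = g x + g y" "g (r *\<^sub>R x) = r *\<^sub>R g x" for x y r
    by (rule inj; simp add: Wg blinfun.add_right blinfun.scaleR_right)+
  then have bl: "bounded_linear g"
    by (intro bounded_linear_intro[where K = 1]) (simp_all add: norm)
  then have G: "blinfun_apply (Blinfun g) = g" by (rule bounded_linear_Blinfun_apply)
  have adj: "cinner (g x) y = cinner x (W y)" for x y
    using unitary_op_cinner[OF W, of "g x" y] by (simp add: Wg)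
  have eq: "op_adjoint W = Blinfun g" by (rule op_adjoint_eqI) (simp add: G adj)
  show "op_adjoint W o\<^sub>L W = id_blinfun" "W o\<^sub>L op_adjoint W = id_blinfun"
    by (rule blinfun_eqI; simp add: eq G gW Wg)+
  show "cinner (op_adjoint W x) y = cinner x (W y)" by (simp add: eq G adj)
  have "g (c *\<^sub>C x) = c *\<^sub>C g x" for c x by (rule inj) (simp add: Wg unitary_op_scaleC[OF W])
  then show "op_adjoint W \<in> bounded_ops" by (simp add: eq G bounded_ops_def)
  show "norm (op_adjoint W x) = norm x" by (simp add: eq G norm)
qed

text \<open>Elements of the operator type are only real-linear. A scalar in the argument of
  \<open>T\<close> can be pulled out on the other side of the adjoint relation, where the inner
  product is complex-linear.\<close>

lemma bounded_ops_if_adjoint: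
  assumes "\<And>x y. cinner (blinfun_apply S x) y = cinner x (blinfun_apply T y)"
  shows "T \<in> bounded_ops"
proof -
  have "T (c *\<^sub>C y) = c *\<^sub>C T y" for c y
  proof (rule cinner_ext)
    fix z
    have "cinner z (T (c *\<^sub>C y)) = cinner z (c *\<^sub>C T y)"
      by (simp add: assms[symmetric] cinner_scaleC_right)
    then show "cinner (T (c *\<^sub>C y)) z = cinner (c *\<^sub>C T y) z"
      by (metis cinner_commute)
  qed
  then show ?thesis by (simp add: bounded_ops_def)
qed

text \<open>Products are respected because \<open>W o\<^sub>L op_adjoint W\<close> cancels between
  two factors. The adjoint hypothesis serves twice: it makes members of \<open>A\<close>
  complex-linear, as ampliation requires, and it provides the value of
  \<open>op_adjoint\<close>.\<close>

lemma unital_star_hom_ampl: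
  fixes W :: "('i, 'h :: complex_hilbert) ell2 \<Rightarrow>\<^sub>L ('i, 'h) ell2"
  assumes W: "unitary_op W"
    and adj: "\<And>T. T \<in> A \<Longrightarrow> \<exists>S. \<forall>x y. cinner (blinfun_apply S x) y = cinner x (blinfun_apply T y)"
  shows "unital_star_hom A (\<lambda>T. op_adjoint W o\<^sub>L ampl T o\<^sub>L W)"
proof -
  define j where "j T = op_adjoint W o\<^sub>L ampl T o\<^sub>L W" for T
  have A: "T \<in> bounded_ops" if "T \<in> A" for T using adj[OF that] bounded_ops_if_adjoint by blast
  have ww: "W (op_adjoint W x) = x" "op_adjoint W (W x) = x" for x
    using arg_cong[OF unitary_op_adjoint(2)[OF W], of "\<lambda>f. blinfun_apply f x"]
      arg_cong[OF unitary_op_adjoint(1)[OF W], of "\<lambda>f. blinfun_apply f x"] by simp_all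
  have "j ` A \<subseteq> bounded_ops"
    using A W by (auto simp: j_def unitary_op_def intro!: bounded_ops_compose ampl_bounded_ops unitary_op_adjoint(4)[OF W])
  moreover have "j id_blinfun = id_blinfun"
    by (intro blinfun_eqI) (simp add: j_def ampl_id ww)
  moreover have "j (S + T) = j S + j T" "j (S o\<^sub>L T) = j S o\<^sub>L j T" if "S \<in> A" "T \<in> A" for S T
    by (intro blinfun_eqI; simp add: j_def ampl_add ampl_compose A that blinfun.add_left blinfun.add_right ww)+
  moreover have "j (c *\<^sub>C T) = c *\<^sub>C j T" if "T \<in> A" for c T
    by (intro blinfun_eqI)
       (simp add: j_def ampl_scaleC A that scaleC_blinfun.rep_eq bounded_opsD[OF unitary_op_adjoint(4)[OF W]])
  moreover have "j (op_adjoint T) = op_adjoint (j T)" if T: "T \<in> A" for T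
  proof -
    obtain S where S: "\<And>x y. cinner (blinfun_apply S x) y = cinner x (blinfun_apply T y)" using adj[OF T] by blast
    have "cinner (T x) y = cinner x (S y)" for x y
      using S[of y x] cinner_commute[of "T x" y] cinner_commute[of x "S y"] by simp
    then have "S \<in> bounded_ops" by (rule bounded_ops_if_adjoint)
    then have "cinner (ampl S x) y = cinner x (ampl T y)" for x y :: "('i, 'h) ell2"
      using ampl_adjoint[OF _ A[OF T] S] by blast
    moreover have "cinner (W x) y = cinner x (op_adjoint W y)" for x y
      using unitary_op_adjoint(3)[OF W, of y x] cinner_commute[of "W x" y] cinner_commute[of x "op_adjoint W y"] by simp
    ultimately have "op_adjoint (j T) = j S"
      by (intro op_adjoint_eqI) (simp add: j_def unitary_op_adjoint(3)[OF W])
    then show ?thesis using op_adjoint_eqI[of S T] S by simp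
  qed
  ultimately show ?thesis unfolding unital_star_hom_def j_def[symmetric] by blast
qed

subsection \<open>The non-commutative torus\<close>

lemma scaleC_blinfun_apply [simp]: "blinfun_apply (c *\<^sub>C T) x = c *\<^sub>C blinfun_apply T x"
  by (simp add: scaleC_blinfun.rep_eq)

lemma norm_adjoint_le:
  fixes S :: "'h :: complex_hilbert \<Rightarrow>\<^sub>L 'k :: complex_hilbert"
  assumes adj: "\<And>x y. cinner (blinfun_apply S x) y = cinner x (blinfun_apply T y)"
  shows "norm S \<le> norm T"
proof (rule norm_blinfun_bound)
  fix x
  have "complex_of_real ((norm (S x))\<^sup>2) = cinner x (T (S x))"
    by (simp only: cinner_self[symmetric] adj)
  then have "(norm (S x))\<^sup>2 \<le> norm x * norm (T (S x))"
    using norm_cinner_le[of x "T (S x)"] by (metis abs_of_nonneg norm_of_real zero_le_power2)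
  also have "\<dots> \<le> norm x * (norm T * norm (S x))"
    by (intro mult_left_mono norm_blinfun) simp
  finally have "norm (S x) * norm (S x) \<le> (norm T * norm x) * norm (S x)"
    by (simp add: power2_eq_square mult_ac)
  then show "norm (S x) \<le> norm T * norm x"
    by (cases "norm (S x) = 0") auto
qed simp

text \<open>Passing to adjoints does not increase the norm of differences, so adjoints of a
  convergent sequence form a Cauchy sequence and their limit is the adjoint of the limit. This
  carries adjoints from the generated algebra to its closure.\<close>

lemma closed_adjointable:
  "closed {T :: 'h :: complex_hilbert \<Rightarrow>\<^sub>L 'h. \<exists>S. \<forall>x y. cinner (blinfun_apply S x) y = cinner x (blinfun_apply T y)}"
  unfolding closed_sequential_limits mem_Collect_eq
proof (intro allI impI)
  fix T and l :: "'h \<Rightarrow>\<^sub>L 'h"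
  assume a: "(\<forall>n. \<exists>S. \<forall>x y. cinner (blinfun_apply S x) y = cinner x (blinfun_apply (T n) y)) \<and> T \<longlonglongrightarrow> l"
  then obtain S where S: "\<And>n x y. cinner (blinfun_apply (S n) x) y = cinner x (blinfun_apply (T n) y)" by metis
  have le: "norm (S m - S n) \<le> norm (T m - T n)" for m n
    by (rule norm_adjoint_le) (simp add: blinfun.diff_left cinner_diff_left cinner_diff_right S)
  have "Cauchy T" using a LIMSEQ_imp_Cauchy by blast
  then have "Cauchy S" unfolding Cauchy_iff using le by (meson order_le_less_trans)
  then obtain S' where S': "S \<longlonglongrightarrow> S'" using Cauchy_convergent convergent_def by blast
  have "cinner (S' x) y = cinner x (l y)" for x y
  proof (rule LIMSEQ_unique)
    have "(\<lambda>n. S n x) \<longlonglongrightarrow> S' x" by (intro blinfun.tendsto S' tendsto_const)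
    then show "(\<lambda>n. cinner (S n x) y) \<longlonglongrightarrow> cinner (S' x) y"
      by (intro bounded_bilinear.tendsto[OF bounded_bilinear_cinner] tendsto_const)
    have "(\<lambda>n. T n y) \<longlonglongrightarrow> l y" using a by (intro blinfun.tendsto tendsto_const) simp
    then show "(\<lambda>n. cinner (S n x) y) \<longlonglongrightarrow> cinner x (l y)"
      unfolding S by (intro bounded_bilinear.tendsto[OF bounded_bilinear_cinner] tendsto_const)
  qed
  then show "\<exists>S. \<forall>x y. cinner (blinfun_apply S x) y = cinner x (blinfun_apply l y)" by blast
qed

lemma cmod_1_nonzero: "cmod z = 1 \<Longrightarrow> z \<noteq> 0"
  by auto

lemma cnj_eq_inverse: "cmod z = 1 \<Longrightarrow> cnj z = inverse z"
  by (metis complex_norm_square inverse_unique mult.commute of_real_1 power_one)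

text \<open>The scalar is the price of moving \<open>V\<close> to the power \<open>b\<close> past
  \<open>U\<close> to the power \<open>a'\<close>: the commutation relation contributes an inverse
  \<open>lam\<close> for each of the \<open>a' * b\<close> exchanges.\<close>

lemma torus_monom_compose:
  assumes lam: "cmod lam = 1"
  shows "torus_monom lam a b o\<^sub>L torus_monom lam a' b' = (lam powi (- (a' * b))) *\<^sub>C torus_monom lam (a + a') (b + b')"
proof -
  have "(torus_monom lam a b o\<^sub>L torus_monom lam a' b') u $$ (m, n) =
      ((lam powi (- (a' * b))) *\<^sub>C torus_monom lam (a + a') (b + b')) u $$ (m, n)" for u m n
  proof -
    have "lam powi ((m + a) * b) * lam powi ((m + a + a') * b') = lam powi (- (a' * b)) * lam powi ((m + (a + a')) * (b + b'))"
      unfolding power_int_add[OF disjI1[OF cmod_1_nonzero[OF lam]], symmetric]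
      by (rule arg_cong[where f = "\<lambda>k. lam powi k"]) (simp add: algebra_simps)
    then show ?thesis
      by (simp add: torus_monom_apply[OF lam] scaleC_ell2.rep_eq scaleC_complex_def mult.assoc[symmetric] add.assoc)
  qed
  then show ?thesis by (intro blinfun_eqI ell2_eqI) (simp add: split_paired_all)
qed

text \<open>The adjoint reverses the factors, and restoring the order \<open>U\<close> before
  \<open>V\<close> costs this scalar. In the infinite sum it amounts to reindexing by a translation
  of the lattice.\<close>

lemma torus_monom_adjoint:
  assumes lam: "cmod lam = 1"
  shows "cinner (((lam powi (- (a * b))) *\<^sub>C torus_monom lam (- a) (- b)) u) v = cinner u (torus_monom lam a b v)"
proof -
  have nz: "lam \<noteq> 0" using lam by auto
  have "cinner u (torus_monom lam a b v) = (\<Sum>\<^sub>\<infinity>p. cinner (((lam powi (- (a * b))) *\<^sub>C torus_monom lam (- a) (- b)) u $$ (case p of (m, n) \<Rightarrow> (m + a, n + b)))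
      (v $$ (case p of (m, n) \<Rightarrow> (m + a, n + b))))"
    unfolding cinner_ell2_def
  proof (intro infsum_cong)
    fix p :: "int \<times> int"
    obtain m n where p: "p = (m, n)" by force
    have c: "lam powi (b * (m + a)) = cnj lam powi - (a * b) * cnj lam powi - (b * m)"
      unfolding cnj_eq_inverse[OF lam] power_int_inverse power_int_minus inverse_inverse_eq
        power_int_add[OF disjI1[OF nz], symmetric]
      by (rule arg_cong[where f = "\<lambda>k. lam powi k"]) (simp add: algebra_simps)
    show "cinner (u $$ p) (torus_monom lam a b v $$ p) =
      cinner (((lam powi (- (a * b))) *\<^sub>C torus_monom lam (- a) (- b)) u $$ (case p of (m, n) \<Rightarrow> (m + a, n + b)))
      (v $$ (case p of (m, n) \<Rightarrow> (m + a, n + b)))"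
      by (simp add: p torus_monom_apply[OF lam] scaleC_ell2.rep_eq scaleC_complex_def cinner_complex_def c mult_ac)
  qed
  also have "\<dots> = cinner (((lam powi (- (a * b))) *\<^sub>C torus_monom lam (- a) (- b)) u) v"
    unfolding cinner_ell2_def by (rule infsum_reindex_bij_betw[OF bij_shift])
  finally show ?thesis by simp
qed

lemma torus_U_eq_monom: "cmod lam = 1 \<Longrightarrow> torus_U = torus_monom lam 1 0"
  by (intro blinfun_eqI ell2_eqI) (simp add: split_paired_all torus_U_apply torus_monom_apply)

lemma torus_V_eq_monom: "cmod lam = 1 \<Longrightarrow> torus_V lam = torus_monom lam 0 1"
  by (intro blinfun_eqI ell2_eqI) (simp add: split_paired_all torus_V_apply torus_monom_apply)

text \<open>Real spans suffice since the spanning set is invariant under complex scalars.\<close>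

definition torus_monoms :: "complex \<Rightarrow> (l2_Z2 \<Rightarrow>\<^sub>L l2_Z2) set" where
  "torus_monoms lam = {c *\<^sub>C torus_monom lam a b | c a b. True}"

lemma blinfun_scaleC_add: "c *\<^sub>C (S + T) = c *\<^sub>C S + c *\<^sub>C (T :: 'a :: real_normed_vector \<Rightarrow>\<^sub>L 'b :: complex_hilbert)"
  by (rule blinfun_eqI) (simp add: blinfun.add_left scaleC_add_right)

lemma blinfun_scaleC_scaleR: "c *\<^sub>C (r *\<^sub>R T) = r *\<^sub>R (c *\<^sub>C (T :: 'a :: real_normed_vector \<Rightarrow>\<^sub>L 'b :: complex_hilbert))"
  by (rule blinfun_eqI) (simp add: blinfun.scaleR_left scaleR_scaleC scaleC_scaleC mult.commute)

lemma blinfun_scaleC_scaleC: "c *\<^sub>C (d *\<^sub>C T) = (c * d) *\<^sub>C (T :: 'a :: real_normed_vector \<Rightarrow>\<^sub>L 'b :: complex_hilbert)"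
  by (rule blinfun_eqI) (simp add: scaleC_scaleC)

lemma blinfun_scaleC_add_left: "(c + d) *\<^sub>C T = c *\<^sub>C T + d *\<^sub>C (T :: 'a :: real_normed_vector \<Rightarrow>\<^sub>L 'b :: complex_hilbert)"
  by (rule blinfun_eqI) (simp add: blinfun.add_left scaleC_add_left)

lemma blinfun_scaleC_zero_right: "c *\<^sub>C 0 = (0 :: 'a :: real_normed_vector \<Rightarrow>\<^sub>L 'b :: complex_hilbert)"
  by (rule blinfun_eqI) simp

lemma torus_monomsI: "c *\<^sub>C torus_monom lam a b \<in> torus_monoms lam"
  unfolding torus_monoms_def by blast

lemma torus_monoms_scaleC: "x \<in> torus_monoms lam \<Longrightarrow> c *\<^sub>C x \<in> torus_monoms lam"
  by (clarsimp simp: torus_monoms_def blinfun_scaleC_scaleC) blast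

lemma span_monoms_scaleC: "x \<in> span (torus_monoms lam) \<Longrightarrow> c *\<^sub>C x \<in> span (torus_monoms lam)"
  by (induction rule: span_induct_alt)
     (auto simp: blinfun_scaleC_add blinfun_scaleC_scaleR blinfun_scaleC_zero_right
       intro: span_zero span_add span_scale span_base torus_monoms_scaleC)

lemma torus_monoms_compose:
  assumes lam: "cmod lam = 1" and x: "x \<in> torus_monoms lam" and y: "y \<in> torus_monoms lam"
  shows "x o\<^sub>L y \<in> torus_monoms lam"
proof -
  obtain c a b where x: "x = c *\<^sub>C torus_monom lam a b" using x by (auto simp: torus_monoms_def)
  obtain d a' b' where y: "y = d *\<^sub>C torus_monom lam a' b'" using y by (auto simp: torus_monoms_def)
  have lin: "torus_monom lam a b (d *\<^sub>C u) = d *\<^sub>C torus_monom lam a b u" for u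
    by (intro ell2_eqI)
       (simp add: split_paired_all torus_monom_apply[OF lam] scaleC_ell2.rep_eq scaleC_complex_def)
  have "x o\<^sub>L y = (c * d) *\<^sub>C (torus_monom lam a b o\<^sub>L torus_monom lam a' b')"
    by (rule blinfun_eqI) (simp add: x y lin scaleC_scaleC)
  then show ?thesis
    unfolding torus_monom_compose[OF lam] blinfun_scaleC_scaleC by (simp only: torus_monomsI)
qed

lemma span_monoms_compose:
  assumes lam: "cmod lam = 1" and x: "x \<in> span (torus_monoms lam)" and y: "y \<in> span (torus_monoms lam)"
  shows "x o\<^sub>L y \<in> span (torus_monoms lam)"
  using x
proof (induction rule: span_induct_alt)
  case base
  then show ?case by (simp add: span_zero)
next
  case (step c a x)
  have "a o\<^sub>L y \<in> span (torus_monoms lam)"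
    using y
  proof (induction rule: span_induct_alt)
    case base
    then show ?case by (simp add: span_zero)
  next
    case (step d b y)
    have "a o\<^sub>L (d *\<^sub>R b + y) = d *\<^sub>R (a o\<^sub>L b) + (a o\<^sub>L y)"
      by (rule blinfun_eqI) (simp add: blinfun.add_left blinfun.scaleR_left blinfun.add_right blinfun.scaleR_right)
    then show ?case
      using step torus_monoms_compose[OF lam \<open>a \<in> _\<close>] by (simp add: span_add span_scale span_base)
  qed
  moreover have "(c *\<^sub>R a + x) o\<^sub>L y = c *\<^sub>R (a o\<^sub>L y) + (x o\<^sub>L y)"
    by (rule blinfun_eqI) (simp add: blinfun.add_left blinfun.scaleR_left)
  ultimately show ?case using step by (simp add: span_add span_scale)
qed

lemma span_monoms_adjoint:
  assumes lam: "cmod lam = 1" and x: "x \<in> span (torus_monoms lam)"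
  shows "\<exists>y\<in>span (torus_monoms lam). \<forall>u v. cinner (blinfun_apply y u) v = cinner u (blinfun_apply x v)"
  using x
proof (induction rule: span_induct_alt)
  case base
  then show ?case by (intro bexI[of _ 0]) (auto simp: span_zero)
next
  case (step r a x)
  obtain c m n where a: "a = c *\<^sub>C torus_monom lam m n" using step(1) by (auto simp: torus_monoms_def)
  obtain y where y: "y \<in> span (torus_monoms lam)" "\<And>u v. cinner (blinfun_apply y u) v = cinner u (blinfun_apply x v)"
    using step(2) by blast
  define b where "b = cnj c *\<^sub>C ((lam powi (- (m * n))) *\<^sub>C torus_monom lam (- m) (- n))"
  have "b \<in> torus_monoms lam" unfolding b_def blinfun_scaleC_scaleC by (rule torus_monomsI)
  then have "r *\<^sub>R b + y \<in> span (torus_monoms lam)" using y by (simp add: span_add span_scale span_base)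
  moreover have "cinner (b u) v = cinner u (a v)" for u v
    using torus_monom_adjoint[OF lam, of m n u v]
    by (simp only: a b_def scaleC_blinfun_apply[of "cnj c"] scaleC_blinfun_apply[of c] cinner_scaleC_left cinner_scaleC_right complex_cnj_cnj)
  ultimately show ?case
    by (intro bexI[of _ "r *\<^sub>R b + y"])
       (simp_all add: blinfun.add_left blinfun.scaleR_left cinner_add_left cinner_add_right cinner_scaleR_left cinner_scaleR_right y)
qed

lemma torus_alg0_span:
  assumes lam: "cmod lam = 1" and x: "x \<in> torus_alg0 lam"
  shows "x \<in> span (torus_monoms lam)"
  using x
proof induction
  case U
  have "torus_U = 1 *\<^sub>C torus_monom lam 1 0"
    by (rule blinfun_eqI) (simp add: torus_U_eq_monom[OF lam])
  then show ?case unfolding torus_monoms_def by (intro span_base) blast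
next
  case V
  have "torus_V lam = 1 *\<^sub>C torus_monom lam 0 1"
    by (rule blinfun_eqI) (simp add: torus_V_eq_monom[OF lam])
  then show ?case unfolding torus_monoms_def by (intro span_base) blast
next
  case (op_adjoint x)
  obtain y where y: "y \<in> span (torus_monoms lam)" "\<And>u v. cinner (blinfun_apply y u) v = cinner u (blinfun_apply x v)"
    using span_monoms_adjoint[OF lam op_adjoint(2)] by blast
  then show ?case using op_adjoint_eqI[of y x] by simp
qed (auto intro: span_add span_monoms_scaleC span_monoms_compose[OF lam])

lemma nc_torus_adjointable:
  assumes lam: "cmod lam = 1" and x: "x \<in> nc_torus lam"
  shows "\<exists>y. \<forall>u v. cinner (blinfun_apply y u) v = cinner u (blinfun_apply x v)"
proof -
  have "torus_alg0 lam \<subseteq> {T. \<exists>S. \<forall>x y. cinner (blinfun_apply S x) y = cinner x (blinfun_apply T y)}"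
    using span_monoms_adjoint[OF lam torus_alg0_span[OF lam]] by blast
  then show ?thesis using x closure_minimal[OF _ closed_adjointable] unfolding nc_torus_def by blast
qed

lemma nc_torus_bounded_ops: "cmod lam = 1 \<Longrightarrow> x \<in> nc_torus lam \<Longrightarrow> x \<in> bounded_ops"
  using nc_torus_adjointable bounded_ops_if_adjoint by blast

text \<open>Brings an element into the form on which \<open>linear_extension_sum\<close> evaluates
  the maps defined by linear extension.\<close>

lemma torus_alg0_lincomb:
  assumes lam: "cmod lam = 1" and x: "x \<in> torus_alg0 lam"
  obtains c where "finite {p. c p \<noteq> 0}" and "x = (\<Sum>(m, n) | c (m, n) \<noteq> 0. c (m, n) *\<^sub>C torus_monom lam m n)"
proof -
  define M where "M p = torus_monom lam (fst p) (snd p)" for p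
  have ext: "(\<Sum>p | c p \<noteq> 0. c p *\<^sub>C M p) = (\<Sum>p\<in>F. c p *\<^sub>C M p)" if "finite F" "{p. c p \<noteq> 0} \<subseteq> F" for c F
  proof (rule sum.mono_neutral_left[OF that])
    have "0 *\<^sub>C T = 0" for T :: "l2_Z2 \<Rightarrow>\<^sub>L l2_Z2" by (rule blinfun_eqI) simp
    then show "\<forall>p\<in>F - {p. c p \<noteq> 0}. c p *\<^sub>C M p = 0" by simp
  qed
  have "\<exists>c. finite {p. c p \<noteq> 0} \<and> x = (\<Sum>p | c p \<noteq> 0. c p *\<^sub>C M p)"
    using torus_alg0_span[OF lam x]
  proof (induction rule: span_induct_alt)
    case base
    show ?case by (rule exI[of _ "\<lambda>_. 0"]) simp
  next
    case (step r a x)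
    obtain d m n where a: "a = d *\<^sub>C torus_monom lam m n" using step(1) by (auto simp: torus_monoms_def)
    obtain c where c: "finite {p. c p \<noteq> 0}" "x = (\<Sum>p | c p \<noteq> 0. c p *\<^sub>C M p)" using step(2) by blast
    \<comment> \<open>A common index set for both combinations. The new coefficient may cancel to 0,
      so the support itself can shrink.\<close>
    define F where "F = insert (m, n) {p. c p \<noteq> 0}"
    define c' where "c' = c((m, n) := c (m, n) + complex_of_real r * d)"
    have F: "finite F" "{p. c p \<noteq> 0} \<subseteq> F" "{p. c' p \<noteq> 0} \<subseteq> F" "(m, n) \<in> F"
      using c by (auto simp: F_def c'_def)
    have "(\<Sum>p\<in>F. c' p *\<^sub>C M p) = (\<Sum>p\<in>F. c p *\<^sub>C M p + (if p = (m, n) then (complex_of_real r * d) *\<^sub>C M (m, n) else 0))"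
      by (rule sum.cong) (auto simp: c'_def blinfun_scaleC_add_left)
    also have "\<dots> = (\<Sum>p\<in>F. c p *\<^sub>C M p) + (complex_of_real r * d) *\<^sub>C M (m, n)"
      using F by (simp add: sum.distrib)
    also have "(complex_of_real r * d) *\<^sub>C M (m, n) = r *\<^sub>R a"
      by (rule blinfun_eqI) (simp add: a M_def blinfun.scaleR_left scaleR_scaleC scaleC_scaleC)
    finally have "(\<Sum>p | c' p \<noteq> 0. c' p *\<^sub>C M p) = r *\<^sub>R a + x"
      by (simp only: ext[OF F(1,3)] ext[OF F(1,2)] c(2) add.commute)
    then have "r *\<^sub>R a + x = (\<Sum>p | c' p \<noteq> 0. c' p *\<^sub>C M p)" by (rule sym)
    moreover have "finite {p. c' p \<noteq> 0}" using F(1,3) finite_subset by blast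
    ultimately show ?case by blast
  qed
  then obtain c where "finite {p. c p \<noteq> 0}" "x = (\<Sum>p | c p \<noteq> 0. c p *\<^sub>C M p)" by blast
  then show thesis by (intro that[of c]) (simp_all add: M_def case_prod_unfold)
qed

text \<open>The terms on the left are the matrix entries of the generator on a monomial with
  eigenvalue \<open>z\<close>, in the order tau, upper right, delta, lower right, weighted by 1,
  \<open>g\<close>, \<open>cnj f\<close> and \<open>cnj f * g\<close>.\<close>

lemma phi_coeff:
  assumes mu: "cmod mu = 1" "mu \<noteq> 1"
  shows "mu / (1 - mu) * ((1 - z) / (1 - mu)) + g * (- mu * ((1 - z) / (1 - mu))) +
      cnj f * ((1 - z) / (1 - mu)) + cnj f * g * (z - 1) =
    (z - 1) * (cnj (f - 1 / (1 - mu)) * (g - 1 / (1 - mu)))"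
proof -
  have nz: "mu \<noteq> 0" "1 - mu \<noteq> 0" "mu - 1 \<noteq> 0" using mu by auto
  \<comment> \<open>On the unit circle conjugation of \<open>mu\<close> is inversion. This ties the
    upper right entry of the generator to the lower left one.\<close>
  have c: "cnj (1 / (1 - mu)) = - (mu / (1 - mu))"
    using nz by (simp add: cnj_eq_inverse[OF mu(1)] field_simps)
  show ?thesis
    unfolding complex_cnj_diff c using nz by (simp add: divide_simps) (simp add: algebra_simps)
qed

lemma compress_torus_phi:
  assumes lam: "cmod lam = 1" and mu: "cmod mu = 1" "mu \<noteq> 1" and c: "finite {p. c p \<noteq> 0}"
  shows "compress (hat_vec f s) (torus_phi lam mu nu (\<Sum>(m, n) | c (m, n) \<noteq> 0. c (m, n) *\<^sub>C torus_monom lam m n)) (hat_vec g s) =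
    (\<Sum>(m, n) | c (m, n) \<noteq> 0. (c (m, n) * ((mu powi m * nu powi n - 1) *
      (cnj (f s - 1 / (1 - mu)) * (g s - 1 / (1 - mu))))) *\<^sub>C torus_monom lam m n)"
    (is "?L = ?R")
proof (intro blinfun_eqI ell2_eqI)
  fix u i
  define F where "F = {(m, n). c (m, n) \<noteq> 0}"
  define M where "M p = torus_monom lam (fst p) (snd p) u $$ i" for p
  define z where "z p = mu powi fst p * nu powi snd p" for p
  have nth: "blinfun_apply (\<Sum>(m, n) | c (m, n) \<noteq> 0. c (m, n) *\<^sub>C G m n) u $$ i =
      (\<Sum>p\<in>F. c p * (blinfun_apply (G (fst p) (snd p)) u $$ i))" for G
    by (simp add: F_def case_prod_unfold blinfun.sum_left sum_ell2_nth scaleC_ell2.rep_eq scaleC_complex_def)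
  define x where "x = (\<Sum>(m, n) | c (m, n) \<noteq> 0. c (m, n) *\<^sub>C torus_monom lam m n)"
  have x: "x u $$ i = (\<Sum>p\<in>F. c p * M p)"
    unfolding x_def nth M_def ..
  have d: "torus_delta lam mu nu x u $$ i = (\<Sum>p\<in>F. c p * ((1 - z p) / (1 - mu) * M p))"
    unfolding x_def torus_delta_def linear_extension_sum[OF lam c] nth
    by (simp add: M_def z_def scaleC_ell2.rep_eq scaleC_complex_def)
  have p: "torus_pi lam mu nu x u $$ i = (\<Sum>p\<in>F. c p * (z p * M p))"
    unfolding x_def torus_pi_def linear_extension_sum[OF lam c] nth
    by (simp add: M_def z_def scaleC_ell2.rep_eq scaleC_complex_def)
  have "compress (hat_vec f s) (torus_phi lam mu nu x) (hat_vec g s) u $$ i =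
     mu / (1 - mu) * (\<Sum>p\<in>F. c p * ((1 - z p) / (1 - mu) * M p)) +
     g s * (- mu * (\<Sum>p\<in>F. c p * ((1 - z p) / (1 - mu) * M p))) +
     cnj (f s) * (\<Sum>p\<in>F. c p * ((1 - z p) / (1 - mu) * M p)) +
     cnj (f s) * g s * ((\<Sum>p\<in>F. c p * (z p * M p)) - (\<Sum>p\<in>F. c p * M p))"
    unfolding compress_def torus_phi_def hat_vec_def torus_tau_def sum_2
    by (simp add: blinfun.add_left blinfun.diff_left plus_ell2.rep_eq minus_ell2_nth scaleC_ell2.rep_eq
        scaleC_complex_def x d p)
  also have "\<dots> = (\<Sum>p\<in>F. c p * (mu / (1 - mu) * ((1 - z p) / (1 - mu)) + g s * (- mu * ((1 - z p) / (1 - mu))) +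
      cnj (f s) * ((1 - z p) / (1 - mu)) + cnj (f s) * g s * (z p - 1)) * M p)"
    unfolding sum_distrib_left sum_subtractf[symmetric] sum.distrib[symmetric]
    by (intro sum.cong refl) (simp only: ring_distribs mult_ac mult_1_left)
  also have "\<dots> = ?R u $$ i"
    unfolding phi_coeff[OF mu]
    by (simp add: F_def M_def z_def case_prod_unfold blinfun.sum_left sum_ell2_nth scaleC_ell2.rep_eq scaleC_complex_def mult.assoc)
  finally show "?L u $$ i = ?R u $$ i" unfolding x_def .
qed

subsection \<open>The exponential of an indefinite Lebesgue integral\<close>

text \<open>A function whose increments are quadratically small relative to those of a continuous
  function is constant; this replaces differentiation, as the integrand is merely integrable.\<close>

lemma constant_if_quadratic_increments:
  fixes G :: "real \<Rightarrow> 'a :: real_normed_vector" and L :: "real \<Rightarrow> real"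
  assumes T: "0 \<le> T" and L: "continuous_on {0..T} L"
    and mono: "\<And>a b. 0 \<le> a \<Longrightarrow> a \<le> b \<Longrightarrow> b \<le> T \<Longrightarrow> L a \<le> L b"
    and C: "C > 0" and G: "\<And>a b. 0 \<le> a \<Longrightarrow> a \<le> b \<Longrightarrow> b \<le> T \<Longrightarrow> norm (G b - G a) \<le> C * (L b - L a)\<^sup>2"
  shows "G T = G 0"
proof -
  have bd: "norm (G T - G 0) \<le> e * (L T - L 0)" if e: "e > 0" for e
  proof -
    \<comment> \<open>The guard is there because interval induction also asks about small intervals
      around \<open>x\<close> that leave \<open>{0..T}\<close>.\<close>
    define P where "P a b \<longleftrightarrow> (0 \<le> a \<and> b \<le> T \<longrightarrow> norm (G b - G a) \<le> e * (L b - L a))" for a b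
    have "P 0 T"
      using T
    proof (induction rule: Bolzano)
      case (trans a b c)
      show ?case
        unfolding P_def
      proof
        assume "0 \<le> a \<and> c \<le> T"
        then have "norm (G b - G a) \<le> e * (L b - L a)" "norm (G c - G b) \<le> e * (L c - L b)"
          using trans by (auto simp: P_def)
        moreover have "norm (G c - G a) \<le> norm (G c - G b) + norm (G b - G a)"
          using norm_triangle_ineq[of "G c - G b" "G b - G a"] by simp
        ultimately show "norm (G c - G a) \<le> e * (L c - L a)" by (simp add: algebra_simps)
      qed
    next
      case (local x)
      \<comment> \<open>Both endpoints deviate from \<open>L x\<close> by less than
        \<open>e / (2 * C)\<close>, which turns one of the two factors \<open>L b - L a\<close>,
        multiplied by \<open>C\<close>, into at most \<open>e\<close>.\<close>
      then obtain d where d: "d > 0" "\<And>y. y \<in> {0..T} \<Longrightarrow> dist y x < d \<Longrightarrow> dist (L y) (L x) < e / (2 * C)"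
        using L e C unfolding continuous_on_iff by (metis atLeastAtMost_iff divide_pos_pos mult_pos_pos zero_less_numeral)
      have "norm (G b - G a) \<le> e * (L b - L a)" if "a \<le> x" "x \<le> b" "b - a < d" "0 \<le> a" "b \<le> T" for a b
      proof -
        have "\<bar>L a - L x\<bar> < e / (2 * C)" "\<bar>L b - L x\<bar> < e / (2 * C)"
          using d(2)[of a] d(2)[of b] that by (auto simp: dist_real_def)
        then have "L b - L a \<le> e / (2 * C) + e / (2 * C)" by linarith
        then have le: "C * (L b - L a) \<le> e" using C by (simp add: field_simps)
        have "norm (G b - G a) \<le> (C * (L b - L a)) * (L b - L a)"
          using G[of a b] that by (simp add: power2_eq_square mult.assoc)
        also have "\<dots> \<le> e * (L b - L a)"
          using le mono[of a b] that by (intro mult_right_mono) auto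
        finally show ?thesis .
      qed
      then show ?case using d(1) unfolding P_def by blast
    qed
    then show ?thesis using T by (simp add: P_def)
  qed
  have "norm (G T - G 0) \<le> 0"
  proof (rule field_le_epsilon)
    fix e :: real assume e: "e > 0"
    have LT: "0 \<le> L T - L 0" using mono[of 0 T] T by simp
    \<comment> \<open>The summand 1 avoids division by zero when \<open>L\<close> is
      constant.\<close>
    have "norm (G T - G 0) \<le> e / (L T - L 0 + 1) * (L T - L 0)" using e LT by (intro bd) simp
    also have "\<dots> \<le> e" using e LT by (simp add: divide_le_eq algebra_simps)
    finally show "norm (G T - G 0) \<le> 0 + e" by simp
  qed
  then show ?thesis by simp
qed

lemma set_integrable_mult_continuous:
  fixes f g :: "real \<Rightarrow> complex"
  assumes f: "set_integrable lborel {a..b} f" and g: "continuous_on {a..b} g"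
  shows "set_integrable lborel {a..b} (\<lambda>x. f x * g x)"
proof -
  obtain B where B: "\<And>x. x \<in> {a..b} \<Longrightarrow> norm (g x) \<le> B"
    using compact_imp_bounded[OF compact_continuous_image[OF g compact_Icc]] unfolding bounded_iff by blast
  show ?thesis
  proof (rule set_integrable_bound)
    show "set_integrable lborel {a..b} (\<lambda>x. B *\<^sub>R f x)" using f by simp
    have "(\<lambda>x. (indicator {a..b} x *\<^sub>R f x) * (indicator {a..b} x *\<^sub>R g x)) \<in> borel_measurable lborel"
      using f borel_measurable_continuous_on_indicator[OF _ g] unfolding set_integrable_def
      by (intro borel_measurable_times) auto
    then show "set_borel_measurable lborel {a..b} (\<lambda>x. f x * g x)"
      unfolding set_borel_measurable_def
      by (rule subst[where P = "\<lambda>h. h \<in> borel_measurable lborel", rotated]) (auto simp: indicator_def fun_eq_iff)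
    have "norm (f x * g x) \<le> norm (B *\<^sub>R f x)" if "x \<in> {a..b}" for x
      using mult_right_mono[OF order_trans[OF B[OF that] abs_ge_self], of "norm (f x)"]
      by (simp add: norm_mult mult.commute)
    then show "AE x in lborel. x \<in> {a..b} \<longrightarrow> norm (f x * g x) \<le> norm (B *\<^sub>R f x)" by simp
  qed
qed

text \<open>The integral form of the differential equation E' = k E. In general it can be
  differentiated only almost everywhere. Hence exp K minus the integral of k exp K is shown to have
  increments bounded by the square of those of \<open>L\<close>, the indefinite integral of the norm
  of \<open>k\<close>.\<close>

lemma
  fixes k :: "real \<Rightarrow> complex"
  assumes T: "0 \<le> T" and k: "set_integrable lborel {0..T} k"
  defines "E \<equiv> \<lambda>t. exp (LINT s:{0..<t}|lborel. k s)"
  shows set_integrable_times_exp_integral: "set_integrable lborel {0..T} (\<lambda>t. k t * E t)"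
    and set_integral_times_exp_integral: "(LINT t:{0..T}|lborel. k t * E t) = E T - 1"
proof -
  define K where "K t = integral {0..t} k" for t
  define L where "L t = integral {0..t} (\<lambda>s. norm (k s))" for t
  have sub: "set_integrable lborel {a..b} k" if "0 \<le> a" "b \<le> T" for a b
    using k by (rule set_integrable_subset) (use that in auto)
  have "(LINT s:{0..<t}|lborel. k s) = K t" if "t \<le> T" for t
  proof -
    \<comment> \<open>The half-open and the closed interval differ by a null set; from here on the
      gauge integral is used.\<close>
    have "(LINT s:{0..<t}|lborel. k s) = (LINT s:{0..t}|lborel. k s)"
      by (rule set_integral_discrete_difference[where X = "{t}"]) auto
    also have "\<dots> = K t"
      unfolding K_def using set_borel_integral_eq_integral(2)[OF sub[of 0 t]] that by simp
    finally show ?thesis .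
  qed
  then have E: "E t = exp (K t)" if "t \<le> T" for t using that by (simp add: E_def)
  have kint: "k integrable_on {a..b}" and nint: "(\<lambda>s. norm (k s)) integrable_on {a..b}" if "0 \<le> a" "b \<le> T" for a b
    using set_borel_integral_eq_integral(1)[OF sub[OF that]] set_borel_integral_eq_integral(1)[OF set_integrable_norm[OF sub[OF that]]]
    by auto
  have Kcont: "continuous_on {0..T} K" and Lcont: "continuous_on {0..T} L"
    unfolding K_def L_def by (intro indefinite_integral_continuous_1 kint nint; simp)+
  have K_diff: "K b - K a = integral {a..b} k" and L_diff: "L b - L a = integral {a..b} (\<lambda>s. norm (k s))"
    if "0 \<le> a" "a \<le> b" "b \<le> T" for a b
    using Henstock_Kurzweil_Integration.integral_combine[OF that(1,2) kint] Henstock_Kurzweil_Integration.integral_combine[OF that(1,2) nint] that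
    by (simp_all add: K_def L_def algebra_simps)
  have KL: "norm (K b - K a) \<le> L b - L a" if "0 \<le> a" "a \<le> b" "b \<le> T" for a b
    unfolding K_diff[OF that] L_diff[OF that]
    using that by (intro Henstock_Kurzweil_Integration.integral_norm_bound_integral kint nint) auto
  have mono: "L a \<le> L b" if "0 \<le> a" "a \<le> b" "b \<le> T" for a b
    using order_trans[OF norm_ge_zero KL[OF that]] by simp
  have K0: "K 0 = 0" and L0: "L 0 = 0" by (simp_all add: K_def L_def)
  define l where "l = L T"
  have l: "L b - L a \<le> l" if "0 \<le> a" "a \<le> b" "b \<le> T" for a b
    using mono[of 0 a] mono[of b T] that by (simp add: l_def L0)
  have Ecl: "norm (exp (K a)) \<le> exp l" if "0 \<le> a" "a \<le> T" for a
  proof -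
    have "norm (exp (K a)) \<le> exp (norm (K a))" by (rule norm_exp)
    also have "\<dots> \<le> exp l" using KL[of 0 a] l[of 0 a] that by (simp add: K0)
    finally show ?thesis .
  qed
  \<comment> \<open>Taylor estimates of order 0 and 1 around \<open>K a\<close>. One factor
    \<open>exp l\<close> bounds \<open>exp (K a)\<close>, the other the exponential in the
    remainder.\<close>
  have inc: "norm (exp (K b) - exp (K a)) \<le> exp (2 * l) * (L b - L a)"
    and inc2: "norm (exp (K b) - exp (K a) - exp (K a) * (K b - K a)) \<le> exp (2 * l) * (L b - L a)\<^sup>2"
    if ab: "0 \<le> a" "a \<le> b" "b \<le> T" for a b
  proof -
    define w where "w = K b - K a"
    have w: "norm w \<le> L b - L a" "exp (norm w) \<le> exp l"
      using KL[OF ab] l[OF ab] by (simp_all add: w_def)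
    have a: "norm (exp (K a)) \<le> exp l" using Ecl[of a] ab by simp
    have ll: "exp l * exp l = exp (2 * l)" by (simp flip: exp_add)
    have "norm (exp (K b) - exp (K a)) = norm (exp (K a)) * norm (exp w - 1)"
      unfolding norm_mult[symmetric] by (simp add: w_def right_diff_distrib flip: exp_add)
    also have "\<dots> \<le> exp l * (exp l * (L b - L a))"
    proof (intro mult_mono a)
      have "norm (exp w - 1) \<le> exp (norm w) * norm w" using Taylor_exp_field[of w 0] by simp
      also have "\<dots> \<le> exp l * (L b - L a)" using w by (intro mult_mono) auto
      finally show "norm (exp w - 1) \<le> exp l * (L b - L a)" .
    qed auto
    finally show "norm (exp (K b) - exp (K a)) \<le> exp (2 * l) * (L b - L a)"
      unfolding mult.assoc[symmetric] ll .
    have "norm (exp (K b) - exp (K a) - exp (K a) * (K b - K a)) = norm (exp (K a)) * norm (exp w - (1 + w))"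
      unfolding norm_mult[symmetric] by (simp add: w_def right_diff_distrib distrib_left algebra_simps flip: exp_add)
    also have "\<dots> \<le> exp l * (exp l * (L b - L a)\<^sup>2)"
    proof (intro mult_mono a)
      have "norm (exp w - (1 + w)) \<le> exp (norm w) * (norm w)\<^sup>2"
        using Taylor_exp_field[of w 1] by (simp add: power2_eq_square)
      also have "\<dots> \<le> exp l * (L b - L a)\<^sup>2" using w by (intro mult_mono power_mono) auto
      finally show "norm (exp w - (1 + w)) \<le> exp l * (L b - L a)\<^sup>2" .
    qed auto
    finally show "norm (exp (K b) - exp (K a) - exp (K a) * (K b - K a)) \<le> exp (2 * l) * (L b - L a)\<^sup>2"
      unfolding mult.assoc[symmetric] ll .
  qed
  have int: "set_integrable lborel {0..T} (\<lambda>t. k t * exp (K t))"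
    by (intro set_integrable_mult_continuous k continuous_intros Kcont)
  have kE: "(\<lambda>t. k t * exp (K t)) integrable_on {a..b}" if "0 \<le> a" "b \<le> T" for a b
    by (rule set_borel_integral_eq_integral(1)[OF set_integrable_subset[OF int]]) (use that in auto)
  define G where "G t = exp (K t) - integral {0..t} (\<lambda>t. k t * exp (K t))" for t
  have "G T = G 0"
  proof (rule constant_if_quadratic_increments[OF T Lcont mono])
    show "0 < 2 * exp (2 * l)" by simp
    fix a b assume ab: "0 \<le> a" "a \<le> b" "b \<le> T"
    \<comment> \<open>Freezing the exponential at \<open>a\<close> leaves an error whose integrand
      is \<open>k\<close> times a factor of order \<open>L b - L a\<close>; integrating the norm of
      \<open>k\<close> supplies the second such factor.\<close>
    have I: "integral {a..b} (\<lambda>t. k t * exp (K t)) - exp (K a) * (K b - K a) = integral {a..b} (\<lambda>t. k t * (exp (K t) - exp (K a)))"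
      unfolding right_diff_distrib K_diff[OF ab]
      by (subst Henstock_Kurzweil_Integration.integral_diff) (use kE[of a b] kint[of a b] ab in \<open>simp_all add: mult.commute\<close>)
    have "norm (integral {a..b} (\<lambda>t. k t * (exp (K t) - exp (K a)))) \<le> integral {a..b} (\<lambda>t. (exp (2 * l) * (L b - L a)) * norm (k t))"
    proof (rule Henstock_Kurzweil_Integration.integral_norm_bound_integral)
      show "(\<lambda>t. k t * (exp (K t) - exp (K a))) integrable_on {a..b}"
        unfolding right_diff_distrib using kE[of a b] kint[of a b] ab
        by (intro integrable_diff integrable_on_mult_left) auto
      show "(\<lambda>t. (exp (2 * l) * (L b - L a)) * norm (k t)) integrable_on {a..b}"
        using nint[of a b] ab by (intro integrable_on_mult_right) auto
      fix t assume t: "t \<in> {a..b}"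
      have "norm (exp (K t) - exp (K a)) \<le> exp (2 * l) * (L t - L a)" using inc[of a t] t ab by simp
      also have "\<dots> \<le> exp (2 * l) * (L b - L a)" using mono[of t b] t ab by simp
      finally show "norm (k t * (exp (K t) - exp (K a))) \<le> (exp (2 * l) * (L b - L a)) * norm (k t)"
        by (simp add: norm_mult mult.commute mult_left_mono)
    qed
    also have "\<dots> = exp (2 * l) * (L b - L a)\<^sup>2" by (simp add: L_diff[OF ab] power2_eq_square)
    finally have 1: "norm (integral {a..b} (\<lambda>t. k t * exp (K t)) - exp (K a) * (K b - K a)) \<le> exp (2 * l) * (L b - L a)\<^sup>2"
      unfolding I .
    have "G b - G a = (exp (K b) - exp (K a) - exp (K a) * (K b - K a)) - (integral {a..b} (\<lambda>t. k t * exp (K t)) - exp (K a) * (K b - K a))"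
      using Henstock_Kurzweil_Integration.integral_combine[OF ab(1,2) kE] ab by (simp add: G_def algebra_simps)
    then have "norm (G b - G a) \<le> norm (exp (K b) - exp (K a) - exp (K a) * (K b - K a)) + norm (integral {a..b} (\<lambda>t. k t * exp (K t)) - exp (K a) * (K b - K a))"
      using norm_triangle_ineq4 by metis
    also have "\<dots> \<le> 2 * exp (2 * l) * (L b - L a)\<^sup>2" using 1 inc2[OF ab] by simp
    finally show "norm (G b - G a) \<le> 2 * exp (2 * l) * (L b - L a)\<^sup>2" .
  qed
  then have "integral {0..T} (\<lambda>t. k t * exp (K t)) = exp (K T) - 1" by (simp add: G_def K0 algebra_simps)
  moreover show "set_integrable lborel {0..T} (\<lambda>t. k t * E t)"
    using int by (rule set_integrable_cong[THEN iffD1, rotated -1]) (auto simp: E)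
  moreover have "(LINT t:{0..T}|lborel. k t * E t) = (LINT t:{0..T}|lborel. k t * exp (K t))"
    by (rule set_lebesgue_integral_cong) (auto simp: E)
  ultimately show "(LINT t:{0..T}|lborel. k t * E t) = E T - 1"
    using set_borel_integral_eq_integral(2)[OF int] E[of T] by simp
qed

subsection \<open>Second quantized rotations\<close>

lemma L2_half_lineI:
  assumes "f \<in> borel_measurable half_line" and "g \<in> L2_half_line" and "h \<in> L2_half_line"
    and "\<And>r. (cmod (f r))\<^sup>2 \<le> 2 * (cmod (g r))\<^sup>2 + 2 * (cmod (h r))\<^sup>2"
  shows "f \<in> L2_half_line"
  unfolding L2_half_line_def mem_Collect_eq
proof
  have [measurable]: "f \<in> borel_measurable half_line" by fact
  show "integrable half_line (\<lambda>t. (cmod (f t))\<^sup>2)"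
  proof (rule Bochner_Integration.integrable_bound)
    show "integrable half_line (\<lambda>r. 2 * (cmod (g r))\<^sup>2 + 2 * (cmod (h r))\<^sup>2)"
      using assms by (simp add: L2_half_line_def)
  qed (use assms in \<open>auto intro!: AE_I2\<close>)
qed fact

lemma L2_half_line_measurable: "f \<in> L2_half_line \<Longrightarrow> f \<in> borel_measurable half_line"
  by (simp add: L2_half_line_def)

lemma L2_half_line_add: "f \<in> L2_half_line \<Longrightarrow> g \<in> L2_half_line \<Longrightarrow> (\<lambda>r. f r + g r) \<in> L2_half_line"
  by (rule L2_half_lineI[of _ f g]) (auto intro: L2_half_line_measurable norm_add_sq_le borel_measurable_add)

lemma L2_half_line_scale: "f \<in> L2_half_line \<Longrightarrow> (\<lambda>r. c * f r) \<in> L2_half_line"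
  by (auto simp: L2_half_line_def norm_mult power_mult_distrib)

lemma indicator_measurable_half_line: "A \<in> sets borel \<Longrightarrow> (indicator A :: real \<Rightarrow> 'b :: {real_normed_vector, zero_neq_one}) \<in> borel_measurable half_line"
  unfolding half_line_def by (intro measurable_restrict_space1 borel_measurable_indicator) simp

lemma L2_half_line_indicator:
  assumes f: "f \<in> L2_half_line" and A: "A \<in> sets borel"
  shows "(\<lambda>r. indicator A r * f r) \<in> L2_half_line"
proof (rule L2_half_lineI[OF _ f f])
  show "(\<lambda>r. indicator A r * f r) \<in> borel_measurable half_line"
    by (intro borel_measurable_times indicator_measurable_half_line L2_half_line_measurable f A)
qed (simp add: indicator_def)

lemma
  fixes h :: "real \<Rightarrow> 'b :: {banach, second_countable_topology}"
  shows integrable_half_line_indicator: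
      "integrable half_line (\<lambda>r. indicator {0..<t} r *\<^sub>R h r) \<longleftrightarrow> set_integrable lborel {0..<t} h"
    and integral_half_line_indicator:
      "(\<integral>r. indicator {0..<t} r *\<^sub>R h r \<partial>half_line) = (LINT r:{0..<t}|lborel. h r)"
proof -
  have *: "indicat_real {0..} r * indicat_real {0..<t} r = indicat_real {0..<t} r" for r :: real
    by (simp add: indicator_def)
  show "integrable half_line (\<lambda>r. indicator {0..<t} r *\<^sub>R h r) \<longleftrightarrow> set_integrable lborel {0..<t} h"
    unfolding half_line_def set_integrable_def by (subst integrable_restrict_space) (simp_all add: *)
  show "(\<integral>r. indicator {0..<t} r *\<^sub>R h r \<partial>half_line) = (LINT r:{0..<t}|lborel. h r)"
    unfolding half_line_def set_lebesgue_integral_def by (subst integral_restrict_space) (simp_all add: *)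
qed

lemma L2_half_line_interval: "(\<lambda>r. indicator {0..<t} r * c) \<in> L2_half_line"
  unfolding L2_half_line_def mem_Collect_eq
proof
  show "(\<lambda>r. indicator {0..<t} r * c) \<in> borel_measurable half_line"
    by (intro borel_measurable_times indicator_measurable_half_line) auto
  have "set_integrable lborel {0..<t} (\<lambda>r. (cmod c)\<^sup>2)"
    unfolding set_integrable_def by (cases "0 \<le> t") auto
  then show "integrable half_line (\<lambda>r. (cmod (indicator {0..<t} r * c))\<^sup>2)"
    unfolding integrable_half_line_indicator[symmetric]
    by (rule Bochner_Integration.integrable_cong[THEN iffD1, rotated -1]) (auto simp: indicator_def)
qed

lemma L2_half_line_cnj_mult_integrable:
  assumes f: "f \<in> L2_half_line" and g: "g \<in> L2_half_line"
  shows "integrable half_line (\<lambda>r. cnj (f r) * g r)"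
proof (rule Bochner_Integration.integrable_bound)
  have [measurable]: "f \<in> borel_measurable half_line" "g \<in> borel_measurable half_line"
    using f g by (simp_all add: L2_half_line_def)
  show "(\<lambda>r. cnj (f r) * g r) \<in> borel_measurable half_line" by measurable
  show "integrable half_line (\<lambda>r. (cmod (f r))\<^sup>2 + (cmod (g r))\<^sup>2)"
    using f g by (simp add: L2_half_line_def)
  have "cmod (f r) * cmod (g r) \<le> (cmod (f r))\<^sup>2 + (cmod (g r))\<^sup>2" for r
    using sum_squares_bound[of "cmod (f r)" "cmod (g r)"]
      mult_nonneg_nonneg[OF norm_ge_zero norm_ge_zero, of "f r" "g r"] by linarith
  then show "AE r in half_line. norm (cnj (f r) * g r) \<le> norm ((cmod (f r))\<^sup>2 + (cmod (g r))\<^sup>2)"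
    by (simp add: norm_mult)
qed

lemma L2_half_line_shift:
  assumes f: "f \<in> L2_half_line" shows "(\<lambda>r. indicator {0..<t} r * (f r - c)) \<in> L2_half_line"
  using L2_half_line_add[OF L2_half_line_indicator[OF f, of "{0..<t}"] L2_half_line_interval[of t "- c"]]
  by (simp add: algebra_simps)

lemma set_integrable_cnj_mult_shift:
  assumes f: "f \<in> L2_half_line" and g: "g \<in> L2_half_line"
  shows "set_integrable lborel {0..<t} (\<lambda>r. cnj (f r - c) * (g r - c))"
  unfolding integrable_half_line_indicator[symmetric]
  by (rule Bochner_Integration.integrable_cong[THEN iffD1, OF _ _ L2_half_line_cnj_mult_integrable[OF L2_half_line_shift[OF f, of t c] L2_half_line_shift[OF g, of t c]]])
     (auto simp: indicator_def)

lemma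
  assumes f: "f \<in> L2_half_line"
  shows set_integrable_shift: "set_integrable lborel {0..<t} (\<lambda>r. f r - c)"
    and set_integrable_cnj_shift: "set_integrable lborel {0..<t} (\<lambda>r. cnj (f r - c))"
proof -
  \<comment> \<open>Pairing with the indicator function of \<open>[0, t)\<close>, itself
    square-integrable, turns square-integrability into integrability on that interval.\<close>
  note L2 = L2_half_line_interval[of t 1] L2_half_line_shift[OF f, of t c]
  show "set_integrable lborel {0..<t} (\<lambda>r. f r - c)"
    unfolding integrable_half_line_indicator[symmetric]
    by (rule Bochner_Integration.integrable_cong[THEN iffD1, OF _ _ L2_half_line_cnj_mult_integrable[OF L2]])
       (auto simp: indicator_def)
  show "set_integrable lborel {0..<t} (\<lambda>r. cnj (f r - c))"
    unfolding integrable_half_line_indicator[symmetric]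
    by (rule Bochner_Integration.integrable_cong[THEN iffD1, OF _ _ L2_half_line_cnj_mult_integrable[OF L2(2,1)]])
       (auto simp: indicator_def)
qed

text \<open>Multiplication by \<open>z\<close> on \<open>[0, t)\<close>, conjugated with the translation by \<open>c\<close> there. On
  exponential vectors, the conjugate of its second quantization by the corresponding Weyl operator
  acts by \<open>rotation_vec\<close>.\<close>

definition rotation_fun :: "complex \<Rightarrow> real \<Rightarrow> complex \<Rightarrow> (real \<Rightarrow> complex) \<Rightarrow> (real \<Rightarrow> complex)" where
  "rotation_fun c t z g r = g r + indicator {0..<t} r * ((z - 1) * (g r - c))"

definition rotation_vec :: "complex \<Rightarrow> real \<Rightarrow> complex \<Rightarrow> (real \<Rightarrow> complex) \<Rightarrow> fock" where
  "rotation_vec c t z g =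
    exp (- ((z - 1) * cnj c * (LINT r:{0..<t}|lborel. g r - c))) *\<^sub>C exp_vec (rotation_fun c t z g)"

lemma rotation_fun_L2: "g \<in> L2_half_line \<Longrightarrow> rotation_fun c t z g \<in> L2_half_line"
  using L2_half_line_add[OF _ L2_half_line_scale[OF L2_half_line_shift], of g g "z - 1" t c]
  by (simp add: rotation_fun_def[abs_def] mult_ac)

lemma rotation_fun_inverse: "z \<noteq> 0 \<Longrightarrow> rotation_fun c t z (rotation_fun c t (inverse z) g) = g"
  by (rule ext) (simp add: rotation_fun_def indicator_def field_simps)

text \<open>On \<open>[0, t)\<close> the rotated functions are c + z (f - c) and c + w (g - c).
  Their product exceeds \<open>cnj f * g\<close> by the function \<open>h\<close> of the proof: one
  term in \<open>cnj z * w - 1\<close> and two terms linear in f - c or g - c. The scalars in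
  \<open>rotation_vec\<close> are chosen to cancel the linear ones.\<close>

lemma cinner_rotation_vec:
  assumes f: "f \<in> L2_half_line" and g: "g \<in> L2_half_line"
  shows "cinner (rotation_vec c t z f) (rotation_vec c t w g) =
    exp ((\<integral>r. cnj (f r) * g r \<partial>half_line) + (cnj z * w - 1) * (LINT r:{0..<t}|lborel. cnj (f r - c) * (g r - c)))"
proof -
  define S where "S h = (LINT r:{0..<t}|lborel. h r)" for h :: "real \<Rightarrow> complex"
  define h where "h r = (cnj z * w - 1) * (cnj (f r - c) * (g r - c)) + (cnj z - 1) * c * cnj (f r - c) + (w - 1) * cnj c * (g r - c)" for r
  note int = set_integrable_cnj_mult_shift[OF f g, of t c] set_integrable_shift[OF g, of t c] set_integrable_cnj_shift[OF f, of t c]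
  have pt: "cnj (rotation_fun c t z f r) * rotation_fun c t w g r = cnj (f r) * g r + indicator {0..<t} r *\<^sub>R h r" for r
    by (cases "r \<in> {0..<t}") (simp_all add: rotation_fun_def h_def algebra_simps)
  have hint: "set_integrable lborel {0..<t} h"
    unfolding h_def[abs_def] by (intro set_integral_add set_integrable_mult_right int)
  have "S h = (cnj z * w - 1) * S (\<lambda>r. cnj (f r - c) * (g r - c)) + (cnj z - 1) * c * S (\<lambda>r. cnj (f r - c)) + (w - 1) * cnj c * S (\<lambda>r. g r - c)"
    unfolding S_def h_def[abs_def]
    by (simp only: set_integral_add set_integrable_mult_right int set_integral_mult_right)
  moreover have "S (\<lambda>r. cnj (f r - c)) = cnj (S (\<lambda>r. f r - c))"
    unfolding S_def set_lebesgue_integral_def by (subst Bochner_integral_cnj[symmetric]) simp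
  ultimately have Sh: "S h = (cnj z * w - 1) * S (\<lambda>r. cnj (f r - c) * (g r - c)) + (cnj z - 1) * c * cnj (S (\<lambda>r. f r - c)) + (w - 1) * cnj c * S (\<lambda>r. g r - c)"
    by simp
  have "cinner (exp_vec (rotation_fun c t z f)) (exp_vec (rotation_fun c t w g)) = exp ((\<integral>r. cnj (f r) * g r \<partial>half_line) + S h)"
    unfolding cinner_exp_vec[OF rotation_fun_L2[OF f] rotation_fun_L2[OF g]] pt S_def
    using L2_half_line_cnj_mult_integrable[OF f g] hint
    by (simp add: Bochner_Integration.integral_add integrable_half_line_indicator integral_half_line_indicator)
  then show ?thesis
    unfolding rotation_vec_def cinner_scaleC_left cinner_scaleC_right S_def[symmetric] exp_cnj Sh
    by (simp add: exp_add[symmetric] algebra_simps)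
qed

lemma rotation_unitary:
  assumes z: "cmod z = 1"
  shows "\<exists>W. unitary_op W \<and> (\<forall>g\<in>L2_half_line. W (exp_vec g) = rotation_vec c t z g)"
proof (rule unitary_extension)
  have zz: "cnj z * z = 1" using z by (metis complex_norm_square mult.commute of_real_1 power_one)
  show "cinner (rotation_vec c t z f) (rotation_vec c t z g) = cinner (exp_vec f) (exp_vec g)"
    if "f \<in> L2_half_line" "g \<in> L2_half_line" for f g
    using that by (simp add: cinner_rotation_vec cinner_exp_vec zz)
  show "\<exists>h\<in>L2_half_line. \<exists>d. rotation_vec c t z g = d *\<^sub>C exp_vec h" if "g \<in> L2_half_line" for g
    using rotation_fun_L2[OF that] unfolding rotation_vec_def by blast
  show "\<exists>h\<in>L2_half_line. \<exists>d. exp_vec g = d *\<^sub>C rotation_vec c t z h" if "g \<in> L2_half_line" for g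
  proof (intro bexI exI)
    \<comment> \<open>Rotating back by the inverse of \<open>z\<close> and undoing the scalar writes
      every exponential vector as a multiple of a rotated one, as the extension lemma
      demands.\<close>
    let ?h = "rotation_fun c t (inverse z) g"
    let ?d = "exp ((z - 1) * cnj c * (LINT r:{0..<t}|lborel. ?h r - c))"
    show "?h \<in> L2_half_line" using that by (rule rotation_fun_L2)
    show "exp_vec g = ?d *\<^sub>C rotation_vec c t z ?h"
      using z by (simp add: rotation_vec_def rotation_fun_inverse[OF cmod_1_nonzero] scaleC_scaleC flip: exp_add)
  qed
qed

section \<open>Splitting at time t\<close>

lemma restrict_before_L2: "f \<in> L2_half_line \<Longrightarrow> restrict_before t f \<in> L2_half_line"
  unfolding restrict_before_def[abs_def] by (intro L2_half_line_indicator) auto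

lemma restrict_from_L2: "f \<in> L2_half_line \<Longrightarrow> restrict_from t f \<in> L2_half_line"
  unfolding restrict_from_def[abs_def] by (intro L2_half_line_indicator) auto

lemma integral_half_line_split:
  assumes f: "f \<in> L2_half_line" and g: "g \<in> L2_half_line"
  shows "(\<integral>r. cnj (f r) * g r \<partial>half_line) =
    (\<integral>r. cnj (restrict_before t f r) * restrict_before t g r \<partial>half_line) +
    (\<integral>r. cnj (restrict_from t f r) * restrict_from t g r \<partial>half_line)"
proof (subst Bochner_Integration.integral_add[symmetric])
  show "(\<integral>r. cnj (f r) * g r \<partial>half_line) =
    (\<integral>r. cnj (restrict_before t f r) * restrict_before t g r + cnj (restrict_from t f r) * restrict_from t g r \<partial>half_line)"
    by (rule Bochner_Integration.integral_cong)
       (auto simp: restrict_before_def restrict_from_def half_line_def indicator_def)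
qed (intro L2_half_line_cnj_mult_integrable restrict_before_L2 restrict_from_L2 f g)+

subsection \<open>The flow on the torus\<close>

definition rotation_op :: "complex \<Rightarrow> real \<Rightarrow> complex \<Rightarrow> (fock \<Rightarrow>\<^sub>L fock)" where
  "rotation_op c t z = (SOME W. unitary_op W \<and> (\<forall>g\<in>L2_half_line. W (exp_vec g) = rotation_vec c t z g))"

lemma
  assumes "cmod z = 1"
  shows unitary_rotation_op: "unitary_op (rotation_op c t z)"
    and rotation_op_exp_vec: "g \<in> L2_half_line \<Longrightarrow> rotation_op c t z (exp_vec g) = rotation_vec c t z g"
  using someI_ex[OF rotation_unitary[OF assms, of c t]] by (auto simp: rotation_op_def)

definition torus_phase :: "complex \<Rightarrow> complex \<Rightarrow> int \<times> int \<Rightarrow> complex" where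
  "torus_phase mu nu = (\<lambda>(m, n). mu powi m * nu powi n)"

definition flow_unitary :: "complex \<Rightarrow> complex \<Rightarrow> real \<Rightarrow> ((int \<times> int, fock) ell2 \<Rightarrow>\<^sub>L (int \<times> int, fock) ell2)" where
  "flow_unitary mu nu t = diag_op (\<lambda>p. rotation_op (1 / (1 - mu)) t (torus_phase mu nu p))"

definition torus_flow ::
  "complex \<Rightarrow> complex \<Rightarrow> real \<Rightarrow> (l2_Z2 \<Rightarrow>\<^sub>L l2_Z2) \<Rightarrow> ((int \<times> int, fock) ell2 \<Rightarrow>\<^sub>L (int \<times> int, fock) ell2)" where
  "torus_flow mu nu t x = op_adjoint (flow_unitary mu nu t) o\<^sub>L ampl x o\<^sub>L flow_unitary mu nu t"

lemma cmod_torus_phase: "cmod mu = 1 \<Longrightarrow> cmod nu = 1 \<Longrightarrow> cmod (torus_phase mu nu p) = 1"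
  by (simp add: torus_phase_def case_prod_unfold norm_mult norm_power_int)

text \<open>The phase is a character of the lattice, so the ratio between two sites depends only on
  their displacement.\<close>

lemma torus_phase_add:
  assumes mu: "cmod mu = 1" and nu: "cmod nu = 1"
  shows "cnj (torus_phase mu nu (m, n)) * torus_phase mu nu (m + a, n + b) = torus_phase mu nu (a, b)"
proof -
  have 1: "z powi (k + l) = z powi k * z powi l" "cnj (z powi k) * z powi k = 1" if "cmod z = 1" for z :: complex and k l
    using power_int_add[OF disjI1[OF cmod_1_nonzero[OF that]], of k l]
      complex_norm_square[of "z powi k"] that by (simp_all add: norm_power_int mult.commute)
  have "cnj (torus_phase mu nu (m, n)) * torus_phase mu nu (m + a, n + b) =
    (cnj (mu powi m) * mu powi m) * (cnj (nu powi n) * nu powi n) * (mu powi a * nu powi b)"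
    unfolding torus_phase_def prod.case 1(1)[OF mu] 1(1)[OF nu] complex_cnj_mult by (simp only: mult_ac)
  then show ?thesis unfolding 1(2)[OF mu] 1(2)[OF nu] by (simp add: torus_phase_def)
qed

lemma torus_monom_bounded_ops: "cmod lam = 1 \<Longrightarrow> torus_monom lam a b \<in> bounded_ops"
  using bounded_ops_if_adjoint torus_monom_adjoint by blast

context
  fixes mu nu :: complex
  assumes mu: "cmod mu = 1" and nu: "cmod nu = 1"
begin

lemma unitary_flow_unitary: "unitary_op (flow_unitary mu nu t)"
  unfolding flow_unitary_def by (intro unitary_diag_op unitary_rotation_op cmod_torus_phase mu nu)

lemma flow_unitary_nth:
  "g \<in> L2_half_line \<Longrightarrow> flow_unitary mu nu t (v \<otimes>\<^sub>h exp_vec g) $$ p =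
    v $$ p *\<^sub>C rotation_vec (1 / (1 - mu)) t (torus_phase mu nu p) g"
  unfolding flow_unitary_def
  by (subst diag_op_nth)
     (simp_all add: unitary_rotation_op cmod_torus_phase mu nu tensor.rep_eq unitary_op_scaleC rotation_op_exp_vec)

lemma cinner_torus_flow: "cinner x (torus_flow mu nu t T y) = cinner (flow_unitary mu nu t x) (ampl T (flow_unitary mu nu t y))"
  using unitary_op_adjoint(3)[OF unitary_flow_unitary, of t "ampl T (flow_unitary mu nu t y)" x]
    cinner_commute[of x] cinner_commute[of "flow_unitary mu nu t x"]
  by (simp add: torus_flow_def)

text \<open>At each site the monomial pairs rotations whose phases differ by the displacement
  \<open>(a, b)\<close>. By \<open>cinner_rotation_vec\<close> and \<open>torus_phase_add\<close>
  the resulting exponential is the same at all sites and factors out of the sum.\<close>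

lemma cinner_torus_flow_monom:
  assumes lam: "cmod lam = 1" and f: "f \<in> L2_half_line" and g: "g \<in> L2_half_line"
  shows "cinner (u \<otimes>\<^sub>h exp_vec f) (torus_flow mu nu t (torus_monom lam a b) (v \<otimes>\<^sub>h exp_vec g)) =
    cinner u (torus_monom lam a b v) * exp ((\<integral>r. cnj (f r) * g r \<partial>half_line) +
      (torus_phase mu nu (a, b) - 1) * (LINT r:{0..<t}|lborel. cnj (f r - 1 / (1 - mu)) * (g r - 1 / (1 - mu))))"
    (is "_ = _ * ?K")
proof -
  have "cinner (flow_unitary mu nu t (u \<otimes>\<^sub>h exp_vec f) $$ p) (ampl (torus_monom lam a b) (flow_unitary mu nu t (v \<otimes>\<^sub>h exp_vec g)) $$ p) =
    cinner (u $$ p) (torus_monom lam a b v $$ p) * ?K" for p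
  proof -
    obtain m n where p: "p = (m, n)" by force
    have "ampl (torus_monom lam a b) x $$ (m, n) = (lam powi ((m + a) * b)) *\<^sub>C (x $$ (m + a, n + b))"
      for x :: "(int \<times> int, fock) ell2"
      by (rule ampl_weighted_shift[OF torus_monom_bounded_ops[OF lam] torus_monom_apply[OF lam]])
    then show ?thesis
      by (simp add: p flow_unitary_nth f g torus_monom_apply[OF lam] cinner_scaleC_left cinner_scaleC_right
          cinner_rotation_vec torus_phase_add[OF mu nu] cinner_complex_def)
  qed
  then show ?thesis
    unfolding cinner_torus_flow by (simp add: cinner_ell2_def infsum_cmult_left')
qed

lemma torus_flow_add:
  "S \<in> bounded_ops \<Longrightarrow> T \<in> bounded_ops \<Longrightarrow>
    cinner x (torus_flow mu nu t (S + T) y) = cinner x (torus_flow mu nu t S y) + cinner x (torus_flow mu nu t T y)"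
  by (simp add: cinner_torus_flow ampl_add blinfun.add_left cinner_add_right)

lemma torus_flow_scaleC:
  "T \<in> bounded_ops \<Longrightarrow> cinner x (torus_flow mu nu t (c *\<^sub>C T) y) = c * cinner x (torus_flow mu nu t T y)"
  by (simp add: cinner_torus_flow ampl_scaleC cinner_scaleC_right)

text \<open>Membership in \<open>bounded_ops\<close> is part of the claim because additivity asks
  for it at each insertion.\<close>

lemma torus_flow_sum:
  assumes "\<And>p. p \<in> F \<Longrightarrow> T p \<in> bounded_ops"
  shows "cinner x (torus_flow mu nu t (\<Sum>p\<in>F. T p) y) = (\<Sum>p\<in>F. cinner x (torus_flow mu nu t (T p) y)) \<and> (\<Sum>p\<in>F. T p) \<in> bounded_ops"
  using assms
proof (induction F rule: infinite_finite_induct)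
  case (insert p F)
  then show ?case by (auto simp: torus_flow_add bounded_ops_add)
qed (use torus_flow_scaleC[of 0 x t 0 y] in \<open>simp_all add: bounded_ops_def blinfun_scaleC_zero_right\<close>)

text \<open>The index set comes from \<open>d\<close>, the coefficients from \<open>c\<close>: the
  generator may annihilate a coefficient, while the sum is still taken over the support of the
  original element.\<close>

lemma cinner_torus_flow_lincomb:
  assumes lam: "cmod lam = 1" and f: "f \<in> L2_half_line" and g: "g \<in> L2_half_line"
  shows "cinner (u \<otimes>\<^sub>h exp_vec f) (torus_flow mu nu t (\<Sum>(m, n) | d (m, n) \<noteq> 0. c (m, n) *\<^sub>C torus_monom lam m n) (v \<otimes>\<^sub>h exp_vec g)) =
    (\<Sum>p | d p \<noteq> 0. c p * (cinner u (torus_monom lam (fst p) (snd p) v) * exp ((\<integral>r. cnj (f r) * g r \<partial>half_line) +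
      (torus_phase mu nu p - 1) * (LINT r:{0..<t}|lborel. cnj (f r - 1 / (1 - mu)) * (g r - 1 / (1 - mu))))))"
proof -
  have "(\<Sum>(m, n) | d (m, n) \<noteq> 0. c (m, n) *\<^sub>C torus_monom lam m n) = (\<Sum>p | d p \<noteq> 0. c p *\<^sub>C torus_monom lam (fst p) (snd p))"
    by (simp add: case_prod_unfold)
  then show ?thesis
    by (simp add: torus_flow_sum bounded_ops_scaleC torus_monom_bounded_ops lam torus_flow_scaleC cinner_torus_flow_monom f g)
qed

text \<open>Ampliation does not increase norms, so the flow is norm continuous on the algebra.
  Adaptedness passes to the closure this way.\<close>

lemma torus_flow_tendsto:
  assumes T: "\<And>n. T n \<in> bounded_ops" and S: "S \<in> bounded_ops" and lim: "T \<longlonglongrightarrow> S"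
  shows "(\<lambda>n. cinner x (torus_flow mu nu t (T n) y)) \<longlonglongrightarrow> cinner x (torus_flow mu nu t S y)"
proof -
  have le: "norm (ampl (T n) - ampl S :: (int \<times> int, fock) ell2 \<Rightarrow>\<^sub>L _) \<le> norm (T n - S)" for n
    unfolding ampl_diff[OF T S, symmetric] by (intro norm_ampl_le bounded_ops_diff T S)
  have "(\<lambda>n. ampl (T n) - ampl S :: (int \<times> int, fock) ell2 \<Rightarrow>\<^sub>L _) \<longlonglongrightarrow> 0"
    by (rule Lim_null_comparison[OF _ tendsto_norm_zero[OF LIM_zero[OF lim]]]) (simp add: le)
  then have "(\<lambda>n. ampl (T n) :: (int \<times> int, fock) ell2 \<Rightarrow>\<^sub>L _) \<longlonglongrightarrow> ampl S" by (rule LIM_zero_cancel)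
  then show ?thesis
    unfolding cinner_torus_flow
    by (intro bounded_bilinear.tendsto[OF bounded_bilinear_cinner] tendsto_const blinfun.tendsto)
qed

text \<open>The integral over \<open>[0, t)\<close> sees only the restricted functions, while the
  integral of \<open>cnj f * g\<close> splits at \<open>t\<close>. The exponential turns this sum
  into the product.\<close>

lemma torus_flow_adapted_alg0:
  assumes lam: "cmod lam = 1" and a: "a \<in> torus_alg0 lam" and f: "f \<in> L2_half_line" and g: "g \<in> L2_half_line"
  shows "cinner (u \<otimes>\<^sub>h exp_vec f) (torus_flow mu nu t a (v \<otimes>\<^sub>h exp_vec g)) =
     cinner (u \<otimes>\<^sub>h exp_vec (restrict_before t f)) (torus_flow mu nu t a (v \<otimes>\<^sub>h exp_vec (restrict_before t g))) *
     cinner (exp_vec (restrict_from t f)) (exp_vec (restrict_from t g))"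
proof -
  obtain c where a: "a = (\<Sum>(m, n) | c (m, n) \<noteq> 0. c (m, n) *\<^sub>C torus_monom lam m n)"
    using torus_alg0_lincomb[OF lam a] by blast
  have kap: "(LINT r:{0..<t}|lborel. cnj (restrict_before t f r - k) * (restrict_before t g r - k)) =
      (LINT r:{0..<t}|lborel. cnj (f r - k) * (g r - k))" for k
    by (rule set_lebesgue_integral_cong) (auto simp: restrict_before_def)
  show ?thesis
    unfolding a cinner_torus_flow_lincomb[OF lam f g]
      cinner_torus_flow_lincomb[OF lam restrict_before_L2[OF f] restrict_before_L2[OF g]]
      cinner_exp_vec[OF restrict_from_L2[OF f] restrict_from_L2[OF g]] kap
      integral_half_line_split[OF f g, of t] sum_distrib_right exp_add
    by (simp only: mult_ac)
qed

lemma torus_flow_adapted: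
  assumes lam: "cmod lam = 1" shows "adapted (nc_torus lam) (torus_flow mu nu)"
  unfolding adapted_def
proof (intro allI impI ballI)
  fix t a u v f g
  assume a: "a \<in> nc_torus lam" and f: "f \<in> L2_half_line" and g: "g \<in> L2_half_line"
  obtain T where T: "\<And>n. T n \<in> torus_alg0 lam" "T \<longlonglongrightarrow> a"
    using a unfolding nc_torus_def closure_sequential by blast
  have "T n \<in> bounded_ops" for n
    using closure_subset[THEN subsetD, OF T(1)[of n]] unfolding nc_torus_def[symmetric] by (rule nc_torus_bounded_ops[OF lam])
  note lim = torus_flow_tendsto[OF this nc_torus_bounded_ops[OF lam a] T(2)]
  let ?w = "cinner (exp_vec (restrict_from t f)) (exp_vec (restrict_from t g))"
  have "(\<lambda>n. cinner (u \<otimes>\<^sub>h exp_vec f) (torus_flow mu nu t (T n) (v \<otimes>\<^sub>h exp_vec g))) \<longlonglongrightarrow>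
      cinner (u \<otimes>\<^sub>h exp_vec (restrict_before t f)) (torus_flow mu nu t a (v \<otimes>\<^sub>h exp_vec (restrict_before t g))) * ?w"
    unfolding torus_flow_adapted_alg0[OF lam T(1) f g, of u t] by (rule tendsto_mult_right[OF lim])
  then show "cinner (u \<otimes>\<^sub>h exp_vec f) (torus_flow mu nu t a (v \<otimes>\<^sub>h exp_vec g)) =
     cinner (u \<otimes>\<^sub>h exp_vec (restrict_before t f)) (torus_flow mu nu t a (v \<otimes>\<^sub>h exp_vec (restrict_before t g))) * ?w"
    by (rule LIMSEQ_unique[OF lim])
qed

text \<open>By linearity this reduces to the scalar equation for each monomial: the compressed
  generator multiplies it by \<open>z p * k s\<close>, which is the logarithmic derivative of its
  factor \<open>E p\<close>.\<close>

lemma torus_flow_integral: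
  fixes u v :: l2_Z2
  assumes lam: "cmod lam = 1" and mu1: "mu \<noteq> 1" and x: "x \<in> torus_alg0 lam"
    and f: "f \<in> L2_half_line" and g: "g \<in> L2_half_line" and t: "t \<ge> 0"
  defines "h \<equiv> \<lambda>s. cinner (u \<otimes>\<^sub>h exp_vec f)
    (torus_flow mu nu s (compress (hat_vec f s) (torus_phi lam mu nu x) (hat_vec g s)) (v \<otimes>\<^sub>h exp_vec g))"
  shows "set_integrable lborel {0..t} h"
    and "cinner (u \<otimes>\<^sub>h exp_vec f) (torus_flow mu nu t x (v \<otimes>\<^sub>h exp_vec g)) =
      cinner (u \<otimes>\<^sub>h exp_vec f) (x v \<otimes>\<^sub>h exp_vec g) + (LINT s:{0..t}|lborel. h s)"
proof -
  obtain c where c: "finite {p. c p \<noteq> 0}" and x: "x = (\<Sum>(m, n) | c (m, n) \<noteq> 0. c (m, n) *\<^sub>C torus_monom lam m n)"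
    using torus_alg0_lincomb[OF lam x] by blast
  define k where "k s = cnj (f s - 1 / (1 - mu)) * (g s - 1 / (1 - mu))" for s
  define z where "z p = torus_phase mu nu p - 1" for p
  define I where "I = (\<integral>r. cnj (f r) * g r \<partial>half_line)"
  define q where "q p = c p * cinner u (torus_monom lam (fst p) (snd p) v) * exp I" for p
  define E where "E p s = exp (LINT r:{0..<s}|lborel. z p * k r)" for p s
  have k: "set_integrable lborel {0..t} k"
  proof -
    \<comment> \<open>The available fact concerns half-open intervals; the larger one contains the
      closed interval ending at \<open>t\<close>.\<close>
    have "set_integrable lborel {0..<t + 1} k"
      unfolding k_def[abs_def] by (rule set_integrable_cnj_mult_shift[OF f g])
    then show ?thesis by (rule set_integrable_subset) auto
  qed
  have E: "exp (I + z p * (LINT r:{0..<s}|lborel. k r)) = exp I * E p s" for p s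
    by (simp add: E_def exp_add)
  have h: "h s = (\<Sum>p | c p \<noteq> 0. q p * (z p * k s * E p s))" for s
  proof -
    define c' where "c' p = c p * (z p * k s)" for p
    have c': "(\<Sum>(m, n) | c (m, n) \<noteq> 0. (c (m, n) * ((mu powi m * nu powi n - 1) *
        (cnj (f s - 1 / (1 - mu)) * (g s - 1 / (1 - mu))))) *\<^sub>C torus_monom lam m n) =
      (\<Sum>(m, n) | c (m, n) \<noteq> 0. c' (m, n) *\<^sub>C torus_monom lam m n)"
      by (simp add: c'_def z_def k_def torus_phase_def)
    show ?thesis
      unfolding h_def x compress_torus_phi[OF lam mu mu1 c] c' cinner_torus_flow_lincomb[OF lam f g]
      unfolding z_def[symmetric] k_def[symmetric] I_def[symmetric] E
      by (simp only: c'_def q_def mult_ac)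
  qed
  have int: "set_integrable lborel {0..t} (\<lambda>s. z p * k s * E p s)"
    and val: "(LINT s:{0..t}|lborel. z p * k s * E p s) = E p t - 1" for p
    unfolding E_def
    by (intro set_integrable_times_exp_integral set_integral_times_exp_integral t set_integrable_mult_right k)+
  have "set_integrable lborel {0..t} (\<lambda>s. \<Sum>p\<in>F. q p * (z p * k s * E p s)) \<and>
    (LINT s:{0..t}|lborel. \<Sum>p\<in>F. q p * (z p * k s * E p s)) = (\<Sum>p\<in>F. q p * (E p t - 1))" if "finite F" for F
    using that
  proof induction
    case empty
    then show ?case by (simp add: set_integrable_def)
  next
    case (insert p F)
    have "set_integrable lborel {0..t} (\<lambda>s. q p * (z p * k s * E p s))" by (intro set_integrable_mult_right int)
    then show ?case using insert set_integral_add by (simp add: val)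
  qed
  from this[OF c] have hint: "set_integrable lborel {0..t} h" "(LINT s:{0..t}|lborel. h s) = (\<Sum>p | c p \<noteq> 0. q p * (E p t - 1))"
    by (simp_all add: h[abs_def])
  \<comment> \<open>Recorded separately because the Lebesgue integral of a non-integrable function
    is 0 by convention.\<close>
  show "set_integrable lborel {0..t} h" by (rule hint)
  have "cinner (u \<otimes>\<^sub>h exp_vec f) (torus_flow mu nu t x (v \<otimes>\<^sub>h exp_vec g)) = (\<Sum>p | c p \<noteq> 0. q p * E p t)"
    unfolding x cinner_torus_flow_lincomb[OF lam f g] z_def[symmetric] k_def[symmetric] I_def[symmetric] E
    by (simp only: q_def mult_ac)
  moreover have "cinner (u \<otimes>\<^sub>h exp_vec f) (x v \<otimes>\<^sub>h exp_vec g) = (\<Sum>p | c p \<noteq> 0. q p)"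
    unfolding cinner_tensor cinner_exp_vec[OF f g] I_def[symmetric] x
    by (simp add: case_prod_unfold blinfun.sum_left cinner_sum_right cinner_scaleC_right q_def sum_distrib_right)
  ultimately show "cinner (u \<otimes>\<^sub>h exp_vec f) (torus_flow mu nu t x (v \<otimes>\<^sub>h exp_vec g)) =
      cinner (u \<otimes>\<^sub>h exp_vec f) (x v \<otimes>\<^sub>h exp_vec g) + (LINT s:{0..t}|lborel. h s)"
    unfolding hint(2) by (simp add: right_diff_distrib sum_subtractf)
qed

end

theorem theorem6p13:
  fixes lam mu nu :: complex
  assumes "cmod lam = 1" and "cmod mu = 1" and "cmod nu = 1" and "mu \<noteq> 1"
  shows "\<exists>j :: real \<Rightarrow> (l2_Z2 \<Rightarrow>\<^sub>L l2_Z2) \<Rightarrow> ((int \<times> int, fock) ell2 \<Rightarrow>\<^sub>L (int \<times> int, fock) ell2).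
    (\<forall>t\<ge>0. unital_star_hom (nc_torus lam) (j t)) \<and>
    adapted (nc_torus lam) j \<and>
    (\<forall>u v. \<forall>f\<in>L2_half_line. \<forall>g\<in>L2_half_line. \<forall>x\<in>torus_alg0 lam. \<forall>t\<ge>0.
       set_integrable lborel {0..t} (\<lambda>s. cinner (u \<otimes>\<^sub>h exp_vec f)
         (j s (compress (hat_vec f s) (torus_phi lam mu nu x) (hat_vec g s)) (v \<otimes>\<^sub>h exp_vec g))) \<and>
       cinner (u \<otimes>\<^sub>h exp_vec f) (j t x (v \<otimes>\<^sub>h exp_vec g)) =
         cinner (u \<otimes>\<^sub>h exp_vec f) (x v \<otimes>\<^sub>h exp_vec g) +
         (LINT s:{0..t}|lborel. cinner (u \<otimes>\<^sub>h exp_vec f)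
           (j s (compress (hat_vec f s) (torus_phi lam mu nu x) (hat_vec g s)) (v \<otimes>\<^sub>h exp_vec g))))"
proof (intro exI[of _ "torus_flow mu nu"] conjI allI impI ballI)
  fix t :: real
  show "unital_star_hom (nc_torus lam) (torus_flow mu nu t)"
    using unital_star_hom_ampl[OF unitary_flow_unitary[OF assms(2,3)] nc_torus_adjointable[OF assms(1)]]
    unfolding torus_flow_def[abs_def] .
  show "adapted (nc_torus lam) (torus_flow mu nu)"
    by (rule torus_flow_adapted[OF assms(2,3,1)])
qed (rule torus_flow_integral[OF assms(2,3,1,4)]; assumption)+

end
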